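(* Let $H$ be a separable Hilbert space, $E$ a separable Banach space, and $\{\eta_k\}_{k\in\mathbb Z}$ a stationary $E$-valued process such that $\mathcal K:=\operatorname{supp}\mathcal D(\eta_k)$ is a compact subset of $E$. Let $S:H\times E\to H$ be twice continuously differentiable and bounded on bounded subsets together with its derivatives up to second order, and let $X\subset H$ be a compact set such that $S(X\times\mathcal K)\subset X$. Suppose that Hypotheses (SF), (GD), (ALC), (DLP$'$) and (SRZ) stated in the context are fulfilled. Then the system $u_k=S(u_{k-1},\eta_k)$, $k\ge1$, is exponentially mixing in the dual-Lipschitz norm: there are a measure $\mu\in\mathcal P(X)$ and positive numbers $C$ and $\gamma$ such that, for any $u\in X$, the trajectory with $u_0=u$ satisfies $$\|\mathcal D(u_k)-\mu\|_L^*\le Ce^{-\gamma k},\qquad k\ge0.$$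
   Context: Notation. $\mathcal P(Y)$: Borel probability measures on $Y$; $\mathcal D(\cdot)$: law; $\|\mu-\nu\|_{\mathrm{var}}=\sup_\Gamma|\mu(\Gamma)-\nu(\Gamma)|$; $\|\mu-\nu\|_L^*=\sup|\langle f,\mu\rangle-\langle f,\nu\rangle|$ over Lipschitz $f$ with $|f|\le1$, $\operatorname{Lip}(f)\le1$. $\mathbb Z_-=\{0,-1,-2,\dots\}$; $\boldsymbol{\mathcal K}=\mathcal K^{\mathbb Z_-}$ carries the distance $\mathrm d(\boldsymbol\xi,\boldsymbol\xi')=\sum_{k\le0}\iota^k\|\xi_k-\xi'_k\|_E$ with a fixed $\iota>1$. $\sigma\in\mathcal P(\boldsymbol{\mathcal K})$ is the law of $\{\eta_k,k\in\mathbb Z_-\}$ and $\mathcal E:=\operatorname{supp}\sigma$. $Q(\boldsymbol\xi;\cdot)$ is the conditional law of $\eta_1$ given $\{\eta_k\}_{k\in\mathbb Z_-}=\boldsymbol\xi$. For integers $k\ge1$, $$\boldsymbol Q_k(\boldsymbol\xi;dy_1,\dots,dy_k)=Q(\boldsymbol\xi;dy_1)Q(\boldsymbol\xi_1;dy_2)\cdots Q(\boldsymbol\xi_{k-1};dy_k),$$ where $\boldsymbol\xi_l=(\boldsymbol\xi,y_1,\dots,y_l)$ is the concatenation; for $k\ge0,m\ge1$, $Q_k^m(\boldsymbol\xi;\cdot)$ is the projection of $\boldsymbol Q_{k+m}(\boldsymbol\xi;\cdot)$ to the last $m$ components. $\mathbf 0_n=(0,\dots,0)\in E^n$ and $\mathcal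 O_\delta(\mathbf 0_n)=B_E(0,\delta)\times\cdots\times B_E(0,\delta)$ ($n$ open balls). $S_k(u;\mathbf 0_k)$ is the value $u_k$ of the trajectory $u_j=S(u_{j-1},0)$, $u_0=u$. (SF) $Q(\boldsymbol\xi;\cdot)$ can be chosen to be a continuous map from $\mathcal E$ to $\mathcal P(\mathcal K)\subset\mathcal P(E)$ (weak topology), and there is $C>0$ with $\|Q(\boldsymbol\xi;\cdot)-Q(\boldsymbol\xi';\cdot)\|_{\mathrm{var}}\le C\,\mathrm d(\boldsymbol\xi,\boldsymbol\xi')$ for $\boldsymbol\xi,\boldsymbol\xi'\in\mathcal E$. (GD) There are an integer $k\ge1$ and $a\in(0,1)$ such that $\|S_k(u;\mathbf 0_k)\|_H\le a\|u\|_H$ for any $u\in H$. (ALC) There are an open set $O\supset X\times\mathcal K$ in $H\times E$ and a finite-dimensional determining subspace $G\subset H$ such that the closure of the image of $D_\eta S(u,\eta):E\to H$ contains $G$ for any $(u,\eta)\in O$. Here a closed subspace $G\subset H$ is determining if there is $\varkappa\in(0,1)$ such that $\|(I-\mathsf P_G)D_uS(u,\eta)\|_{\mathcal L(H)}\le\varkappa$ for any $u\in X$, $\eta\in\mathcal K$, where $\mathsf P_G$ is the orthogonal projection to $G$. (DLP$'$) There is an increasing sequence of finite-dimensional subspaces $F_n\subset E$ with complementary subspaces $F_n^\dagger\subset E$ and projections $\mathsf P_n:E\to F_n$ (along $F_n^\dagger$) such that $\cup_nF_n$ is dense in $E$, the norms of $\mathsf P_n$ are bounded uniformly in $n$, and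 for each $n\ge1$ and $\boldsymbol\xi\in\mathcal E$, $$Q(\boldsymbol\xi;dy)=Q_n^\dagger(\boldsymbol\xi;dy_n^\dagger)\,Q_n(\boldsymbol\xi,y_n^\dagger;dy_n),\qquad Q_n(\boldsymbol\xi,y_n^\dagger;dy_n)=\rho_n(\boldsymbol\xi,y_n^\dagger,y_n)\,\ell_n(dy_n),$$ where $y=(y_n,y_n^\dagger)$ corresponds to $E=F_n\dotplus F_n^\dagger$, $Q_n^\dagger(\boldsymbol\xi;\cdot)$ is the image of $Q(\boldsymbol\xi;\cdot)$ under $I-\mathsf P_n$, $\ell_n$ is Lebesgue measure on $F_n$, and $\rho_n:\mathcal E\times E\to\mathbb R_+$ is Lipschitz continuous. (If $\dim E<\infty$, one takes $F_n=E$, $F_n^\dagger=\{0\}$.) (SRZ) For any $n\in\mathbb N$ and $\delta>0$ there is an integer $s\ge0$ such that $\inf_{\boldsymbol\xi\in\mathcal E}Q_s^n(\boldsymbol\xi;\mathcal O_\delta(\mathbf 0_n))>0$. *)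

theory Defs
  imports "HOL-Probability.Probability"
begin

section \<open>Measures\<close>

text \<open>The set \<open>prob_on Y\<close> is \<open>\<P>(Y)\<close>, viewed as the set of Borel probability measures on the ambient
  space that charge only \<open>Y\<close>.\<close>

definition prob_on :: "'a::topological_space set \<Rightarrow> 'a measure set" where
  "prob_on Y = {\<mu>. prob_space \<mu> \<and> sets \<mu> = sets borel \<and> emeasure \<mu> Y = 1}"

definition msupport :: "'a::topological_space measure \<Rightarrow> 'a set" where
  "msupport \<mu> = {x. \<forall>U. open U \<and> x \<in> U \<longrightarrow> emeasure \<mu> U > 0}"

text \<open>The weak topology on Borel probability measures: the coarsest one for which integration
  against every bounded continuous function is continuous.\<close>

definition weak_topology :: "'a::topological_space measure topology" where
  "weak_topology = topology_generated_by
     {{\<mu> \<in> prob_on UNIV. (\<integral>x. f x \<partial>\<mu>) \<in> U} | (f :: 'a \<Rightarrow> real) U.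
        continuous_on UNIV f \<and> bounded (range f) \<and> open U}"

definition var_dist :: "'a::topological_space measure \<Rightarrow> 'a measure \<Rightarrow> real" where
  "var_dist \<mu> \<nu> = (SUP \<Gamma> \<in> sets borel. \<bar>measure \<mu> \<Gamma> - measure \<nu> \<Gamma>\<bar>)"

definition dual_lip_dist :: "'a::metric_space measure \<Rightarrow> 'a measure \<Rightarrow> real" where
  "dual_lip_dist \<mu> \<nu> =
     (SUP f \<in> {f :: 'a \<Rightarrow> real. (\<forall>x. \<bar>f x\<bar> \<le> 1) \<and> 1-lipschitz_on UNIV f}.
        \<bar>(\<integral>x. f x \<partial>\<mu>) - (\<integral>x. f x \<partial>\<nu>)\<bar>)"

section \<open>The noise and its conditional law\<close>

definition stationary_process ::
    "'w measure \<Rightarrow> (int \<Rightarrow> 'w \<Rightarrow> 'e::topological_space) \<Rightarrow> bool" where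
  "stationary_process M \<eta> \<longleftrightarrow>
     (\<forall>k. \<eta> k \<in> borel_measurable M) \<and>
     (\<forall>h. distr M (Pi\<^sub>M UNIV (\<lambda>_. borel)) (\<lambda>\<omega> k. \<eta> (k + h) \<omega>)
        = distr M (Pi\<^sub>M UNIV (\<lambda>_. borel)) (\<lambda>\<omega> k. \<eta> k \<omega>))"

text \<open>A history indexed by the nonpositive integers is encoded as a function on \<open>nat\<close>: entry \<open>i\<close>
  is the entry at time \<open>-i\<close>. The space of histories carries the product topology, which on
  sequences in a bounded set is the topology of \<open>hist_dist \<iota>\<close> for \<open>\<iota> > 1\<close>.\<close>

definition past :: "(int \<Rightarrow> 'w \<Rightarrow> 'e) \<Rightarrow> 'w \<Rightarrow> nat \<Rightarrow> 'e" where
  "past \<eta> \<omega> = (\<lambda>i. \<eta> (- int i) \<omega>)"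

definition hist_dist :: "real \<Rightarrow> (nat \<Rightarrow> 'e::real_normed_vector) \<Rightarrow> (nat \<Rightarrow> 'e) \<Rightarrow> real" where
  "hist_dist \<iota> \<xi> \<xi>' = (\<Sum>i. norm (\<xi> i - \<xi>' i) / \<iota> ^ i)"

definition past_law ::
    "'w measure \<Rightarrow> (int \<Rightarrow> 'w \<Rightarrow> 'e::topological_space) \<Rightarrow> (nat \<Rightarrow> 'e) measure" where
  "past_law M \<eta> = distr M borel (past \<eta>)"

definition past_supp ::
    "'w measure \<Rightarrow> (int \<Rightarrow> 'w \<Rightarrow> 'e::topological_space) \<Rightarrow> (nat \<Rightarrow> 'e) set" where
  "past_supp M \<eta> = msupport (past_law M \<eta>)"

text \<open>\<open>Q\<close> is a version of the regular conditional law of \<open>\<eta> 1\<close> given the past. It is a kernel on the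
  whole sequence space; nothing below depends on its values outside \<open>past_supp M \<eta>\<close>, and a
  version that is continuous on this set is uniquely determined there.\<close>

definition conditional_law ::
    "'w measure \<Rightarrow> (int \<Rightarrow> 'w \<Rightarrow> 'e::topological_space) \<Rightarrow> ((nat \<Rightarrow> 'e) \<Rightarrow> 'e measure) \<Rightarrow> bool" where
  "conditional_law M \<eta> Q \<longleftrightarrow>
     Q \<in> measurable borel (prob_algebra borel) \<and>
     (\<forall>A \<in> sets borel. \<forall>B \<in> sets borel.
        emeasure M {\<omega> \<in> space M. past \<eta> \<omega> \<in> A \<and> \<eta> 1 \<omega> \<in> B}
          = (\<integral>\<^sup>+\<xi>\<in>A. emeasure (Q \<xi>) B \<partial>past_law M \<eta>))"

text \<open>The history \<open>(\<xi>, y 1, \<dots>, y k)\<close>, whose most recent entry is \<open>y k\<close>.\<close>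

definition hist_append :: "(nat \<Rightarrow> 'e) \<Rightarrow> nat \<Rightarrow> (nat \<Rightarrow> 'e) \<Rightarrow> nat \<Rightarrow> 'e" where
  "hist_append \<xi> k y = (\<lambda>i. if i < k then y (k - i) else \<xi> (i - k))"

text \<open>Tuples \<open>(y 1, \<dots>, y k)\<close> are elements of \<open>{1..k} \<rightarrow>\<^sub>E UNIV\<close>.\<close>

primrec path_kernel ::
    "((nat \<Rightarrow> 'e::topological_space) \<Rightarrow> 'e measure) \<Rightarrow> nat \<Rightarrow> (nat \<Rightarrow> 'e) \<Rightarrow> (nat \<Rightarrow> 'e) measure" where
  "path_kernel Q 0 \<xi> = return (Pi\<^sub>M {1..0} (\<lambda>_. borel)) (\<lambda>_. undefined)"
| "path_kernel Q (Suc k) \<xi> =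
     path_kernel Q k \<xi> \<bind>
       (\<lambda>y. distr (Q (hist_append \<xi> k y)) (Pi\<^sub>M {1..Suc k} (\<lambda>_. borel)) (\<lambda>z. y(Suc k := z)))"

definition last_kernel ::
    "((nat \<Rightarrow> 'e::topological_space) \<Rightarrow> 'e measure) \<Rightarrow> nat \<Rightarrow> nat \<Rightarrow> (nat \<Rightarrow> 'e) \<Rightarrow> (nat \<Rightarrow> 'e) measure" where
  "last_kernel Q k m \<xi> =
     distr (path_kernel Q (k + m) \<xi>) (Pi\<^sub>M {1..m} (\<lambda>_. borel)) (\<lambda>y. \<lambda>i\<in>{1..m}. y (k + i))"

definition hyp_SF ::
    "real \<Rightarrow> 'e::real_normed_vector set \<Rightarrow> (nat \<Rightarrow> 'e) set \<Rightarrow> ((nat \<Rightarrow> 'e) \<Rightarrow> 'e measure) \<Rightarrow> bool" where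
  "hyp_SF \<iota> K \<E> Q \<longleftrightarrow>
     continuous_map (top_of_set \<E>) (subtopology weak_topology (prob_on K)) Q \<and>
     (\<exists>C>0. \<forall>\<xi>\<in>\<E>. \<forall>\<xi>'\<in>\<E>. var_dist (Q \<xi>) (Q \<xi>') \<le> C * hist_dist \<iota> \<xi> \<xi>')"

definition hyp_SRZ ::
    "(nat \<Rightarrow> 'e::real_normed_vector) set \<Rightarrow> ((nat \<Rightarrow> 'e) \<Rightarrow> 'e measure) \<Rightarrow> bool" where
  "hyp_SRZ \<E> Q \<longleftrightarrow>
     (\<forall>n\<ge>1. \<forall>\<delta>>0. \<exists>s.
        (INF \<xi>\<in>\<E>. measure (last_kernel Q s n \<xi>) (PiE {1..n} (\<lambda>_. ball 0 \<delta>))) > 0)"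

subsection \<open>Decomposability with Lipschitz densities\<close>

text \<open>Lebesgue measure on the finite-dimensional space spanned by the linearly independent set \<open>B\<close>,
  in the coordinates given by \<open>B\<close>. Another basis of the same space changes it by a positive
  constant factor only.\<close>

definition span_lebesgue :: "'e::real_normed_vector set \<Rightarrow> 'e measure" where
  "span_lebesgue B = distr (Pi\<^sub>M B (\<lambda>_. lborel)) borel (\<lambda>c. \<Sum>b\<in>B. c b *\<^sub>R b)"

definition is_lebesgue_measure_on :: "'e::real_normed_vector set \<Rightarrow> 'e measure \<Rightarrow> bool" where
  "is_lebesgue_measure_on F leb \<longleftrightarrow>
     (\<exists>B. finite B \<and> independent B \<and> span B = F \<and> leb = span_lebesgue B)"

definition is_projection_along ::
    "'e::real_normed_vector set \<Rightarrow> 'e set \<Rightarrow> ('e \<Rightarrow>\<^sub>L 'e) \<Rightarrow> bool" where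
  "is_projection_along F F' P \<longleftrightarrow>
     subspace F \<and> subspace F' \<and> F \<inter> F' = {0} \<and> {x + z | x z. x \<in> F \<and> z \<in> F'} = UNIV \<and>
     (\<forall>x\<in>F. \<forall>z\<in>F'. blinfun_apply P (x + z) = x)"

text \<open>The density \<open>\<rho> n \<xi>\<close> is a function of \<open>y = z + x\<close>, where \<open>z = y - P n y\<close> and \<open>x = P n y\<close>
  are the components of \<open>y\<close> in \<open>F' n\<close> and \<open>F n\<close>. The product \<open>\<E> \<times> E\<close> carries the sum metric.\<close>

definition hyp_DLP ::
    "real \<Rightarrow> (nat \<Rightarrow> 'e::real_normed_vector) set \<Rightarrow> ((nat \<Rightarrow> 'e) \<Rightarrow> 'e measure) \<Rightarrow> bool" where
  "hyp_DLP \<iota> \<E> Q \<longleftrightarrow>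
     (\<exists>(F :: nat \<Rightarrow> 'e set) (F' :: nat \<Rightarrow> 'e set) (P :: nat \<Rightarrow> 'e \<Rightarrow>\<^sub>L 'e)
        (leb :: nat \<Rightarrow> 'e measure) (\<rho> :: nat \<Rightarrow> (nat \<Rightarrow> 'e) \<Rightarrow> 'e \<Rightarrow> real).
        incseq F \<and>
        (\<forall>n. is_projection_along (F n) (F' n) (P n)) \<and>
        closure (\<Union>n. F n) = UNIV \<and>
        (\<exists>c. \<forall>n. norm (P n) \<le> c) \<and>
        (\<forall>n. is_lebesgue_measure_on (F n) (leb n)) \<and>
        (\<forall>n. \<forall>\<xi>\<in>\<E>. \<forall>y. \<rho> n \<xi> y \<ge> 0) \<and>
        (\<forall>n. \<exists>L. \<forall>\<xi>\<in>\<E>. \<forall>\<xi>'\<in>\<E>. \<forall>y y'.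
           \<bar>\<rho> n \<xi> y - \<rho> n \<xi>' y'\<bar> \<le> L * (hist_dist \<iota> \<xi> \<xi>' + norm (y - y'))) \<and>
        (\<forall>n. \<forall>\<xi>\<in>\<E>. \<forall>A \<in> sets borel.
           emeasure (Q \<xi>) A =
             (\<integral>\<^sup>+z. (\<integral>\<^sup>+x. indicator A (z + x) * ennreal (\<rho> n \<xi> (z + x)) \<partial>leb n)
                \<partial>distr (Q \<xi>) borel (\<lambda>y. y - P n y))))"

section \<open>The dynamics\<close>

primrec traj :: "('h \<times> 'e \<Rightarrow> 'h) \<Rightarrow> 'h \<Rightarrow> (nat \<Rightarrow> 'e) \<Rightarrow> nat \<Rightarrow> 'h" where
  "traj S u \<zeta> 0 = u"
| "traj S u \<zeta> (Suc k) = S (traj S u \<zeta> k, \<zeta> (Suc k))"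

text \<open>Twice continuously Frechet differentiable, with \<open>S\<close>, \<open>DS\<close> and \<open>D\<^sup>2S\<close> bounded on bounded sets.\<close>

definition C2_bounded :: "('a::real_normed_vector \<Rightarrow> 'b::real_normed_vector) \<Rightarrow> bool" where
  "C2_bounded S \<longleftrightarrow>
     (\<exists>(S' :: 'a \<Rightarrow> 'a \<Rightarrow>\<^sub>L 'b) (S'' :: 'a \<Rightarrow> 'a \<Rightarrow>\<^sub>L ('a \<Rightarrow>\<^sub>L 'b)).
        (\<forall>z. (S has_derivative blinfun_apply (S' z)) (at z)) \<and>
        (\<forall>z. (S' has_derivative blinfun_apply (S'' z)) (at z)) \<and>
        continuous_on UNIV S'' \<and>
        (\<forall>B. bounded B \<longrightarrow> bounded (S ` B) \<and> bounded (S' ` B) \<and> bounded (S'' ` B)))"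

definition hyp_GD :: "('h::real_normed_vector \<times> 'e::real_normed_vector \<Rightarrow> 'h) \<Rightarrow> bool" where
  "hyp_GD S \<longleftrightarrow>
     (\<exists>k\<ge>1. \<exists>a. 0 < a \<and> a < 1 \<and> (\<forall>u. norm (traj S u (\<lambda>_. 0) k) \<le> a * norm u))"

definition orth_proj :: "'h::real_inner set \<Rightarrow> 'h \<Rightarrow> 'h" where
  "orth_proj G x = (THE y. y \<in> G \<and> (\<forall>z\<in>G. (x - y) \<bullet> z = 0))"

definition determining ::
    "('h::real_inner \<times> 'e::real_normed_vector \<Rightarrow> 'h) \<Rightarrow> 'h set \<Rightarrow> 'e set \<Rightarrow> 'h set \<Rightarrow> bool" where
  "determining S X K G \<longleftrightarrow>
     subspace G \<and> closed G \<and>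
     (\<exists>\<kappa>. 0 < \<kappa> \<and> \<kappa> < 1 \<and>
        (\<forall>u\<in>X. \<forall>\<zeta>\<in>K.
           onorm (\<lambda>v. frechet_derivative (\<lambda>w. S (w, \<zeta>)) (at u) v
                     - orth_proj G (frechet_derivative (\<lambda>w. S (w, \<zeta>)) (at u) v)) \<le> \<kappa>))"

definition hyp_ALC ::
    "('h::real_inner \<times> 'e::real_normed_vector \<Rightarrow> 'h) \<Rightarrow> 'h set \<Rightarrow> 'e set \<Rightarrow> bool" where
  "hyp_ALC S X K \<longleftrightarrow>
     (\<exists>W G. open W \<and> X \<times> K \<subseteq> W \<and>
        (\<exists>B. finite B \<and> G = span B) \<and> determining S X K G \<and>
        (\<forall>(u, \<zeta>)\<in>W. G \<subseteq> closure (range (frechet_derivative (\<lambda>y. S (u, y)) (at \<zeta>)))))"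

end

theory Submission
  imports Defs
begin

text \<open>Record the past of the noise together with the state: \<open>(u, \<xi>)\<close> is a Markov chain on
  \<open>X \<times> \<E>\<close> with transition operator \<open>step\<close>. It suffices that \<open>step\<close> contracts, after
  finitely many iterations, the Lipschitz seminorm of functions with values in \<open>[0, 1]\<close> for the
  distance \<open>min 1 (dst \<theta> \<tau>)\<close>, where \<open>dst \<theta> \<tau> (u, \<xi>) (u', \<xi>') = (|u - u'| + \<theta> d(\<xi>, \<xi>')) / \<tau>\<close>.

  For points at distance less than 1, the difference \<open>S (u, y) - S (u', y)\<close> is compensated modulo the
  determining subspace by moving the noise to \<open>\<Phi> y\<close>, where \<open>\<Phi> y - y\<close> is an approximate solution
  of the linearised control problem in some \<open>F\<^sub>n\<close>. Since the conditional densities along \<open>F\<^sub>n\<close> are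
  Lipschitz, this changes the law of the noise by \<open>O(|u - u'|)\<close> in variation, which is a small
  multiple of the distance once \<open>\<tau>\<close> is small. The past contributes the factor \<open>1 / \<iota>\<close>, because
  the new component of the noise shifts the old ones by one place.

  For points at distance at least 1, with positive probability the noise stays near zero for a long
  time, by (SRZ). Then the state is small by (GD), the recent past is nearly zero, and two such
  trajectories are at distance at most 1/2.

  The contraction makes the laws of \<open>u_k\<close> Cauchy, and a weak limit point is the measure \<open>\<mu>\<close>.\<close>

section \<open>Shifts of laws with Lipschitz densities\<close>

text \<open>No coupling is constructed. Laws are compared by one-sided inequalities between
  integrals of functions with values in [0, 1], and exchanging the two points gives absolute values.
  A change of law in variation costs its size times the oscillation of the test function. This
  oscillation is at most 1 however small \<open>\<tau>\<close> is, whereas |u - u'| is at most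
  \<open>\<tau>\<close> times the distance, so the cost acquires a factor \<open>\<tau>\<close>.
  Moving the noise by O(|u - u'|) also moves the newest entry of the history; hence
  \<open>\<theta>\<close> is fixed first, with \<open>\<kappa> + \<theta> * C < 1\<close>, and
  \<open>\<tau>\<close> afterwards. The control exists only for |u - u'| \<le> \<open>d0\<close>,
  and \<open>\<tau> \<le> d0\<close> makes every pair at distance below 1 satisfy this.

  The obstacle is to transport the law of the noise by a nonlinear map of a space that may have
  infinite dimension. Shifting along one basis vector of \<open>F n\<close> at a time reduces the
  change of variables to increasing functions on the line, with no Jacobian to compute.\<close>

lemma borel_measure_eqI_Ioc:
  fixes M N :: "real measure"
  assumes "sets M = sets borel" "sets N = sets borel"
    and eq: "\<And>a b. a \<le> b \<Longrightarrow> emeasure M {a<..b} = emeasure N {a<..b}"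
    and fin: "\<And>a b. emeasure M {a<..b} \<noteq> \<infinity>"
  shows "M = N"
proof -
  have borel_Ioc: "sets (borel :: real measure) = sigma_sets UNIV (range (\<lambda>(a, b). {a<..b}))"
    by (subst borel_sigma_sets_Ioc) (rule sets_measure_of, simp)
  show ?thesis
  proof (rule measure_eqI_generator_eq[where \<Omega>=UNIV and E="range (\<lambda>(a,b). {a<..b})"
          and A="\<lambda>n::nat. {- real n<..real n}"])
    show "Int_stable (range (\<lambda>(a, b). {a<..b::real}))"
      by (clarsimp simp: Int_stable_def image_iff) (metis Int_greaterThanAtMost)
    show "emeasure M X = emeasure N X" if "X \<in> range (\<lambda>(a, b). {a<..b})" for X
    proof -
      from that obtain a b where X: "X = {a<..b}" by auto
      show ?thesis using eq[of a b] by (cases "a \<le> b") (auto simp: X)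
    qed
    show "sets M = sigma_sets UNIV (range (\<lambda>(a, b). {a<..b}))"
      "sets N = sigma_sets UNIV (range (\<lambda>(a, b). {a<..b}))"
      using assms(1,2) by (simp_all add: borel_Ioc)
    show "(\<Union>n::nat. {- real n<..real n}) = UNIV"
    proof (intro equalityI subsetI UNIV_I)
      fix x :: real
      obtain n where "\<bar>x\<bar> < real n" using reals_Archimedean2 by blast
      then show "x \<in> (\<Union>n::nat. {- real n<..real n})" by (intro UN_I[of n]) auto
    qed
  qed (use fin in auto)
qed

text \<open>The image of Lebesgue measure under \<open>T\<close> is the Stieltjes measure of the inverse \<open>V\<close> of \<open>T\<close>.
  It is at most \<open>1 / c\<close> times Lebesgue measure, because \<open>x / c - V x\<close> is nondecreasing.\<close>

lemma nn_integral_expanding_le: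
  fixes T :: "real \<Rightarrow> real"
  assumes c: "0 < c" and cont: "continuous_on UNIV T"
    and exp: "\<And>s t. s \<le> t \<Longrightarrow> c * (t - s) \<le> T t - T s"
    and g[measurable]: "g \<in> borel_measurable borel"
  shows "(\<integral>\<^sup>+t. g (T t) \<partial>lborel) \<le> ennreal (1 / c) * (\<integral>\<^sup>+t. g t \<partial>lborel)"
proof -
  have [measurable]: "T \<in> borel_measurable borel"
    using cont by (rule borel_measurable_continuous_onI)
  have mono_iff: "T s \<le> T t \<longleftrightarrow> s \<le> t" for s t
  proof
    assume "T s \<le> T t" show "s \<le> t"
    proof (rule ccontr)
      assume "\<not> s \<le> t"
      then have "c * (s - t) \<le> T s - T t" "0 < c * (s - t)" using exp[of t s] c by auto
      with \<open>T s \<le> T t\<close> show False by linarith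
    qed
  next
    assume "s \<le> t"
    then have "0 \<le> c * (t - s)" using c by simp
    with exp[OF \<open>s \<le> t\<close>] show "T s \<le> T t" by linarith
  qed
  have "\<exists>t. T t = x" for x
  proof -
    \<comment> \<open>On \<open>{- r..r}\<close> the expansion carries \<open>T\<close> at least |x
      - T 0| away from \<open>T 0\<close> on either side, so the intermediate value theorem reaches
      x.\<close>
    define r where "r = \<bar>x - T 0\<bar> / c"
    have r: "0 \<le> r" "c * r = \<bar>x - T 0\<bar>" using c by (auto simp: r_def)
    have 1: "T (- r) \<le> x" using exp[of "- r" 0] r by (auto simp: algebra_simps)
    have 2: "x \<le> T r" using exp[of 0 r] r by (auto simp: algebra_simps)
    from IVT'[of T "- r" x r] 1 2 r cont show ?thesis
      by (auto intro: continuous_on_subset)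
  qed
  then obtain V where V: "\<And>x. T (V x) = x" by metis
  have V_mono: "a \<le> b \<Longrightarrow> V a \<le> V b" for a b
    using mono_iff[of "V a" "V b"] V by simp
  have V_lip: "a \<le> b \<Longrightarrow> V b - V a \<le> (b - a) / c" for a b
    using exp[of "V a" "V b"] V V_mono[of a b] c by (simp add: field_simps)
  have V_dist: "\<bar>V b - V a\<bar> \<le> \<bar>b - a\<bar> / c" for a b
    using V_lip[of a b] V_lip[of b a] V_mono[of a b] V_mono[of b a] by (cases "a \<le> b") auto
  have V_cont: "continuous_on UNIV V"
  proof (rule continuous_on_iff[THEN iffD2], intro ballI allI impI)
    fix a e :: real assume e: "0 < e"
    show "\<exists>d>0. \<forall>b\<in>UNIV. dist b a < d \<longrightarrow> dist (V b) (V a) < e"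
    proof (intro exI[of _ "e * c"] conjI ballI impI)
      fix b assume "dist b a < e * c"
      then have "\<bar>b - a\<bar> / c < e" using c by (simp add: dist_real_def field_simps)
      then show "dist (V b) (V a) < e" using V_dist[of b a] by (simp add: dist_real_def)
    qed (use e c in simp)
  qed
  define F where "F x = x / c - V x" for x
  have F_mono: "a \<le> b \<Longrightarrow> F a \<le> F b" for a b
    using V_lip[of a b] by (simp add: F_def diff_divide_distrib)
  have F_cont: "continuous_on UNIV F"
    unfolding F_def by (intro continuous_intros V_cont) (use c in auto)
  have right: "continuous (at_right a) V" "continuous (at_right a) F" for a
    using V_cont F_cont by (auto simp: continuous_on_eq_continuous_at intro: continuous_at_imp_continuous_at_within)
  \<comment> \<open>The sum of the Stieltjes measures of \<open>V\<close> and \<open>F\<close> is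
    the one of x / c. It visibly dominates the measure of \<open>V\<close>, and no difference of
    measures has to be formed.\<close>
  define N where "N = measure_of UNIV (sets borel)
      (\<lambda>A. emeasure (interval_measure V) A + emeasure (interval_measure F) A)"
  have sN: "sets N = sets borel" unfolding N_def
    by (simp add: sigma_algebra.sets_measure_of_eq[OF sets.sigma_algebra_axioms[of borel, simplified]])
  have eN: "emeasure N A = emeasure (interval_measure V) A + emeasure (interval_measure F) A"
    if "A \<in> sets borel" for A
  proof (rule emeasure_measure_of[OF N_def])
    show "countably_additive (sets N) (\<lambda>A. emeasure (interval_measure V) A + emeasure (interval_measure F) A)"
    proof (rule countably_additiveI)
      fix A :: "nat \<Rightarrow> real set"
      assume A: "range A \<subseteq> sets N" "disjoint_family A"
      then have "range A \<subseteq> sets borel" by (simp add: sN)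
      with A(2) show "(\<Sum>i. emeasure (interval_measure V) (A i) + emeasure (interval_measure F) (A i)) =
          emeasure (interval_measure V) (\<Union> (range A)) + emeasure (interval_measure F) (\<Union> (range A))"
        by (subst suminf_add[symmetric]) (auto simp: suminf_emeasure)
    qed
  qed (auto simp: positive_def that sN)
  have Ioc: "emeasure (distr lborel borel T) {a<..b} = ennreal (V b - V a)" if "a \<le> b" for a b
  proof -
    have "T -` {a<..b} = {V a<..V b}"
      using mono_iff[of _ "V b"] mono_iff[of _ "V a"] by (auto simp: V not_le[symmetric])
    then show ?thesis using V_mono[OF that] by (simp add: emeasure_distr)
  qed
  have TV: "distr lborel borel T = interval_measure V"
  proof (rule borel_measure_eqI_Ioc)
    show "emeasure (distr lborel borel T) {a<..b} \<noteq> \<infinity>" for a b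
      using Ioc[of a b] by (cases "a \<le> b") auto
  qed (auto simp: Ioc emeasure_interval_measure_Ioc_eq[OF V_mono right(1)])
  have N: "N = density lborel (\<lambda>_. ennreal (1 / c))"
  proof (rule borel_measure_eqI_Ioc)
    show "emeasure N {a<..b} = emeasure (density lborel (\<lambda>_. ennreal (1 / c))) {a<..b}" if "a \<le> b" for a b
    proof -
      have "emeasure N {a<..b} = ennreal (V b - V a) + ennreal (F b - F a)"
        using that by (simp add: eN emeasure_interval_measure_Ioc[OF that V_mono right(1)]
            emeasure_interval_measure_Ioc[OF that F_mono right(2)])
      also have "\<dots> = ennreal ((b - a) / c)"
        using V_mono[OF that] F_mono[OF that]
        by (simp add: ennreal_plus[symmetric] F_def diff_divide_distrib del: ennreal_plus)
      finally show ?thesis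
        using that c by (simp add: emeasure_density_const ennreal_mult'[symmetric])
    qed
    show "emeasure N {a<..b} \<noteq> \<infinity>" for a b
      by (simp add: eN emeasure_interval_measure_Ioc_eq[OF V_mono right(1)] emeasure_interval_measure_Ioc_eq[OF F_mono right(2)])
  qed (auto simp: sN)
  have "(\<integral>\<^sup>+t. g (T t) \<partial>lborel) = (\<integral>\<^sup>+t. g t \<partial>interval_measure V)"
    by (simp add: TV[symmetric] nn_integral_distr)
  also have "\<dots> \<le> (\<integral>\<^sup>+t. g t \<partial>N)"
  proof (rule nn_integral_mono_measure)
    show "interval_measure V \<le> N"
      by (subst le_measure) (simp_all add: sN eN)
  qed (simp add: sN)
  also have "\<dots> = ennreal (1 / c) * (\<integral>\<^sup>+t. g t \<partial>lborel)"
    unfolding N by (subst nn_integral_density) (simp_all add: nn_integral_cmult)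
  finally show ?thesis .
qed

text \<open>The disintegration says that \<open>Q\<close> is an image of the measure with density
  \<open>\<rho>\<close> composed with \<open>J\<close> on the product of \<open>Q\<close> and
  Lebesgue measure, the map being \<open>J\<close>. So \<open>Q\<close> occurs on both sides, but on
  the right y enters only through \<open>y - P y\<close>. The inner integral runs over coordinates,
  which can then be changed one at a time.\<close>

lemma nn_integral_disintegration:
  fixes Q :: "'e::{banach, second_countable_topology} measure" and P :: "'e \<Rightarrow>\<^sub>L 'e"
  assumes "prob_space Q" and [measurable_cong]: "sets Q = sets borel" and B: "finite B"
    and [measurable]: "\<rho> \<in> borel_measurable borel"
    and dis: "\<And>A. A \<in> sets borel \<Longrightarrow> emeasure Q A =
             (\<integral>\<^sup>+z. (\<integral>\<^sup>+x. indicator A (z + x) * ennreal (\<rho> (z + x)) \<partial>span_lebesgue B)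
                \<partial>distr Q borel (\<lambda>y. y - P y))"
    and g[measurable]: "g \<in> borel_measurable borel"
  shows "(\<integral>\<^sup>+y. g y \<partial>Q) = (\<integral>\<^sup>+y. (\<integral>\<^sup>+c. g (y - P y + (\<Sum>b\<in>B. c b *\<^sub>R b)) * ennreal (\<rho> (y - P y + (\<Sum>b\<in>B. c b *\<^sub>R b)))
            \<partial>Pi\<^sub>M B (\<lambda>_. lborel)) \<partial>Q)"
proof -
  interpret Q: prob_space Q by fact
  interpret pr: product_sigma_finite "\<lambda>_::'e. lborel :: real measure" by standard
  let ?L = "Pi\<^sub>M B (\<lambda>_. lborel :: real measure)"
  note Lsf = pr.sigma_finite[OF B]
  have [measurable]: "(\<lambda>y. blinfun_apply P y) \<in> borel_measurable borel"
    by (intro borel_measurable_continuous_onI continuous_intros)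
  have sumM[measurable]: "(\<lambda>c. \<Sum>b\<in>B. c b *\<^sub>R b) \<in> borel_measurable ?L"
    by (intro borel_measurable_sum borel_measurable_scaleR measurable_component_singleton) auto
  define J where "J = (\<lambda>(y, c). y - P y + (\<Sum>b\<in>B. c b *\<^sub>R b))"
  have J[measurable]: "J \<in> borel_measurable (Q \<Otimes>\<^sub>M ?L)"
    unfolding J_def by measurable
  have "Q = distr (density (Q \<Otimes>\<^sub>M ?L) (\<lambda>p. ennreal (\<rho> (J p)))) borel J" (is "_ = ?D")
  proof (rule measure_eqI)
    show "emeasure Q A = emeasure ?D A" if "A \<in> sets Q" for A
    proof -
      have A[measurable]: "A \<in> sets borel" using that assms(2) by simp
      have "emeasure ?D A = (\<integral>\<^sup>+p. ennreal (\<rho> (J p)) * indicator A (J p) \<partial>(Q \<Otimes>\<^sub>M ?L))"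
        by (subst emeasure_distr, simp, simp, subst emeasure_density)
          (auto intro!: nn_integral_cong simp: indicator_def)
      also have "\<dots> = (\<integral>\<^sup>+y. \<integral>\<^sup>+c. ennreal (\<rho> (J (y, c))) * indicator A (J (y, c)) \<partial>?L \<partial>Q)"
        by (rule sigma_finite_measure.nn_integral_fst[OF Lsf, symmetric]) measurable
      also have "\<dots> = (\<integral>\<^sup>+y. (\<integral>\<^sup>+x. indicator A (y - P y + x) * ennreal (\<rho> (y - P y + x)) \<partial>span_lebesgue B) \<partial>Q)"
        unfolding span_lebesgue_def
        by (intro nn_integral_cong, subst nn_integral_distr) (auto simp: J_def mult.commute)
      also have "\<dots> = emeasure Q A"
        unfolding dis[OF A]
        by (subst nn_integral_distr) (auto simp: span_lebesgue_def intro!: sigma_finite_measure.borel_measurable_nn_integral[OF Lsf]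
           simp: nn_integral_distr)
      finally show ?thesis by simp
    qed
  qed (simp add: assms(2))
  then have "(\<integral>\<^sup>+y. g y \<partial>Q) = (\<integral>\<^sup>+y. g y \<partial>?D)" by simp
  also have "\<dots> = (\<integral>\<^sup>+p. g (J p) * ennreal (\<rho> (J p)) \<partial>(Q \<Otimes>\<^sub>M ?L))"
    by (subst nn_integral_distr, simp, simp, subst nn_integral_density)
      (auto intro!: nn_integral_cong simp: mult.commute)
  also have "\<dots> = (\<integral>\<^sup>+y. \<integral>\<^sup>+c. g (J (y, c)) * ennreal (\<rho> (J (y, c))) \<partial>?L \<partial>Q)"
    by (rule sigma_finite_measure.nn_integral_fst[OF Lsf, symmetric]) measurable
  finally show ?thesis by (simp add: J_def)
qed

lemma lipschitz_real_continuous: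
  fixes f :: "'e::real_normed_vector \<Rightarrow> real"
  assumes f: "\<And>y y'. \<bar>f y - f y'\<bar> \<le> C * norm (y - y')" and C: "0 \<le> C"
  shows "continuous_on UNIV f"
  by (rule lipschitz_on_continuous_on[of C]) (use f C in \<open>auto intro!: lipschitz_onI simp: dist_norm\<close>)

text \<open>Along each line parallel to \<open>b\<close>, the map \<open>y \<mapsto> y + a y b\<close> expands distances at least by the factor
  \<open>1 - \<beta> |b|\<close>, and the density changes by at most \<open>L \<alpha> |b|\<close>.\<close>

lemma nn_integral_direction_shift:
  fixes Q :: "'e::{banach, second_countable_topology} measure" and P :: "'e \<Rightarrow>\<^sub>L 'e"
  assumes Q: "prob_space Q" "sets Q = sets borel" and B: "finite B" "b \<in> B"
    and \<rho>0: "\<And>y. 0 \<le> \<rho> y" and \<rho>lip: "\<And>y y'. \<bar>\<rho> y - \<rho> y'\<bar> \<le> L * norm (y - y')" and L: "0 \<le> L"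
    and dis: "\<And>A. A \<in> sets borel \<Longrightarrow> emeasure Q A =
             (\<integral>\<^sup>+z. (\<integral>\<^sup>+x. indicator A (z + x) * ennreal (\<rho> (z + x)) \<partial>span_lebesgue B)
                \<partial>distr Q borel (\<lambda>y. y - P y))"
    and K: "closed K" "emeasure Q K = 1"
    and box: "\<And>y c b'. y - P y + (\<Sum>b\<in>B. c b *\<^sub>R b) \<in> K \<Longrightarrow> b' \<in> B \<Longrightarrow> \<bar>c b'\<bar> \<le> R" and R: "0 \<le> R"
    and a: "\<And>y. \<bar>a y\<bar> \<le> \<alpha>" "\<And>y y'. \<bar>a y - a y'\<bar> \<le> \<beta> * norm (y - y')" and \<beta>: "0 \<le> \<beta>" "\<beta> * norm b \<le> 1/2"
    and g[measurable]: "g \<in> borel_measurable borel" and g1: "\<And>y. g y \<le> 1"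
  shows "(\<integral>\<^sup>+y. g (y + a y *\<^sub>R b) \<partial>Q) \<le> (\<integral>\<^sup>+y. g y \<partial>Q) + ennreal (2 * \<beta> * norm b + L * \<alpha> * norm b * (2 * R) ^ card B)"
proof -
  interpret Q: prob_space Q by fact
  note [measurable_cong] = Q(2)
  interpret pr: product_sigma_finite "\<lambda>_::'e. lborel :: real measure" by standard
  let ?L = "Pi\<^sub>M B (\<lambda>_. lborel :: real measure)" and ?L' = "Pi\<^sub>M (B - {b}) (\<lambda>_. lborel :: real measure)"
  note Lsf = pr.sigma_finite[OF B(1)]
  define J where "J y c = y - P y + (\<Sum>b\<in>B. c b *\<^sub>R b)" for y c
  have a0: "0 \<le> \<alpha>" using a(1)[of undefined] by linarith
  have a_cont: "continuous_on UNIV a" using lipschitz_real_continuous[OF a(2) \<beta>(1)] .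
  have \<rho>_cont: "continuous_on UNIV \<rho>" using lipschitz_real_continuous[OF \<rho>lip L] .
  have [measurable]: "\<rho> \<in> borel_measurable borel" "a \<in> borel_measurable borel"
    using a_cont \<rho>_cont by (auto intro: borel_measurable_continuous_onI)
  have [measurable]: "K \<in> sets borel" using K by auto
  have sumM[measurable]: "(\<lambda>c. \<Sum>b\<in>B. c b *\<^sub>R b) \<in> borel_measurable ?L"
    by (intro borel_measurable_sum borel_measurable_scaleR measurable_component_singleton) auto
  have [measurable]: "(\<lambda>y. blinfun_apply P y) \<in> borel_measurable borel"
    by (intro borel_measurable_continuous_onI continuous_intros)
  have JM: "(\<lambda>p. J (fst p) (snd p)) \<in> borel_measurable (Q \<Otimes>\<^sub>M ?L)" "\<And>y. J y \<in> borel_measurable ?L"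
    unfolding J_def by measurable
  note [measurable] = JM(2) measurable_compose[OF measurable_Pair JM(1), simplified]
  define c where "c = 1 - \<beta> * norm b"
  have c: "1/2 \<le> c" "c \<le> 1" using \<beta> by (auto simp: c_def)
  \<comment> \<open>This is 1 / (1 - x) \<le> 1 + 2 x for 0 \<le> x \<le> 1/2, taken at x =
    \<open>\<beta> * norm b\<close>.\<close>
  have ic: "1 / c \<le> 1 + 2 * \<beta> * norm b"
  proof -
    have "1 \<le> (1 + 2 * (\<beta> * norm b)) * (1 - \<beta> * norm b)"
      using mult_nonneg_nonneg[of "\<beta> * norm b" "1 - 2 * (\<beta> * norm b)"] \<beta> by (simp add: algebra_simps)
    then show ?thesis using c by (simp add: divide_le_eq c_def mult.assoc)
  qed
  \<comment> \<open>The density changes by an additive constant, whose Lebesgue integral over the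
    whole space is infinite. Points of \<open>K\<close> have coordinates in this box, and
    restricting to them makes the error finite.\<close>
  let ?box = "PiE B (\<lambda>_. {-R..R})"
  have [measurable]: "?box \<in> sets ?L" using B by (intro sets_PiM_I_finite) auto
  have line: "(\<integral>\<^sup>+t. indicator K (J y (x(b:=t))) * g (J y (x(b:=t)) + a (J y (x(b:=t))) *\<^sub>R b) * ennreal (\<rho> (J y (x(b:=t)))) \<partial>lborel)
     \<le> ennreal (1 / c) * (\<integral>\<^sup>+t. g (J y (x(b:=t))) * ennreal (\<rho> (J y (x(b:=t)))) \<partial>lborel)
       + ennreal (L * \<alpha> * norm b) * (\<integral>\<^sup>+t. indicator ?box (x(b:=t)) \<partial>lborel)"
    if x: "x \<in> space ?L'" for x y
  proof -
    define z where "z = y - P y + (\<Sum>b\<in>B - {b}. x b *\<^sub>R b)"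
    have Jz: "J y (x(b:=t)) = z + t *\<^sub>R b" for t
      using B unfolding J_def z_def by (subst sum.remove[of B b]) (auto intro!: sum.cong)
    define T where "T t = t + a (z + t *\<^sub>R b)" for t
    have T_cont: "continuous_on UNIV T" unfolding T_def
      by (intro continuous_intros continuous_on_compose2[OF a_cont]) auto
    have T_exp: "c * (t - s) \<le> T t - T s" if "s \<le> t" for s t
    proof -
      have "(z + t *\<^sub>R b) - (z + s *\<^sub>R b) = (t - s) *\<^sub>R b" by (simp add: algebra_simps)
      then have "norm ((z + t *\<^sub>R b) - (z + s *\<^sub>R b)) = (t - s) * norm b" using that by simp
      then have "\<bar>a (z + t *\<^sub>R b) - a (z + s *\<^sub>R b)\<bar> \<le> \<beta> * norm b * (t - s)"
        using a(2)[of "z + t *\<^sub>R b" "z + s *\<^sub>R b"] by (simp add: mult_ac)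
      then show ?thesis unfolding T_def c_def by (simp add: algebra_simps)
    qed
    have [measurable]: "T \<in> borel_measurable borel" using T_cont by (rule borel_measurable_continuous_onI)
    define h where "h t = g (z + t *\<^sub>R b) * ennreal (\<rho> (z + t *\<^sub>R b))" for t
    have [measurable]: "h \<in> borel_measurable borel" unfolding h_def by measurable
    have xt: "x(b:=t) \<in> extensional B" for t
      using x B(2) by (auto simp: space_PiM PiE_def extensional_def)
    have "(\<integral>\<^sup>+t. indicator K (J y (x(b:=t))) * g (J y (x(b:=t)) + a (J y (x(b:=t))) *\<^sub>R b) * ennreal (\<rho> (J y (x(b:=t)))) \<partial>lborel)
       \<le> (\<integral>\<^sup>+t. h (T t) + ennreal (L * \<alpha> * norm b) * indicator ?box (x(b:=t)) \<partial>lborel)"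
    proof (rule nn_integral_mono)
      fix t
      have eq: "z + t *\<^sub>R b + a (z + t *\<^sub>R b) *\<^sub>R b = z + T t *\<^sub>R b" by (simp add: T_def algebra_simps)
      show "indicator K (J y (x(b:=t))) * g (J y (x(b:=t)) + a (J y (x(b:=t))) *\<^sub>R b) * ennreal (\<rho> (J y (x(b:=t))))
         \<le> h (T t) + ennreal (L * \<alpha> * norm b) * indicator ?box (x(b:=t))"
      proof (cases "z + t *\<^sub>R b \<in> K")
        case True
        then have "x(b:=t) \<in> ?box"
          using box[of y "x(b:=t)"] xt[of t] Jz[of t] unfolding J_def[symmetric]
          by (auto simp: PiE_def abs_le_iff minus_le_iff fun_upd_def)
        \<comment> \<open>The substitution along the line requires the density at the moved point;
          passing to it from the density at the original point is what costs the additive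
          constant.\<close>
        have "\<rho> (z + t *\<^sub>R b) \<le> \<rho> (z + T t *\<^sub>R b) + L * norm ((z + t *\<^sub>R b) - (z + T t *\<^sub>R b))"
          using \<rho>lip[of "z + t *\<^sub>R b" "z + T t *\<^sub>R b"] by linarith
        also have "(z + t *\<^sub>R b) - (z + T t *\<^sub>R b) = - a (z + t *\<^sub>R b) *\<^sub>R b" by (simp add: T_def algebra_simps)
        also have "L * norm (- a (z + t *\<^sub>R b) *\<^sub>R b) \<le> L * \<alpha> * norm b"
          using a(1)[of "z + t *\<^sub>R b"] L by (simp add: mult_left_mono mult_right_mono mult.assoc)
        finally have "ennreal (\<rho> (z + t *\<^sub>R b)) \<le> ennreal (\<rho> (z + T t *\<^sub>R b) + L * \<alpha> * norm b)"
          by (intro ennreal_leI) simp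
        also have "\<dots> = ennreal (\<rho> (z + T t *\<^sub>R b)) + ennreal (L * \<alpha> * norm b)"
          using \<rho>0 L a0 by (intro ennreal_plus) auto
        finally have "g (z + T t *\<^sub>R b) * ennreal (\<rho> (z + t *\<^sub>R b))
            \<le> g (z + T t *\<^sub>R b) * (ennreal (\<rho> (z + T t *\<^sub>R b)) + ennreal (L * \<alpha> * norm b))"
          by (rule mult_left_mono) simp
        also have "\<dots> \<le> g (z + T t *\<^sub>R b) * ennreal (\<rho> (z + T t *\<^sub>R b)) + 1 * ennreal (L * \<alpha> * norm b)"
          unfolding distrib_left by (intro add_mono order_refl mult_right_mono g1) simp
        finally show ?thesis using True \<open>x(b:=t) \<in> ?box\<close> by (simp add: Jz eq h_def)
      next
        case False
        then show ?thesis by (simp add: Jz)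
      qed
    qed
    also have "\<dots> = (\<integral>\<^sup>+t. h (T t) \<partial>lborel) + ennreal (L * \<alpha> * norm b) * (\<integral>\<^sup>+t. indicator ?box (x(b:=t)) \<partial>lborel)"
    proof -
      have [measurable]: "(\<lambda>t. x(b:=t)) \<in> measurable lborel ?L"
        using measurable_component_update[OF x, of b] B(2) by (simp add: insert_absorb)
      show ?thesis by (subst nn_integral_add) (auto simp: nn_integral_cmult)
    qed
    also have "(\<integral>\<^sup>+t. h (T t) \<partial>lborel) \<le> ennreal (1 / c) * (\<integral>\<^sup>+t. h t \<partial>lborel)"
      using c by (intro nn_integral_expanding_le[OF _ T_cont T_exp]) auto
    finally show ?thesis unfolding h_def fun_upd_def Jz[unfolded fun_upd_def] by (simp add: add_right_mono)
  qed
  have BB: "insert b (B - {b}) = B" using B by auto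
  have ins: "integral\<^sup>N ?L f = (\<integral>\<^sup>+x. (\<integral>\<^sup>+t. f (x(b:=t)) \<partial>lborel) \<partial>?L')" if "f \<in> borel_measurable ?L" for f
    using pr.product_nn_integral_insert[of "B - {b}" b f, unfolded BB] B that by simp
  have insM: "(\<lambda>x. \<integral>\<^sup>+t. f (x(b:=t)) \<partial>lborel) \<in> borel_measurable ?L'" if f[measurable]: "f \<in> borel_measurable ?L"
    for f :: "_ \<Rightarrow> ennreal"
  proof -
    have [measurable]: "(\<lambda>p. (fst p)(b := snd p)) \<in> measurable (?L' \<Otimes>\<^sub>M lborel) ?L"
      using measurable_add_dim[of b "B - {b}" "\<lambda>_. lborel", unfolded BB] by (simp add: case_prod_beta')
    have "(\<lambda>(x, t). f (x(b:=t))) \<in> borel_measurable (?L' \<Otimes>\<^sub>M lborel)"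
      by (simp add: case_prod_beta')
    then show ?thesis by (rule lborel.borel_measurable_nn_integral)
  qed
  have inner: "(\<integral>\<^sup>+x. indicator K (J y x) * g (J y x + a (J y x) *\<^sub>R b) * ennreal (\<rho> (J y x)) \<partial>?L)
     \<le> ennreal (1 / c) * (\<integral>\<^sup>+x. g (J y x) * ennreal (\<rho> (J y x)) \<partial>?L) + ennreal (L * \<alpha> * norm b * (2 * R) ^ card B)" for y
  proof -
    have "(\<integral>\<^sup>+x. indicator K (J y x) * g (J y x + a (J y x) *\<^sub>R b) * ennreal (\<rho> (J y x)) \<partial>?L)
      = (\<integral>\<^sup>+x. (\<integral>\<^sup>+t. indicator K (J y (x(b:=t))) * g (J y (x(b:=t)) + a (J y (x(b:=t))) *\<^sub>R b) * ennreal (\<rho> (J y (x(b:=t)))) \<partial>lborel) \<partial>?L')"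
      by (rule ins) measurable
    also have "\<dots> \<le> (\<integral>\<^sup>+x. ennreal (1 / c) * (\<integral>\<^sup>+t. g (J y (x(b:=t))) * ennreal (\<rho> (J y (x(b:=t)))) \<partial>lborel)
       + ennreal (L * \<alpha> * norm b) * (\<integral>\<^sup>+t. indicator ?box (x(b:=t)) \<partial>lborel) \<partial>?L')"
      by (intro nn_integral_mono line)
    also have "\<dots> = ennreal (1 / c) * (\<integral>\<^sup>+x. g (J y x) * ennreal (\<rho> (J y x)) \<partial>?L)
       + ennreal (L * \<alpha> * norm b) * (\<integral>\<^sup>+x. indicator ?box x \<partial>?L)"
    proof -
      have m: "(\<lambda>x. \<integral>\<^sup>+t. g (J y (x(b:=t))) * ennreal (\<rho> (J y (x(b:=t)))) \<partial>lborel) \<in> borel_measurable ?L'"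
        by (rule insM) measurable
      have m': "(\<lambda>x. \<integral>\<^sup>+t. indicator ?box (x(b:=t)) \<partial>lborel) \<in> borel_measurable ?L'"
        by (rule insM) measurable
      have e: "(\<integral>\<^sup>+x. g (J y x) * ennreal (\<rho> (J y x)) \<partial>?L)
          = (\<integral>\<^sup>+x. (\<integral>\<^sup>+t. g (J y (x(b:=t))) * ennreal (\<rho> (J y (x(b:=t)))) \<partial>lborel) \<partial>?L')"
        by (rule ins) measurable
      have e': "(\<integral>\<^sup>+x. indicator ?box x \<partial>?L) = (\<integral>\<^sup>+x. (\<integral>\<^sup>+t. indicator ?box (x(b:=t)) \<partial>lborel) \<partial>?L')"
        by (rule ins) measurable
      show ?thesis unfolding e e' using m m'
        by (simp add: nn_integral_add nn_integral_cmult)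
    qed
    also have "(\<integral>\<^sup>+x. indicator ?box x \<partial>?L) = ennreal ((2 * R) ^ card B)"
    proof -
      have "(\<integral>\<^sup>+x. indicator ?box x \<partial>?L) = emeasure ?L ?box" by (rule nn_integral_indicator) measurable
      also have "\<dots> = (\<Prod>b\<in>B. emeasure lborel {-R..R})" by (rule pr.emeasure_PiM) (use B in auto)
      also have "\<dots> = ennreal (2 * R) ^ card B" proof -
        have "emeasure lborel {-R..R} = ennreal (2 * R)" using R by (subst emeasure_lborel_Icc) auto
        then show ?thesis by (simp only: prod_constant)
      qed
      finally show ?thesis using R by (simp add: ennreal_power)
    qed
    also have "ennreal (L * \<alpha> * norm b) * ennreal ((2 * R) ^ card B) = ennreal (L * \<alpha> * norm b * (2 * R) ^ card B)"
      using R L a0 by (intro ennreal_mult[symmetric]) auto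
    finally show ?thesis .
  qed
  have [measurable]: "(\<lambda>y. g (y + a y *\<^sub>R b)) \<in> borel_measurable borel" by measurable
  have AEK: "AE y in Q. y \<in> K"
    using K(2) by (intro Q.AE_prob_1) (simp add: measure_def)
  have "(\<integral>\<^sup>+y. g (y + a y *\<^sub>R b) \<partial>Q) = (\<integral>\<^sup>+y. indicator K y * g (y + a y *\<^sub>R b) \<partial>Q)"
    using AEK by (intro nn_integral_cong_AE) auto
  also have "\<dots> = (\<integral>\<^sup>+y. (\<integral>\<^sup>+x. indicator K (J y x) * g (J y x + a (J y x) *\<^sub>R b) * ennreal (\<rho> (J y x)) \<partial>?L) \<partial>Q)"
    unfolding J_def by (rule nn_integral_disintegration[OF Q B(1) _ dis]) auto
  also have "\<dots> \<le> (\<integral>\<^sup>+y. ennreal (1 / c) * (\<integral>\<^sup>+x. g (J y x) * ennreal (\<rho> (J y x)) \<partial>?L) + ennreal (L * \<alpha> * norm b * (2 * R) ^ card B) \<partial>Q)"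
    by (intro nn_integral_mono inner)
  also have "\<dots> = ennreal (1 / c) * (\<integral>\<^sup>+y. (\<integral>\<^sup>+x. g (J y x) * ennreal (\<rho> (J y x)) \<partial>?L) \<partial>Q) + ennreal (L * \<alpha> * norm b * (2 * R) ^ card B)"
  proof -
    have "(\<lambda>y. \<integral>\<^sup>+x. g (J y x) * ennreal (\<rho> (J y x)) \<partial>?L) \<in> borel_measurable Q"
      by (rule sigma_finite_measure.borel_measurable_nn_integral[OF Lsf]) (use JM(1) in \<open>simp add: case_prod_beta'\<close>)
    then show ?thesis by (subst nn_integral_add) (auto simp: nn_integral_cmult Q.emeasure_space_1)
  qed
  also have "(\<integral>\<^sup>+y. (\<integral>\<^sup>+x. g (J y x) * ennreal (\<rho> (J y x)) \<partial>?L) \<partial>Q) = (\<integral>\<^sup>+y. g y \<partial>Q)"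
    unfolding J_def by (rule nn_integral_disintegration[OF Q B(1) _ dis, symmetric]) auto
  \<comment> \<open>The factor 1 / c turns into an additive error because the integral of
    \<open>g\<close> is at most 1.\<close>
  also have "ennreal (1 / c) * (\<integral>\<^sup>+y. g y \<partial>Q) \<le> (\<integral>\<^sup>+y. g y \<partial>Q) + ennreal (2 * \<beta> * norm b)"
  proof -
    have le1: "(\<integral>\<^sup>+y. g y \<partial>Q) \<le> 1"
      using nn_integral_mono[of Q g "\<lambda>_. 1"] g1 by (simp add: Q.emeasure_space_1)
    have "ennreal (1 / c) * (\<integral>\<^sup>+y. g y \<partial>Q) \<le> (1 + ennreal (2 * \<beta> * norm b)) * (\<integral>\<^sup>+y. g y \<partial>Q)"
      using ennreal_leI[OF ic] \<beta> by (intro mult_right_mono) (auto simp: ennreal_plus)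
    also have "\<dots> \<le> (\<integral>\<^sup>+y. g y \<partial>Q) + ennreal (2 * \<beta> * norm b) * 1"
      unfolding distrib_right using le1 by (intro add_mono mult_left_mono) auto
    finally show ?thesis by simp
  qed
  finally show ?thesis using \<beta> L a0 R by (simp add: ennreal_plus add.assoc add_mono)
qed

text \<open>Equivalence of norms in finite dimension: on the unit sphere of the maximum norm the
  combination attains its minimal norm, which is positive by independence, and scaling does the
  rest. Coefficients are functions on the whole type, so compactness comes from a product of
  intervals in which the coordinates outside \<open>B\<close> are frozen at 0.\<close>

lemma independent_coordinates_bounded:
  fixes B :: "'e::real_normed_vector set"
  assumes B: "finite B" "independent B"
  shows "\<exists>C\<ge>0. \<forall>c. \<forall>b\<in>B. \<bar>c b\<bar> \<le> C * norm (\<Sum>b\<in>B. c b *\<^sub>R b)"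
proof (cases "B = {}")
  case False
  define D where "D = PiE UNIV (\<lambda>b. if b \<in> B then {-1..1} else {0::real})"
  have "compactin (product_topology (\<lambda>_. euclidean) UNIV) D"
    unfolding D_def by (subst compactin_PiE) auto
  then have D: "compact D" by (simp add: euclidean_product_topology)
  define A where "A = {c \<in> D. \<exists>b\<in>B. \<bar>c b\<bar> = 1}"
  let ?f = "\<lambda>c. norm (\<Sum>b\<in>B. c b *\<^sub>R b)"
  have cc: "continuous_on UNIV (\<lambda>c::'e \<Rightarrow> real. c b)" for b
    by (rule continuous_on_product_coordinates)
  have "A = D \<inter> (\<Union>b\<in>B. {c. \<bar>c b\<bar> = 1})" by (auto simp: A_def)
  moreover have "closed {c::'e \<Rightarrow> real. \<bar>c b\<bar> = 1}" for b
    by (intro closed_Collect_eq continuous_intros cc)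
  ultimately have "compact A" using B D by (auto intro!: compact_Int_closed)
  moreover have "A \<noteq> {}"
  proof -
    obtain b where "b \<in> B" using False by auto
    then have "(\<lambda>b. if b \<in> B then 1 else 0) \<in> A" by (auto simp: A_def D_def)
    then show ?thesis by auto
  qed
  moreover have "continuous_on A ?f"
    by (intro continuous_intros continuous_on_subset[OF cc]) auto
  ultimately obtain c0 where c0: "c0 \<in> A" "\<And>c. c \<in> A \<Longrightarrow> ?f c0 \<le> ?f c"
    using continuous_attains_inf[of A ?f] by blast
  have "?f c0 \<noteq> 0"
    using c0(1) B independentD[OF B(2,1) subset_refl, of c0] by (auto simp: A_def)
  then have pos: "0 < ?f c0" using norm_ge_zero by (metis less_eq_real_def)
  have "\<bar>c b\<bar> \<le> 1 / ?f c0 * ?f c" if "b \<in> B" for c b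
  proof (cases "\<forall>b\<in>B. c b = 0")
    case True then show ?thesis using that by simp
  next
    case False
    define M where "M = Max ((\<lambda>b. \<bar>c b\<bar>) ` B)"
    have M: "\<bar>c b\<bar> \<le> M" if "b \<in> B" for b unfolding M_def using that B by (intro Max_ge) auto
    obtain b0 where b0: "b0 \<in> B" "M = \<bar>c b0\<bar>"
      using Max_in[of "(\<lambda>b. \<bar>c b\<bar>) ` B"] B \<open>B \<noteq> {}\<close> unfolding M_def by blast
    have "0 < M" using False M by force
    have "(\<lambda>b. if b \<in> B then c b / M else 0) \<in> A"
    proof -
      have "c b / M \<in> {-1..1}" if "b \<in> B" for b
        using M[OF that] \<open>0 < M\<close> by (auto simp: abs_le_iff field_simps)
      then show ?thesis using b0 \<open>0 < M\<close> by (auto simp: A_def D_def intro!: bexI[of _ b0])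
    qed
    from c0(2)[OF this] have "?f c0 \<le> norm ((1 / M) *\<^sub>R (\<Sum>b\<in>B. c b *\<^sub>R b))"
      by (simp add: scaleR_sum_right)
    then have "M * ?f c0 \<le> ?f c" using \<open>0 < M\<close> by (simp add: field_simps)
    then have "M \<le> 1 / ?f c0 * ?f c" using pos by (simp add: field_simps)
    then show ?thesis using M[OF that] by linarith
  qed
  then show ?thesis using pos by (intro exI[of _ "1 / ?f c0"]) auto
qed (auto intro: exI[of _ 0])

text \<open>\<open>orth_proj\<close> is a definite description, so existence and uniqueness have to
  be shown before it can be used. Gram-Schmidt supplies an orthogonal spanning set \<open>C\<close>
  and an explicit formula, which shows linearity and yields the scalar coefficients from which the
  control is built. Excluding 0 from \<open>C\<close> makes the divisions meaningful.\<close>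

lemma orth_proj_span:
  fixes B :: "'h::real_inner set"
  assumes "finite B"
  obtains C where "finite C" "0 \<notin> C" "C \<subseteq> span B"
    "\<And>x. orth_proj (span B) x = (\<Sum>c\<in>C. (c \<bullet> x / (c \<bullet> c)) *\<^sub>R c)"
    "\<And>x. norm (x - orth_proj (span B) x) \<le> norm x"
proof -
  obtain C0 where C0: "finite C0" "span C0 = span B" "pairwise orthogonal C0"
    using basis_orthogonal[OF assms] by blast
  define C where "C = C0 - {0}"
  have C: "finite C" "0 \<notin> C" "span C = span B" "pairwise orthogonal C"
    using C0 by (auto simp: C_def pairwise_def span_delete_0)
  define p where "p x = (\<Sum>c\<in>C. (c \<bullet> x / (c \<bullet> c)) *\<^sub>R c)" for x
  have pin: "p x \<in> span B" for x
    unfolding p_def C(3)[symmetric] by (intro span_sum span_scale span_base)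
  have orthC: "(x - p x) \<bullet> c = 0" if "c \<in> C" for x c
  proof -
    have "p x \<bullet> c = (\<Sum>c'\<in>C. if c' = c then c \<bullet> x else 0)"
      unfolding p_def inner_sum_left using C(2,4) that
      by (intro sum.cong) (auto simp: pairwise_def orthogonal_def)
    then show ?thesis using C(1) that by (simp add: inner_diff_left inner_diff_right inner_commute[of c])
  qed
  have orth: "(x - p x) \<bullet> z = 0" if "z \<in> span B" for x z
  proof -
    have "z \<in> span C" using that C by simp
    then show ?thesis
      by (induction rule: span_induct_alt) (auto simp: inner_add_right orthC)
  qed
  have P: "orth_proj (span B) x = p x" for x
    unfolding orth_proj_def
  proof (rule the_equality)
    fix y assume y: "y \<in> span B \<and> (\<forall>z\<in>span B. (x - y) \<bullet> z = 0)"
    then have d: "p x - y \<in> span B" using pin by (intro span_diff) auto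
    have "(p x - y) \<bullet> (p x - y) = (x - y) \<bullet> (p x - y) - (x - p x) \<bullet> (p x - y)"
      by (simp add: inner_diff_left)
    also have "\<dots> = 0" using y d orth by auto
    finally show "y = p x" by simp
  qed (use pin orth in auto)
  have "norm (x - p x) \<le> norm x" for x
  proof -
    have "(norm x)\<^sup>2 = (norm (x - p x))\<^sup>2 + (norm (p x))\<^sup>2"
      using norm_add_Pythagorean[of "x - p x" "p x"] orth[OF pin] by (simp add: orthogonal_def)
    then have "(norm (x - p x))\<^sup>2 \<le> (norm x)\<^sup>2" by simp
    then show ?thesis by (rule power2_le_imp_le) simp
  qed
  then show thesis using that[of C] C P span_superset[of C] by (auto simp: p_def)
qed

text \<open>Here \<open>s\<close> is the wanted displacement and \<open>\<alpha>\<close> its size: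
  the map realises \<open>s\<close> up to second order. The last clause bounds the positive part of
  the difference between the image of \<open>Q \<xi>\<close> and \<open>Q \<xi>\<close>, which for
  probability measures is their distance in variation.\<close>

definition approx_shift ::
    "('x \<Rightarrow> 'e::real_normed_vector measure) \<Rightarrow> 'x set \<Rightarrow> ('e \<Rightarrow> 'e) \<Rightarrow> real \<Rightarrow> real \<Rightarrow> ('e \<Rightarrow> 'e) \<Rightarrow> bool" where
  "approx_shift Q \<E> s C \<alpha> \<Phi> \<longleftrightarrow> continuous_on UNIV \<Phi> \<and> (\<forall>y. norm (\<Phi> y - y) \<le> C * \<alpha>) \<and>
        (\<forall>y. norm (\<Phi> y - y - s y) \<le> C * \<alpha>\<^sup>2) \<and>
        (\<forall>\<xi>\<in>\<E>. \<forall>g. g \<in> borel_measurable borel \<longrightarrow> (\<forall>y. g y \<le> 1) \<longrightarrow>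
           (\<integral>\<^sup>+y. g (\<Phi> y) \<partial>Q \<xi>) \<le> (\<integral>\<^sup>+y. g y \<partial>Q \<xi>) + ennreal (C * \<alpha>))"

text \<open>Composing one-dimensional shifts instead of shifting by the whole vector at once costs only
  an error of second order in the size of the shift.\<close>

lemma chain_of_shifts:
  fixes bs :: "'e::{banach, second_countable_topology} list" and Q :: "'x \<Rightarrow> 'e measure"
  assumes shift: "\<And>b a \<alpha> g \<xi>. b \<in> set bs \<Longrightarrow> 0 \<le> \<alpha> \<Longrightarrow> \<alpha> \<le> \<alpha>0 \<Longrightarrow> (\<And>y. \<bar>a y\<bar> \<le> \<alpha>) \<Longrightarrow>
      (\<And>y y'. \<bar>a y - a y'\<bar> \<le> \<alpha> * norm (y - y')) \<Longrightarrow> g \<in> borel_measurable borel \<Longrightarrow> (\<And>y. g y \<le> 1) \<Longrightarrow> \<xi> \<in> \<E> \<Longrightarrow>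
      (\<integral>\<^sup>+y. g (y + a y *\<^sub>R b) \<partial>Q \<xi>) \<le> (\<integral>\<^sup>+y. g y \<partial>Q \<xi>) + ennreal (M * \<alpha>)"
    and M: "0 \<le> M"
  shows "\<exists>C\<ge>0. \<forall>a \<alpha>. 0 \<le> \<alpha> \<longrightarrow> \<alpha> \<le> \<alpha>0 \<longrightarrow> (\<forall>b\<in>set bs. \<forall>y. \<bar>a b y\<bar> \<le> \<alpha>) \<longrightarrow>
      (\<forall>b\<in>set bs. \<forall>y y'. \<bar>a b y - a b y'\<bar> \<le> \<alpha> * norm (y - y')) \<longrightarrow>
      (\<exists>\<Phi>. approx_shift Q \<E> (\<lambda>y. \<Sum>b\<leftarrow>bs. a b y *\<^sub>R b) C \<alpha> \<Phi>)"
  using shift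
proof (induction bs)
  case Nil
  show ?case
    by (rule exI[of _ 0], intro conjI allI impI exI[of _ "\<lambda>y. y"])
      (auto simp: approx_shift_def)
next
  case (Cons b bs)
  have "\<exists>C\<ge>0. \<forall>a \<alpha>. 0 \<le> \<alpha> \<longrightarrow> \<alpha> \<le> \<alpha>0 \<longrightarrow> (\<forall>b\<in>set bs. \<forall>y. \<bar>a b y\<bar> \<le> \<alpha>) \<longrightarrow>
      (\<forall>b\<in>set bs. \<forall>y y'. \<bar>a b y - a b y'\<bar> \<le> \<alpha> * norm (y - y')) \<longrightarrow>
      (\<exists>\<Phi>. approx_shift Q \<E> (\<lambda>y. \<Sum>b\<leftarrow>bs. a b y *\<^sub>R b) C \<alpha> \<Phi>)"
  proof (rule Cons.IH, goal_cases)
    case (1 b' a \<alpha> g \<xi>)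
    show ?case by (rule Cons.prems) (use 1 in auto)
  qed
  then obtain C where C: "0 \<le> C"
    and IH: "\<And>a \<alpha>. 0 \<le> \<alpha> \<Longrightarrow> \<alpha> \<le> \<alpha>0 \<Longrightarrow> (\<forall>b\<in>set bs. \<forall>y. \<bar>a b y\<bar> \<le> \<alpha>) \<Longrightarrow>
      (\<forall>b\<in>set bs. \<forall>y y'. \<bar>a b y - a b y'\<bar> \<le> \<alpha> * norm (y - y')) \<Longrightarrow>
      (\<exists>\<Phi>. approx_shift Q \<E> (\<lambda>y. \<Sum>b\<leftarrow>bs. a b y *\<^sub>R b) C \<alpha> \<Phi>)"
    by blast
  define N where "N = (\<Sum>b\<leftarrow>bs. norm b)"
  have N: "0 \<le> N" unfolding N_def by (rule sum_list_nonneg) auto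
  \<comment> \<open>One constant for three bounds: \<open>C + norm b\<close> for the displacement,
    \<open>C + N * norm b\<close> for the deviation from the wanted sum, \<open>C + M\<close> for
    the cost in variation.\<close>
  define C' where "C' = C + norm b + M + N * norm b"
  have C': "0 \<le> C'" "C + norm b \<le> C'" "C + N * norm b \<le> C'" "C + M \<le> C'"
    using C N M by (auto simp: C'_def)
  show ?case
  proof (intro exI[of _ C'] conjI allI impI C'(1))
    fix a :: "'e \<Rightarrow> 'e \<Rightarrow> real" and \<alpha> :: real
    assume \<alpha>: "0 \<le> \<alpha>" "\<alpha> \<le> \<alpha>0" and a: "\<forall>b\<in>set (b # bs). \<forall>y. \<bar>a b y\<bar> \<le> \<alpha>"
      "\<forall>b\<in>set (b # bs). \<forall>y y'. \<bar>a b y - a b y'\<bar> \<le> \<alpha> * norm (y - y')"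
    have "\<exists>\<Phi>. approx_shift Q \<E> (\<lambda>y. \<Sum>b\<leftarrow>bs. a b y *\<^sub>R b) C \<alpha> \<Phi>"
      by (rule IH[OF \<alpha>]) (use a in auto)
    then obtain \<Phi> where \<Phi>_shift: "approx_shift Q \<E> (\<lambda>y. \<Sum>b\<leftarrow>bs. a b y *\<^sub>R b) C \<alpha> \<Phi>" ..
    have \<Phi>: "continuous_on UNIV \<Phi>" "\<And>y. norm (\<Phi> y - y) \<le> C * \<alpha>"
        "\<And>y. norm (\<Phi> y - y - (\<Sum>b\<leftarrow>bs. a b y *\<^sub>R b)) \<le> C * \<alpha>\<^sup>2"
        "\<And>\<xi> g. \<xi> \<in> \<E> \<Longrightarrow> g \<in> borel_measurable borel \<Longrightarrow> (\<forall>y. g y \<le> 1) \<Longrightarrow>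
           (\<integral>\<^sup>+y. g (\<Phi> y) \<partial>Q \<xi>) \<le> (\<integral>\<^sup>+y. g y \<partial>Q \<xi>) + ennreal (C * \<alpha>)"
      using \<Phi>_shift by (simp_all add: approx_shift_def)
    define T where "T y = y + a b y *\<^sub>R b" for y
    have Tc: "continuous_on UNIV T" unfolding T_def
      using a(2) \<alpha> by (intro continuous_intros lipschitz_real_continuous[of "a b" \<alpha>]) auto
    have T1: "norm (T y - y) \<le> \<alpha> * norm b" for y
      using a(1) by (auto simp: T_def intro!: mult_right_mono)
    \<comment> \<open>The later coefficients are evaluated at \<open>T y\<close> and not at y. Their
      Lipschitz constant \<open>\<alpha>\<close> times the displacement
      \<open>\<alpha> * norm b\<close> makes the discrepancy quadratic.\<close>
    have diff: "norm ((\<Sum>b\<leftarrow>bs. a b (T y) *\<^sub>R b) - (\<Sum>b\<leftarrow>bs. a b y *\<^sub>R b)) \<le> N * norm b * \<alpha>\<^sup>2" for y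
    proof -
      have "norm ((\<Sum>b\<leftarrow>cs. a b (T y) *\<^sub>R b) - (\<Sum>b\<leftarrow>cs. a b y *\<^sub>R b)) \<le> (\<Sum>b\<leftarrow>cs. norm b) * (norm b * \<alpha>\<^sup>2)"
        if "set cs \<subseteq> set bs" for cs
        using that
      proof (induction cs)
        case (Cons c cs)
        have "\<bar>a c (T y) - a c y\<bar> \<le> \<alpha> * norm (T y - y)" using a(2) Cons.prems by auto
        also have "\<dots> \<le> \<alpha> * (\<alpha> * norm b)" by (intro mult_left_mono T1 \<alpha>)
        finally have "norm c * \<bar>a c (T y) - a c y\<bar> \<le> norm c * (\<alpha> * (\<alpha> * norm b))"
          by (rule mult_left_mono) simp
        then have "norm ((a c (T y) - a c y) *\<^sub>R c) \<le> norm c * (norm b * \<alpha>\<^sup>2)"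
          by (simp add: power2_eq_square mult_ac)
        moreover have eq: "(\<Sum>b\<leftarrow>c # cs. a b (T y) *\<^sub>R b) - (\<Sum>b\<leftarrow>c # cs. a b y *\<^sub>R b) = (a c (T y) - a c y) *\<^sub>R c
            + ((\<Sum>b\<leftarrow>cs. a b (T y) *\<^sub>R b) - (\<Sum>b\<leftarrow>cs. a b y *\<^sub>R b))" by (simp add: algebra_simps)
        moreover have "norm ((\<Sum>b\<leftarrow>cs. a b (T y) *\<^sub>R b) - (\<Sum>b\<leftarrow>cs. a b y *\<^sub>R b)) \<le> (\<Sum>b\<leftarrow>cs. norm b) * (norm b * \<alpha>\<^sup>2)"
          by (rule Cons.IH) (use Cons.prems in auto)
        ultimately show ?case unfolding eq
          by (simp only: list.map sum_list.Cons distrib_right norm_triangle_mono)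
      qed simp
      from this[OF subset_refl] show ?thesis by (simp add: N_def mult.assoc)
    qed
    show "\<exists>\<Phi>. approx_shift Q \<E> (\<lambda>y. \<Sum>b\<leftarrow>b # bs. a b y *\<^sub>R b) C' \<alpha> \<Phi>"
      unfolding approx_shift_def
    proof (intro exI[of _ "\<lambda>y. \<Phi> (T y)"] conjI allI ballI impI)
      show "continuous_on UNIV (\<lambda>y. \<Phi> (T y))"
        by (rule continuous_on_compose2[OF \<Phi>(1) Tc]) auto
      fix y
      have "norm (\<Phi> (T y) - y) \<le> norm (\<Phi> (T y) - T y) + norm (T y - y)"
        using norm_triangle_ineq[of "\<Phi> (T y) - T y" "T y - y"] by simp
      also have "\<dots> \<le> (C + norm b) * \<alpha>" using \<Phi>(2)[of "T y"] T1[of y] by (simp add: algebra_simps)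
      also have "\<dots> \<le> C' * \<alpha>" by (intro mult_right_mono C' \<alpha>)
      finally show "norm (\<Phi> (T y) - y) \<le> C' * \<alpha>" .
      have eq: "\<Phi> (T y) - y - (\<Sum>b\<leftarrow>b # bs. a b y *\<^sub>R b) = (\<Phi> (T y) - T y - (\<Sum>b\<leftarrow>bs. a b (T y) *\<^sub>R b))
          + ((\<Sum>b\<leftarrow>bs. a b (T y) *\<^sub>R b) - (\<Sum>b\<leftarrow>bs. a b y *\<^sub>R b))" by (simp add: T_def algebra_simps)
      have "norm (\<Phi> (T y) - y - (\<Sum>b\<leftarrow>b # bs. a b y *\<^sub>R b)) \<le> C * \<alpha>\<^sup>2 + N * norm b * \<alpha>\<^sup>2"
        unfolding eq by (rule norm_triangle_mono[OF \<Phi>(3)[of "T y"] diff[of y]])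
      also have "\<dots> = (C + N * norm b) * \<alpha>\<^sup>2" by (simp add: algebra_simps)
      also have "\<dots> \<le> C' * \<alpha>\<^sup>2" by (intro mult_right_mono C') auto
      finally show "norm (\<Phi> (T y) - y - (\<Sum>b\<leftarrow>b # bs. a b y *\<^sub>R b)) \<le> C' * \<alpha>\<^sup>2" .
    next
      fix \<xi> and g :: "'e \<Rightarrow> ennreal" assume \<xi>: "\<xi> \<in> \<E>" and g[measurable]: "g \<in> borel_measurable borel" "\<forall>y. g y \<le> 1"
      have [measurable]: "\<Phi> \<in> borel_measurable borel" using \<Phi>(1) by (rule borel_measurable_continuous_onI)
      \<comment> \<open>The single shift is applied to the test function \<open>g\<close> composed
        with \<open>\<Phi>\<close>, which is again Borel and bounded by 1.\<close>
      have "(\<integral>\<^sup>+y. g (\<Phi> (y + a b y *\<^sub>R b)) \<partial>Q \<xi>) \<le> (\<integral>\<^sup>+y. g (\<Phi> y) \<partial>Q \<xi>) + ennreal (M * \<alpha>)"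
        by (rule Cons.prems[of b \<alpha> "a b"]) (use \<alpha> a g \<xi> in auto)
      also have "\<dots> \<le> (\<integral>\<^sup>+y. g y \<partial>Q \<xi>) + ennreal (C * \<alpha>) + ennreal (M * \<alpha>)"
        by (intro add_mono \<Phi>(4) \<xi> g order_refl)
      also have "\<dots> = (\<integral>\<^sup>+y. g y \<partial>Q \<xi>) + ennreal ((C + M) * \<alpha>)"
        using C M \<alpha> by (simp add: add.assoc ennreal_plus[symmetric] distrib_right del: ennreal_plus)
      also have "\<dots> \<le> (\<integral>\<^sup>+y. g y \<partial>Q \<xi>) + ennreal (C' * \<alpha>)"
        by (intro add_mono order_refl ennreal_leI mult_right_mono C' \<alpha>)
      finally show "(\<integral>\<^sup>+y. g (\<Phi> (T y)) \<partial>Q \<xi>) \<le> (\<integral>\<^sup>+y. g y \<partial>Q \<xi>) + ennreal (C' * \<alpha>)" by (simp add: T_def)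
    qed
  qed
qed

section \<open>Approximate controls and squeezing\<close>

text \<open>Dividing by \<open>max m\<close> of the sum and not by the sum itself keeps the
  functions Lipschitz on the whole space, also where the sum vanishes. Where the sum is at least
  \<open>m\<close> they form a genuine partition of unity.\<close>

lemma scaled_partition_lipschitz:
  fixes \<phi> :: "'i \<Rightarrow> 'a::metric_space \<Rightarrow> real"
  assumes D: "finite D" "i \<in> D" and m: "0 < m"
    and \<phi>: "\<And>i q. 0 \<le> \<phi> i q" "\<And>i q q'. \<bar>\<phi> i q - \<phi> i q'\<bar> \<le> dist q q'"
  shows "\<bar>\<phi> i q / max m (\<Sum>i\<in>D. \<phi> i q) - \<phi> i q' / max m (\<Sum>i\<in>D. \<phi> i q')\<bar> \<le> (1 + real (card D)) / m * dist q q'"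
    and "0 \<le> \<phi> i q / max m (\<Sum>i\<in>D. \<phi> i q)" "\<phi> i q / max m (\<Sum>i\<in>D. \<phi> i q) \<le> 1"
proof -
  define s where "s q = max m (\<Sum>i\<in>D. \<phi> i q)" for q
  have s: "m \<le> s q" "0 < s q" for q using m by (auto simp: s_def)
  have sle: "\<phi> i q \<le> s q" for q
    using member_le_sum[OF D(2), of "\<lambda>i. \<phi> i q"] \<phi>(1) D(1) by (auto simp: s_def)
  have sl: "\<bar>s q - s q'\<bar> \<le> real (card D) * dist q q'" for q q'
  proof -
    have "\<bar>s q - s q'\<bar> \<le> \<bar>(\<Sum>i\<in>D. \<phi> i q) - (\<Sum>i\<in>D. \<phi> i q')\<bar>" by (auto simp: s_def max_def abs_if)
    also have "\<dots> \<le> (\<Sum>i\<in>D. \<bar>\<phi> i q - \<phi> i q'\<bar>)" unfolding sum_subtractf[symmetric] by (rule sum_abs)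
    also have "\<dots> \<le> (\<Sum>i\<in>D. dist q q')" by (intro sum_mono \<phi>)
    finally show ?thesis by simp
  qed
  \<comment> \<open>The split leaves \<open>s\<close> in each denominator once, against a Lipschitz
    numerator, and the remaining quotient is at most 1.\<close>
  have eq: "\<phi> i q / s q - \<phi> i q' / s q' = (\<phi> i q - \<phi> i q') / s q + (\<phi> i q' / s q') * ((s q' - s q) / s q)"
    using s(2)[of q] s(2)[of q'] by (simp add: field_simps)
  have q1: "0 \<le> \<phi> i q / s q" "\<phi> i q / s q \<le> 1" for q using s(2)[of q] sle[of q] \<phi>(1)[of i q] by auto
  have 1: "\<bar>(\<phi> i q - \<phi> i q') / s q\<bar> \<le> dist q q' / m"
    using s[of q] m \<phi>(2)[of i q q'] by (auto simp: abs_divide intro!: frac_le)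
  have 2: "\<bar>(s q' - s q) / s q\<bar> \<le> real (card D) * dist q q' / m"
    using s[of q] m sl[of q' q] by (auto simp: abs_divide dist_commute intro!: frac_le)
  have "\<bar>\<phi> i q / s q - \<phi> i q' / s q'\<bar> \<le> \<bar>(\<phi> i q - \<phi> i q') / s q\<bar> + \<bar>\<phi> i q' / s q'\<bar> * \<bar>(s q' - s q) / s q\<bar>"
    unfolding eq abs_mult[symmetric] by (rule abs_triangle_ineq)
  also have "\<bar>\<phi> i q' / s q'\<bar> * \<bar>(s q' - s q) / s q\<bar> \<le> 1 * \<bar>(s q' - s q) / s q\<bar>"
    using q1[of q'] by (intro mult_right_mono) auto
  also have "\<bar>(\<phi> i q - \<phi> i q') / s q\<bar> + 1 * \<bar>(s q' - s q) / s q\<bar> \<le> dist q q' / m + real (card D) * dist q q' / m"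
    using 1 2 by simp
  also have "\<dots> = (1 + real (card D)) / m * dist q q'" by (simp add: add_divide_distrib distrib_right)
  finally show "\<bar>\<phi> i q / max m (\<Sum>i\<in>D. \<phi> i q) - \<phi> i q' / max m (\<Sum>i\<in>D. \<phi> i q')\<bar> \<le> (1 + real (card D)) / m * dist q q'"
    by (simp add: s_def)
  show "0 \<le> \<phi> i q / max m (\<Sum>i\<in>D. \<phi> i q)" "\<phi> i q / max m (\<Sum>i\<in>D. \<phi> i q) \<le> 1"
    using q1[of q] by (auto simp: s_def)
qed

text \<open>An approximate right inverse of the control derivative that depends on the base point in a
  Lipschitz way. It is glued from constant ones by a partition of unity, which is possible because
  the admissible right inverses form a convex set.\<close>

lemma approximate_controls:
  fixes A :: "'a::metric_space \<Rightarrow> 'e::real_normed_vector \<Rightarrow>\<^sub>L 'h::real_inner"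
  assumes Z: "compact Z" and A: "continuous_on UNIV A"
    and C: "finite C" "\<And>z c. z \<in> Z \<Longrightarrow> c \<in> C \<Longrightarrow> c \<in> closure (range (blinfun_apply (A z)))"
    and F: "incseq F" "\<And>n. subspace (F n)" "closure (\<Union>n. F n) = UNIV"
    and eps: "0 < \<epsilon>"
  obtains n D e \<psi> L where "finite D" "D \<subseteq> Z" "0 \<le> L" "\<And>p c. p \<in> D \<Longrightarrow> c \<in> C \<Longrightarrow> e p c \<in> F n"
    "\<And>p q. p \<in> D \<Longrightarrow> 0 \<le> \<psi> p q" "\<And>p q. p \<in> D \<Longrightarrow> \<psi> p q \<le> (1::real)"
    "\<And>p q q'. p \<in> D \<Longrightarrow> \<bar>\<psi> p q - \<psi> p q'\<bar> \<le> L * dist q q'"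
    "\<And>z. z \<in> Z \<Longrightarrow> (\<Sum>p\<in>D. \<psi> p z) = 1" "\<And>p q. p \<in> D \<Longrightarrow> \<psi> p q \<noteq> 0 \<Longrightarrow> dist p q < 1"
    "\<And>p q c. p \<in> D \<Longrightarrow> c \<in> C \<Longrightarrow> \<psi> p q \<noteq> 0 \<Longrightarrow> norm (A q (e p c) - c) < \<epsilon>"
proof (cases "Z = {}")
  case True
  then show thesis by (intro that[of "{}" 0]) auto
next
  case False
  \<comment> \<open>Density is used twice: c is approximated from the range of \<open>A p\<close>,
    and the preimage found is then moved into the union of the \<open>F n\<close>, at a small cost
    because \<open>A p\<close> is bounded.\<close>
  have "\<exists>v. v \<in> (\<Union>n. F n) \<and> norm (A p v - c) < \<epsilon>" if pc: "p \<in> Z" "c \<in> C" for p c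
  proof -
    obtain w where w: "norm (A p w - c) < \<epsilon> / 2"
    proof -
      have "\<exists>x\<in>range (blinfun_apply (A p)). dist x c < \<epsilon> / 2"
        using C(2)[OF pc] half_gt_zero[OF eps] unfolding closure_approachable by blast
      then show ?thesis using that by (auto simp: dist_norm)
    qed
    define N where "N = norm (A p) + 1"
    have N: "0 < N" using norm_ge_zero[of "A p"] unfolding N_def by linarith
    have "w \<in> closure (\<Union>n. F n)" using F(3) by simp
    then obtain v where v: "v \<in> (\<Union>n. F n)" "norm (v - w) < \<epsilon> / (2 * N)"
    proof -
      have "\<exists>x\<in>(\<Union>n. F n). dist x w < \<epsilon> / (2 * N)"
        using \<open>w \<in> _\<close> divide_pos_pos[of \<epsilon> "2 * N"] eps N unfolding closure_approachable by auto
      then show ?thesis using that by (auto simp: dist_norm)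
    qed
    have "norm (A p v - c) \<le> norm (A p (v - w)) + norm (A p w - c)"
      using norm_triangle_ineq[of "A p (v - w)" "A p w - c"] by (simp add: blinfun.diff_right)
    also have "norm (A p (v - w)) \<le> N * norm (v - w)"
      using norm_blinfun[of "A p" "v - w"] by (rule order_trans) (auto simp: N_def intro!: mult_right_mono)
    also have "N * norm (v - w) \<le> \<epsilon> / 2" using v(2) N by (simp add: field_simps)
    finally show ?thesis using v(1) w by (intro exI[of _ v]) auto
  qed
  then obtain e where e: "\<And>p c. p \<in> Z \<Longrightarrow> c \<in> C \<Longrightarrow> e p c \<in> (\<Union>n. F n)"
    "\<And>p c. p \<in> Z \<Longrightarrow> c \<in> C \<Longrightarrow> norm (A p (e p c) - c) < \<epsilon>" by metis
  \<comment> \<open>Continuity of \<open>A\<close> lets one choice of \<open>e p c\<close> serve a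
    whole ball around p. Radii at most 1 keep the supports of the weights within distance 1 of
    \<open>Z\<close>, where estimates remain available.\<close>
  have "\<exists>r>0. r \<le> 1 \<and> (\<forall>q. dist p q < r \<longrightarrow> (\<forall>c\<in>C. norm (A q (e p c) - c) < \<epsilon>))" if p: "p \<in> Z" for p
  proof -
    have "open (\<Inter>c\<in>C. {q. norm (A q (e p c) - c) < \<epsilon>})"
      using C(1) A by (intro open_INT ballI open_Collect_less continuous_intros) auto
    moreover have "p \<in> (\<Inter>c\<in>C. {q. norm (A q (e p c) - c) < \<epsilon>})" using e(2)[OF p] by auto
    ultimately obtain r where "r > 0" "ball p r \<subseteq> (\<Inter>c\<in>C. {q. norm (A q (e p c) - c) < \<epsilon>})"
      by (meson open_contains_ball)
    then show ?thesis by (intro exI[of _ "min r 1"]) (auto simp: subset_iff)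
  qed
  then obtain r where r: "\<And>p. p \<in> Z \<Longrightarrow> 0 < r p" "\<And>p. p \<in> Z \<Longrightarrow> r p \<le> 1"
    "\<And>p q c. p \<in> Z \<Longrightarrow> dist p q < r p \<Longrightarrow> c \<in> C \<Longrightarrow> norm (A q (e p c) - c) < \<epsilon>" by metis
  obtain D where D: "D \<subseteq> Z" "finite D" "Z \<subseteq> (\<Union>p\<in>D. ball p (r p / 2))"
  proof (rule compactE_image[OF Z, of Z "\<lambda>p. ball p (r p / 2)"])
    show "Z \<subseteq> (\<Union>p\<in>Z. ball p (r p / 2))" using r(1) by force
  qed auto
  have "D \<noteq> {}" using D False by auto
  \<comment> \<open>\<open>Z\<close> is covered by balls of half the radius, so at each point of
    \<open>Z\<close> some bump is at least half its radius. Hence the sum is at least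
    \<open>m\<close> on \<open>Z\<close>, and the cutoff \<open>max m\<close> is inactive
    there.\<close>
  define m where "m = Min ((\<lambda>p. r p / 2) ` D)"
  have m_le: "m \<le> r p / 2" if "p \<in> D" for p
    unfolding m_def by (rule Min_le) (use that D in auto)
  have "m \<in> (\<lambda>p. r p / 2) ` D" unfolding m_def by (rule Min_in) (use D \<open>D \<noteq> {}\<close> in auto)
  then have m0: "0 < m" using r(1) D(1) by auto
  note m = m0 m_le
  define \<phi> where "\<phi> p q = max 0 (r p - dist p q)" for p q
  have \<phi>: "0 \<le> \<phi> p q" "\<bar>\<phi> p q - \<phi> p q'\<bar> \<le> dist q q'" for p q q'
    using dist_triangle[of p q q'] dist_triangle[of p q' q] by (auto simp: \<phi>_def max_def dist_commute abs_if)
  define \<psi> where "\<psi> p q = \<phi> p q / max m (\<Sum>p\<in>D. \<phi> p q)" for p q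
  have "\<exists>n. \<forall>p\<in>D. \<forall>c\<in>C. e p c \<in> F n"
  proof -
    have "\<exists>n. e p c \<in> F n" if "p \<in> D" "c \<in> C" for p c using e(1) that D by blast
    then obtain k where k: "\<And>p c. p \<in> D \<Longrightarrow> c \<in> C \<Longrightarrow> e p c \<in> F (k p c)" by metis
    \<comment> \<open>The sum of the finitely many indices is a common upper bound for them, so by
      monotonicity a single \<open>F n\<close> contains all the vectors.\<close>
    have "k p c \<le> (\<Sum>(p, c)\<in>D \<times> C. k p c)" if "p \<in> D" "c \<in> C" for p c
      using member_le_sum[of "(p, c)" "D \<times> C" "\<lambda>(p, c). k p c"] that D C(1) by auto
    then have "F (k p c) \<subseteq> F (\<Sum>(p, c)\<in>D \<times> C. k p c)" if "p \<in> D" "c \<in> C" for p c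
      using that by (intro incseqD[OF F(1)]) auto
    then show ?thesis using k by blast
  qed
  then obtain n where n: "\<And>p c. p \<in> D \<Longrightarrow> c \<in> C \<Longrightarrow> e p c \<in> F n" by blast
  have nz: "dist p q < r p" if "\<psi> p q \<noteq> 0" for p q
    using that by (auto simp: \<psi>_def \<phi>_def max_def split: if_splits)
  show thesis
  proof (rule that[of D "(1 + real (card D)) / m" e n \<psi>])
    show "(\<Sum>p\<in>D. \<psi> p z) = 1" if z: "z \<in> Z" for z
    proof -
      obtain p where p: "p \<in> D" "dist p z < r p / 2" using D(3) z by (auto simp: subset_iff)
      have "m \<le> r p - dist p z" using m(2)[OF p(1)] p(2) by simp
      also have "\<dots> \<le> \<phi> p z" by (simp add: \<phi>_def)
      also have "\<dots> \<le> (\<Sum>p\<in>D. \<phi> p z)" using member_le_sum[OF p(1), of "\<lambda>p. \<phi> p z"] \<phi>(1) D(2) by auto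
      finally have "m \<le> (\<Sum>p\<in>D. \<phi> p z)" .
      then show ?thesis using m(1) by (simp add: \<psi>_def sum_divide_distrib[symmetric] max_absorb2)
    qed
    show "dist p q < 1" if "p \<in> D" "\<psi> p q \<noteq> 0" for p q
      using nz[OF that(2)] r(2)[of p] D(1) that(1) by auto
    show "norm (A q (e p c) - c) < \<epsilon>" if "p \<in> D" "c \<in> C" "\<psi> p q \<noteq> 0" for p q c
      using r(3)[of p q c] nz[OF that(3)] that D(1) by auto
    show "\<bar>\<psi> p q - \<psi> p q'\<bar> \<le> (1 + real (card D)) / m * dist q q'" "0 \<le> \<psi> p q" "\<psi> p q \<le> 1" if "p \<in> D" for p q q'
      unfolding \<psi>_def using scaled_partition_lipschitz[OF D(2) that m(1), of \<phi>] \<phi> by blast+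
    show "0 \<le> (1 + real (card D)) / m" using m(1) by simp
  qed (use D n in auto)
qed

section \<open>Taylor bounds for the dynamics and coefficients of the control\<close>

lemma C2_estimates:
  fixes S :: "'a::real_normed_vector \<times> 'b::real_normed_vector \<Rightarrow> 'c::real_normed_vector"
  assumes "C2_bounded S"
  obtains S' where "\<And>z. (S has_derivative blinfun_apply (S' z)) (at z)" "continuous_on UNIV S'"
    "\<And>R. \<exists>c\<ge>0. \<forall>p\<in>cball 0 R \<times> cball 0 R. \<forall>q\<in>cball 0 R \<times> cball 0 R.
       norm (S' p) \<le> c \<and> norm (S q - S p) \<le> c * norm (q - p) \<and> norm (S' q - S' p) \<le> c * norm (q - p) \<and>
       norm (S q - S p - S' p (q - p)) \<le> norm (q - p) * (c * norm (q - p))"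
proof -
  obtain S' S'' where S': "\<And>z. (S has_derivative blinfun_apply (S' z)) (at z)"
    and S'': "\<And>z. (S' has_derivative blinfun_apply (S'' z)) (at z)"
    and bd: "\<And>B. bounded B \<Longrightarrow> bounded (S' ` B) \<and> bounded (S'' ` B)"
    using assms unfolding C2_bounded_def by metis
  show thesis
  proof (rule that[OF S'])
    show "continuous_on UNIV S'"
      using S'' by (intro continuous_at_imp_continuous_on ballI has_derivative_continuous)
    fix R :: real
    define B :: "('a \<times> 'b) set" where "B = cball 0 R \<times> cball 0 R"
    have B: "bounded B" "convex B" by (auto simp: B_def intro: bounded_Times convex_Times)
    obtain c1 c2 where c: "\<And>p. p \<in> B \<Longrightarrow> norm (S' p) \<le> c1" "\<And>p. p \<in> B \<Longrightarrow> norm (S'' p) \<le> c2"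
      using bd[OF B(1)] by (auto simp: bounded_iff)
    define c where "c = max 0 (max c1 c2)"
    have cB: "norm (S' p) \<le> c" "norm (S'' p) \<le> c" if "p \<in> B" for p
      using c[OF that] by (auto simp: c_def)
    have lip: "norm (S q - S p) \<le> c * norm (q - p)" if "p \<in> B" "q \<in> B" for p q
      by (rule differentiable_bound[OF B(2), of S "\<lambda>z. blinfun_apply (S' z)"])
        (use that cB in \<open>auto intro!: has_derivative_at_withinI[OF S'] simp: norm_blinfun.rep_eq[symmetric]\<close>)
    have lip': "norm (S' q - S' p) \<le> c * norm (q - p)" if "p \<in> B" "q \<in> B" for p q
      by (rule differentiable_bound[OF B(2), of S' "\<lambda>z. blinfun_apply (S'' z)"])
        (use that cB in \<open>auto intro!: has_derivative_at_withinI[OF S''] simp: norm_blinfun.rep_eq[symmetric]\<close>)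
    have tay: "norm (S q - S p - S' p (q - p)) \<le> norm (q - p) * (c * norm (q - p))" if "p \<in> B" "q \<in> B" for p q
    proof (rule differentiable_bound_linearization[of p q "closed_segment p q" S "\<lambda>z. blinfun_apply (S' z)"])
      show "p + t *\<^sub>R (q - p) \<in> closed_segment p q" if "t \<in> {0..1}" for t
        using that by (auto simp: in_segment algebra_simps intro!: exI[of _ t])
      show "(S has_derivative blinfun_apply (S' x)) (at x within closed_segment p q)" for x
        by (rule has_derivative_at_withinI[OF S'])
      fix x assume x: "x \<in> closed_segment p q"
      then have "x \<in> B" using closed_segment_subset[OF that B(2)] by auto
      have "onorm (blinfun_apply (S' x) - blinfun_apply (S' p)) = norm (S' x - S' p)"
        by (simp add: norm_blinfun.rep_eq minus_blinfun.rep_eq fun_diff_def)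
      also have "\<dots> \<le> c * norm (x - p)" by (rule lip') fact+
      also have "\<dots> \<le> c * norm (q - p)"
        using segment_bound(1)[OF x] by (intro mult_left_mono) (auto simp: c_def)
      finally show "onorm (blinfun_apply (S' x) - blinfun_apply (S' p)) \<le> c * norm (q - p)" .
    qed simp
    show "\<exists>c\<ge>0. \<forall>p\<in>cball 0 R \<times> cball 0 R. \<forall>q\<in>cball 0 R \<times> cball 0 R.
       norm (S' p) \<le> c \<and> norm (S q - S p) \<le> c * norm (q - p) \<and> norm (S' q - S' p) \<le> c * norm (q - p) \<and>
       norm (S q - S p - S' p (q - p)) \<le> norm (q - p) * (c * norm (q - p))"
      unfolding B_def[symmetric]
      by (rule exI[of _ c]) (use cB lip lip' tay in \<open>auto simp: c_def\<close>)
  qed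
qed

lemma has_derivative_partial:
  assumes "\<And>z. (S has_derivative blinfun_apply (S' z)) (at z)"
  shows "((\<lambda>y. S (u, y)) has_derivative (\<lambda>v. S' (u, y) (0, v))) (at y)"
    and "((\<lambda>w. S (w, y)) has_derivative (\<lambda>v. S' (u, y) (v, 0))) (at u)"
proof -
  have "((\<lambda>y. (u, y)) has_derivative (\<lambda>v. (0, v))) (at y)"
    by (intro has_derivative_Pair has_derivative_const has_derivative_ident)
  from has_derivative_compose[OF this assms]
  show "((\<lambda>y. S (u, y)) has_derivative (\<lambda>v. S' (u, y) (0, v))) (at y)" .
  have "((\<lambda>w. (w, y)) has_derivative (\<lambda>v. (v, 0))) (at u)"
    by (intro has_derivative_Pair has_derivative_const has_derivative_ident)
  from has_derivative_compose[OF this assms]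
  show "((\<lambda>w. S (w, y)) has_derivative (\<lambda>v. S' (u, y) (v, 0))) (at u)" .
qed

text \<open>The factor \<open>k\<close> is controlled only on the ball of radius \<open>R\<close>,
  but \<open>\<psi>\<close> vanishes outside. For a pair with one point outside the support of
  \<open>\<psi>\<close>, only the Lipschitz bound of \<open>\<psi>\<close> and the value of
  \<open>k\<close> at the other point are used.\<close>

lemma cutoff_product:
  fixes \<psi> k :: "'e::real_normed_vector \<Rightarrow> real"
  assumes \<psi>: "\<And>y. 0 \<le> \<psi> y" "\<And>y. \<psi> y \<le> 1" "\<And>y y'. \<bar>\<psi> y - \<psi> y'\<bar> \<le> L * norm (y - y')"
      "\<And>y. \<psi> y \<noteq> 0 \<Longrightarrow> norm y \<le> R" and L: "0 \<le> L"
    and k: "\<And>y. norm y \<le> R \<Longrightarrow> \<bar>k y\<bar> \<le> k0" "\<And>y y'. norm y \<le> R \<Longrightarrow> norm y' \<le> R \<Longrightarrow> \<bar>k y - k y'\<bar> \<le> k0 * norm (y - y')"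
    and k0: "0 \<le> k0"
  shows "\<bar>\<psi> y * k y\<bar> \<le> (L + 1) * k0" "\<bar>\<psi> y * k y - \<psi> y' * k y'\<bar> \<le> (L + 1) * k0 * norm (y - y')"
proof -
  have b: "\<bar>\<psi> y * k y\<bar> \<le> k0" for y
  proof (cases "\<psi> y = 0")
    case False
    then have "\<bar>\<psi> y\<bar> * \<bar>k y\<bar> \<le> 1 * k0" using \<psi>(1,2)[of y] k(1)[OF \<psi>(4)] by (intro mult_mono) auto
    then show ?thesis by (simp add: abs_mult)
  qed (use k0 in simp)
  have "k0 \<le> (L + 1) * k0" using L k0 by (simp add: distrib_right)
  then show "\<bar>\<psi> y * k y\<bar> \<le> (L + 1) * k0" using b[of y] by linarith
  have one: "\<bar>\<psi> y * k y - \<psi> y' * k y'\<bar> \<le> (L + 1) * k0 * norm (y - y')" if "\<psi> y' = 0" for y y'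
  proof (cases "\<psi> y = 0")
    case False
    have "\<bar>\<psi> y * k y - \<psi> y' * k y'\<bar> = \<bar>\<psi> y - \<psi> y'\<bar> * \<bar>k y\<bar>" using that by (simp add: abs_mult)
    also have "\<dots> \<le> (L * norm (y - y')) * k0" using \<psi>(3) k(1)[OF \<psi>(4)[OF False]] L by (intro mult_mono) auto
    also have "\<dots> \<le> (L + 1) * k0 * norm (y - y')" using k0 by (simp add: algebra_simps)
    finally show ?thesis .
  qed (use that L k0 in simp)
  show "\<bar>\<psi> y * k y - \<psi> y' * k y'\<bar> \<le> (L + 1) * k0 * norm (y - y')"
  proof (cases "\<psi> y = 0 \<or> \<psi> y' = 0")
    case True
    then show ?thesis using one[of y' y] one[of y y'] by (auto simp: norm_minus_commute abs_minus_commute)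
  next
    case False
    then have n: "norm y \<le> R" "norm y' \<le> R" using \<psi>(4) by auto
    have "\<psi> y * k y - \<psi> y' * k y' = (\<psi> y - \<psi> y') * k y + \<psi> y' * (k y - k y')" by (simp add: algebra_simps)
    then have "\<bar>\<psi> y * k y - \<psi> y' * k y'\<bar> \<le> \<bar>\<psi> y - \<psi> y'\<bar> * \<bar>k y\<bar> + \<bar>\<psi> y'\<bar> * \<bar>k y - k y'\<bar>"
      by (metis abs_mult abs_triangle_ineq)
    also have "\<dots> \<le> (L * norm (y - y')) * k0 + 1 * (k0 * norm (y - y'))"
      using \<psi>(1,2)[of y'] \<psi>(3)[of y y'] k(1)[OF n(1)] k(2)[OF n] L k0 by (intro add_mono mult_mono) auto
    finally show ?thesis by (simp add: algebra_simps)
  qed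
qed

text \<open>The glued approximate right inverse is applied to the orthogonal projection of
  \<open>S (u, y) - S (u', y)\<close> on the span of \<open>C\<close>, and the result is written in
  a basis \<open>B\<close> of \<open>F n\<close>. The mixed difference bound in \<open>est\<close>
  makes the coefficients not only of size O(|u - u'|) but also Lipschitz in y with a constant of
  that order, as the one-dimensional shifts demand. The index n precedes \<open>B\<close> because
  Lebesgue measure on \<open>F n\<close> comes with a basis of its own.\<close>

lemma control_coefficients:
  fixes S :: "'h::real_inner \<times> 'e::real_normed_vector \<Rightarrow> 'h" and S' :: "'h \<times> 'e \<Rightarrow> ('h \<times> 'e) \<Rightarrow>\<^sub>L 'h"
  assumes S': "continuous_on UNIV S'"
    and est: "\<And>u u' y. u \<in> X \<Longrightarrow> u' \<in> X \<Longrightarrow> norm y \<le> R \<Longrightarrow> norm (S (u, y) - S (u', y)) \<le> c0 * norm (u - u')"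
    "\<And>u u' y y'. u \<in> X \<Longrightarrow> u' \<in> X \<Longrightarrow> norm y \<le> R \<Longrightarrow> norm y' \<le> R \<Longrightarrow>
      norm ((S (u, y) - S (u', y)) - (S (u, y') - S (u', y'))) \<le> c0 * norm (u - u') * norm (y - y')"
    and c0: "0 \<le> c0"
    and K: "compact K" "\<And>y. y \<in> K \<Longrightarrow> norm y + 1 \<le> R" and X: "compact X"
    and C: "finite C" "0 \<notin> C" "\<And>z c. z \<in> X \<times> K \<Longrightarrow> c \<in> C \<Longrightarrow> c \<in> closure (range (\<lambda>v. S' z (0, v)))"
    and F: "incseq F" "\<And>n. subspace (F n)" "closure (\<Union>n. F n) = UNIV"
    and eps: "0 < \<epsilon>"
  shows "\<exists>n. \<forall>B. finite B \<longrightarrow> independent B \<longrightarrow> span B = F n \<longrightarrow> (\<exists>A a. 0 \<le> A \<and>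
      (\<forall>u\<in>X. \<forall>u'\<in>X. \<forall>b\<in>B. (\<forall>y. \<bar>a u u' b y\<bar> \<le> A * norm (u - u')) \<and>
         (\<forall>y y'. \<bar>a u u' b y - a u u' b y'\<bar> \<le> A * norm (u - u') * norm (y - y'))) \<and>
      (\<forall>u\<in>X. \<forall>u'\<in>X. \<forall>y\<in>K. norm (S' (u', y) (0, \<Sum>b\<in>B. a u u' b y *\<^sub>R b)
          - (\<Sum>c\<in>C. (c \<bullet> (S (u, y) - S (u', y)) / (c \<bullet> c)) *\<^sub>R c)) \<le> \<epsilon> * norm (S (u, y) - S (u', y))))"
proof -
  have bl: "bounded_linear (\<lambda>v::'e. (0::'h, v))"
    by (intro bounded_linear_Pair bounded_linear_zero bounded_linear_ident)
  define A where "A z = S' z o\<^sub>L Blinfun (\<lambda>v::'e. (0::'h, v))" for z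
  have A: "blinfun_apply (A z) v = S' z (0, v)" for z v
    by (simp add: A_def bounded_linear_Blinfun_apply[OF bl])
  have A_cont: "continuous_on UNIV A" unfolding A_def by (intro continuous_intros S')
  \<comment> \<open>The coefficient on c is at most norm v / norm c, so an error \<epsilon> / s for
    each c adds up to at most \<epsilon> times norm v.\<close>
  define s where "s = 1 + (\<Sum>c\<in>C. 1 / norm c)"
  have s: "1 \<le> s" unfolding s_def by (auto intro!: sum_nonneg)
  have Acl: "c \<in> closure (range (blinfun_apply (A z)))" if "z \<in> X \<times> K" "c \<in> C" for z c
    using C(3)[OF that] by (simp add: A[abs_def])
  have es: "0 < \<epsilon> / s" using eps s by simp
  obtain n D e \<psi> L where D: "finite D" "D \<subseteq> X \<times> K" and L: "0 \<le> L" and e: "\<And>p c. p \<in> D \<Longrightarrow> c \<in> C \<Longrightarrow> e p c \<in> F n"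
    and \<psi>: "\<And>p q. p \<in> D \<Longrightarrow> 0 \<le> \<psi> p q" "\<And>p q. p \<in> D \<Longrightarrow> \<psi> p q \<le> (1::real)"
      "\<And>p q q'. p \<in> D \<Longrightarrow> \<bar>\<psi> p q - \<psi> p q'\<bar> \<le> L * dist q q'"
      "\<And>z. z \<in> X \<times> K \<Longrightarrow> (\<Sum>p\<in>D. \<psi> p z) = 1" "\<And>p q. p \<in> D \<Longrightarrow> \<psi> p q \<noteq> 0 \<Longrightarrow> dist p q < 1"
      "\<And>p q c. p \<in> D \<Longrightarrow> c \<in> C \<Longrightarrow> \<psi> p q \<noteq> 0 \<Longrightarrow> norm (A q (e p c) - c) < \<epsilon> / s"
    by (rule approximate_controls[OF compact_Times[OF X K(1)] A_cont C(1) Acl F es]) (assumption | rule that)+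
  define h where "h u u' y = S (u, y) - S (u', y)" for u u' y
  define co where "co c v = (c \<bullet> v) / (c \<bullet> c)" for c v :: 'h
  have co: "\<bar>co c v\<bar> \<le> norm v / norm c" if "c \<in> C" for c v
  proof -
    have "c \<noteq> 0" using that C(2) by auto
    have "\<bar>co c v\<bar> \<le> (norm c * norm v) / (c \<bullet> c)"
      unfolding co_def abs_divide using Cauchy_Schwarz_ineq2[of c v] by (auto intro!: divide_right_mono)
    also have "\<dots> = norm v / norm c" using \<open>c \<noteq> 0\<close> by (simp add: power2_norm_eq_inner[symmetric] power2_eq_square)
    finally show ?thesis .
  qed
  show ?thesis
  proof (rule exI[of _ n], intro allI impI)
    fix B assume B: "finite B" "independent B" "span B = F n"
    define r where "r p c b = representation B (e p c) b" for p c b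
    have r: "(\<Sum>b\<in>B. r p c b *\<^sub>R b) = e p c" if "p \<in> D" "c \<in> C" for p c
      unfolding r_def using sum_representation_eq[OF B(2) _ B(1), of "e p c"] e[OF that] B(3) by auto
    define a where "a u u' b y = (\<Sum>p\<in>D. \<Sum>c\<in>C. \<psi> p (u', y) * (co c (h u u' y) * r p c b))" for u u' b y
    define w where "w p c b = (L + 1) * (c0 * \<bar>r p c b\<bar> / norm c)" for p c b
    have w0: "0 \<le> w p c b" for p c b using L c0 by (simp add: w_def)
    define M where "M = (\<Sum>b\<in>B. \<Sum>p\<in>D. \<Sum>c\<in>C. w p c b)"
    have M0: "0 \<le> M" unfolding M_def by (intro sum_nonneg w0)
    have Mb: "(\<Sum>p\<in>D. \<Sum>c\<in>C. w p c b) \<le> M" if "b \<in> B" for b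
      unfolding M_def by (rule member_le_sum[of b B "\<lambda>b. \<Sum>p\<in>D. \<Sum>c\<in>C. w p c b"])
        (use that B(1) w0 in \<open>auto intro!: sum_nonneg\<close>)
    have summand: "\<bar>\<psi> p (u', y) * (co c (h u u' y) * r p c b)\<bar> \<le> w p c b * norm (u - u') \<and>
        \<bar>\<psi> p (u', y) * (co c (h u u' y) * r p c b) - \<psi> p (u', y') * (co c (h u u' y') * r p c b)\<bar> \<le> w p c b * norm (u - u') * norm (y - y')"
      if u: "u \<in> X" "u' \<in> X" and pc: "p \<in> D" "c \<in> C" for u u' p c b y y'
    proof -
      define k where "k y = co c (h u u' y) * r p c b" for y
      define k0 where "k0 = c0 * norm (u - u') / norm c * \<bar>r p c b\<bar>"
      have k0: "0 \<le> k0" using c0 by (simp add: k0_def)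
      have 1: "\<bar>k y\<bar> \<le> k0" if "norm y \<le> R" for y
      proof -
        have "\<bar>co c (h u u' y)\<bar> \<le> c0 * norm (u - u') / norm c"
          by (rule order_trans[OF co[OF pc(2)] divide_right_mono]) (use est(1)[OF u that] in \<open>simp_all add: h_def\<close>)
        then show ?thesis unfolding k_def k0_def abs_mult by (intro mult_right_mono) auto
      qed
      have 2: "\<bar>k y - k y'\<bar> \<le> k0 * norm (y - y')" if "norm y \<le> R" "norm y' \<le> R" for y y'
      proof -
        have "co c (h u u' y) - co c (h u u' y') = co c (h u u' y - h u u' y')"
          by (simp add: co_def inner_diff_right diff_divide_distrib)
        moreover have "\<bar>co c (h u u' y - h u u' y')\<bar> \<le> c0 * norm (u - u') * norm (y - y') / norm c"
          by (rule order_trans[OF co[OF pc(2)] divide_right_mono]) (use est(2)[OF u that] in \<open>simp_all add: h_def\<close>)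
        ultimately have "\<bar>co c (h u u' y) - co c (h u u' y')\<bar> \<le> c0 * norm (u - u') * norm (y - y') / norm c" by simp
        then have "\<bar>co c (h u u' y) - co c (h u u' y')\<bar> * \<bar>r p c b\<bar> \<le> c0 * norm (u - u') * norm (y - y') / norm c * \<bar>r p c b\<bar>"
          by (intro mult_right_mono) auto
        then show ?thesis unfolding k_def k0_def left_diff_distrib[symmetric] abs_mult by (simp add: mult_ac)
      qed
      \<comment> \<open>A nonzero weight puts y within distance 1 of a point of \<open>K\<close>,
        and \<open>R\<close> exceeds the norms on \<open>K\<close> by at least 1.\<close>
      have ball: "norm y \<le> R" if "\<psi> p (u', y) \<noteq> 0" for y
      proof -
        have "dist (snd p) y \<le> dist p (u', y)" using dist_snd_le[of p "(u', y)"] by simp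
        moreover have "dist p (u', y) < 1" by (rule \<psi>(5)[OF pc(1) that])
        ultimately have "dist y (snd p) < 1" unfolding dist_commute[of y] by linarith
        then have "norm (y - snd p) < 1" unfolding dist_norm .
        then have "norm y < norm (snd p) + 1" using norm_triangle_ineq2[of y "snd p"] by linarith
        moreover have "snd p \<in> K" using D(2) pc(1) by auto
        ultimately show ?thesis using K(2)[of "snd p"] by linarith
      qed
      have lip: "\<bar>\<psi> p (u', y) - \<psi> p (u', y')\<bar> \<le> L * norm (y - y')" for y y'
        using \<psi>(3)[OF pc(1), of "(u', y)" "(u', y')"] by (simp add: dist_Pair_Pair dist_norm)
      have w: "w p c b * norm (u - u') = (L + 1) * k0" by (simp add: w_def k0_def)
      show ?thesis unfolding w k_def[symmetric]
        using cutoff_product[of "\<lambda>y. \<psi> p (u', y)" L R k k0, OF \<psi>(1)[OF pc(1)] \<psi>(2)[OF pc(1)] lip ball L 1 2 k0] by blast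
    qed
    show "\<exists>A a. 0 \<le> A \<and>
      (\<forall>u\<in>X. \<forall>u'\<in>X. \<forall>b\<in>B. (\<forall>y. \<bar>a u u' b y\<bar> \<le> A * norm (u - u')) \<and>
         (\<forall>y y'. \<bar>a u u' b y - a u u' b y'\<bar> \<le> A * norm (u - u') * norm (y - y'))) \<and>
      (\<forall>u\<in>X. \<forall>u'\<in>X. \<forall>y\<in>K. norm (S' (u', y) (0, \<Sum>b\<in>B. a u u' b y *\<^sub>R b)
          - (\<Sum>c\<in>C. (c \<bullet> (S (u, y) - S (u', y)) / (c \<bullet> c)) *\<^sub>R c)) \<le> \<epsilon> * norm (S (u, y) - S (u', y)))"
    proof (rule exI[of _ M], rule exI[of _ a], intro conjI ballI allI M0)
      fix u u' b y y' assume u: "u \<in> X" "u' \<in> X" and b: "b \<in> B"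
      have "\<bar>a u u' b y\<bar> \<le> (\<Sum>p\<in>D. \<Sum>c\<in>C. w p c b * norm (u - u'))"
        unfolding a_def by (intro order_trans[OF sum_abs] sum_mono) (use summand[OF u] in blast)
      also have "\<dots> = (\<Sum>p\<in>D. \<Sum>c\<in>C. w p c b) * norm (u - u')" by (simp add: sum_distrib_right)
      also have "\<dots> \<le> M * norm (u - u')" by (intro mult_right_mono Mb b) simp
      finally show "\<bar>a u u' b y\<bar> \<le> M * norm (u - u')" .
      have "\<bar>a u u' b y - a u u' b y'\<bar> \<le> (\<Sum>p\<in>D. \<Sum>c\<in>C. w p c b * norm (u - u') * norm (y - y'))"
        unfolding a_def sum_subtractf[symmetric] by (intro order_trans[OF sum_abs] sum_mono) (use summand[OF u] in blast)
      also have "\<dots> = (\<Sum>p\<in>D. \<Sum>c\<in>C. w p c b) * norm (u - u') * norm (y - y')" by (simp add: sum_distrib_right)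
      also have "\<dots> \<le> M * norm (u - u') * norm (y - y')" by (intro mult_right_mono Mb b) simp_all
      finally show "\<bar>a u u' b y - a u u' b y'\<bar> \<le> M * norm (u - u') * norm (y - y')" .
    next
      fix u u' y assume u: "u \<in> X" "u' \<in> X" and y: "y \<in> K"
      define z where "z = (u', y)"
      define v where "v = h u u' y"
      have zZ: "z \<in> X \<times> K" using u y by (simp add: z_def)
      have "(\<Sum>b\<in>B. a u u' b y *\<^sub>R b) = (\<Sum>b\<in>B. \<Sum>p\<in>D. \<Sum>c\<in>C. (\<psi> p z * co c v) *\<^sub>R (r p c b *\<^sub>R b))"
        by (simp add: a_def scaleR_sum_left z_def v_def mult_ac)
      also have "\<dots> = (\<Sum>p\<in>D. \<Sum>b\<in>B. \<Sum>c\<in>C. (\<psi> p z * co c v) *\<^sub>R (r p c b *\<^sub>R b))" by (rule sum.swap)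
      also have "\<dots> = (\<Sum>p\<in>D. \<Sum>c\<in>C. \<Sum>b\<in>B. (\<psi> p z * co c v) *\<^sub>R (r p c b *\<^sub>R b))"
        by (intro sum.cong refl sum.swap)
      also have "\<dots> = (\<Sum>p\<in>D. \<Sum>c\<in>C. (\<psi> p z * co c v) *\<^sub>R e p c)"
        by (intro sum.cong refl) (simp only: scaleR_sum_right[symmetric] r)
      finally have "S' z (0, \<Sum>b\<in>B. a u u' b y *\<^sub>R b) = (\<Sum>p\<in>D. \<Sum>c\<in>C. (\<psi> p z * co c v) *\<^sub>R A z (e p c))"
        by (simp add: A[symmetric] blinfun.sum_right blinfun.scaleR_right)
      \<comment> \<open>The weights add up to 1 on \<open>X \<times> K\<close>, so the target can be
        averaged with them as well and compared with the control term by term.\<close>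
      moreover have "(\<Sum>c\<in>C. co c v *\<^sub>R c) = (\<Sum>p\<in>D. \<psi> p z) *\<^sub>R (\<Sum>c\<in>C. co c v *\<^sub>R c)"
        using \<psi>(4)[OF zZ] by simp
      then have "(\<Sum>c\<in>C. co c v *\<^sub>R c) = (\<Sum>p\<in>D. \<Sum>c\<in>C. (\<psi> p z * co c v) *\<^sub>R c)"
        unfolding scaleR_sum_left by (simp add: scaleR_sum_right)
      ultimately have "norm (S' z (0, \<Sum>b\<in>B. a u u' b y *\<^sub>R b) - (\<Sum>c\<in>C. co c v *\<^sub>R c))
          = norm (\<Sum>p\<in>D. \<Sum>c\<in>C. (\<psi> p z * co c v) *\<^sub>R (A z (e p c) - c))"
        by (simp add: sum_subtractf[symmetric] scaleR_diff_right)
      also have "\<dots> \<le> (\<Sum>p\<in>D. \<Sum>c\<in>C. \<psi> p z * (\<epsilon> / s * (norm v / norm c)))"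
      proof (intro order_trans[OF norm_sum] sum_mono)
        fix p c assume pc: "p \<in> D" "c \<in> C"
        show "norm ((\<psi> p z * co c v) *\<^sub>R (A z (e p c) - c)) \<le> \<psi> p z * (\<epsilon> / s * (norm v / norm c))"
        proof (cases "\<psi> p z = 0")
          case False
          have "\<bar>co c v\<bar> * norm (A z (e p c) - c) \<le> norm v / norm c * (\<epsilon> / s)"
            using \<psi>(6)[OF pc False] co[OF pc(2), of v] by (intro mult_mono) auto
          from mult_left_mono[OF this \<psi>(1)[OF pc(1), of z]] show ?thesis
            using \<psi>(1)[OF pc(1), of z] by (simp add: abs_mult mult_ac)
        qed simp
      qed
      also have "\<dots> = (\<Sum>p\<in>D. \<psi> p z) * (\<epsilon> / s * norm v * (\<Sum>c\<in>C. 1 / norm c))"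
        unfolding sum_distrib_right by (intro sum.cong refl) (simp add: sum_distrib_left mult_ac)
      also have "\<dots> = \<epsilon> * norm v * ((\<Sum>c\<in>C. 1 / norm c) / s)" using \<psi>(4)[OF zZ] by simp
      also have "\<dots> \<le> \<epsilon> * norm v * 1" using eps s by (intro mult_left_mono) (auto simp: s_def)
      finally show "norm (S' (u', y) (0, \<Sum>b\<in>B. a u u' b y *\<^sub>R b)
          - (\<Sum>c\<in>C. (c \<bullet> (S (u, y) - S (u', y)) / (c \<bullet> c)) *\<^sub>R c)) \<le> \<epsilon> * norm (S (u, y) - S (u', y))"
        by (simp add: z_def v_def h_def co_def)
    qed
  qed
qed

text \<open>What matters is uniformity: \<open>M\<close> and \<open>\<alpha>0\<close> depend on the
  basis, on the Lipschitz constant of the densities in y and on the size of \<open>K\<close>, but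
  not on the history \<open>\<xi>\<close>.\<close>

lemma density_shift:
  fixes Q :: "(nat \<Rightarrow> 'e::{banach, second_countable_topology}) \<Rightarrow> 'e measure"
  assumes proj: "is_projection_along F F' P" and leb: "is_lebesgue_measure_on F leb"
    and \<rho>0: "\<forall>\<xi>\<in>\<E>. \<forall>y. \<rho> \<xi> y \<ge> 0"
    and lip: "\<forall>\<xi>\<in>\<E>. \<forall>\<xi>'\<in>\<E>. \<forall>y y'. \<bar>\<rho> \<xi> y - \<rho> \<xi>' y'\<bar> \<le> L * (hist_dist \<iota> \<xi> \<xi>' + norm (y - y'))"
    and dis: "\<forall>\<xi>\<in>\<E>. \<forall>A \<in> sets borel. emeasure (Q \<xi>) A =
             (\<integral>\<^sup>+z. (\<integral>\<^sup>+x. indicator A (z + x) * ennreal (\<rho> \<xi> (z + x)) \<partial>leb)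
                \<partial>distr (Q \<xi>) borel (\<lambda>y. y - P y))"
    and K: "closed K" "\<And>y. y \<in> K \<Longrightarrow> norm y \<le> RK" and RK: "0 \<le> RK" and Q: "\<And>\<xi>. \<xi> \<in> \<E> \<Longrightarrow> Q \<xi> \<in> prob_on K"
  shows "\<exists>B M \<alpha>0. finite B \<and> independent B \<and> span B = F \<and> 0 \<le> M \<and> 0 < \<alpha>0 \<and>
    (\<forall>b\<in>B. \<forall>a \<alpha> g. \<forall>\<xi>\<in>\<E>. 0 \<le> \<alpha> \<longrightarrow> \<alpha> \<le> \<alpha>0 \<longrightarrow> (\<forall>y. \<bar>a y\<bar> \<le> \<alpha>) \<longrightarrow>
      (\<forall>y y'. \<bar>a y - a y'\<bar> \<le> \<alpha> * norm (y - y')) \<longrightarrow> g \<in> borel_measurable borel \<longrightarrow> (\<forall>y. g y \<le> 1) \<longrightarrow>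
      (\<integral>\<^sup>+y. g (y + a y *\<^sub>R b) \<partial>Q \<xi>) \<le> (\<integral>\<^sup>+y. g y \<partial>Q \<xi>) + ennreal (M * \<alpha>))"
proof -
  obtain B where B: "finite B" "independent B" "span B = F" "leb = span_lebesgue B"
    using leb unfolding is_lebesgue_measure_on_def by blast
  obtain CB where CB: "0 \<le> CB" "\<And>c b. b \<in> B \<Longrightarrow> \<bar>c b\<bar> \<le> CB * norm (\<Sum>b\<in>B. c b *\<^sub>R b)"
    using independent_coordinates_bounded[OF B(1,2)] by blast
  define R where "R = CB * (norm P * RK)"
  have R: "0 \<le> R" using CB RK by (simp add: R_def)
  \<comment> \<open>The component in \<open>F\<close> of a point of \<open>K\<close> is its image
    under \<open>P\<close>, hence of norm at most norm P times \<open>RK\<close>; independence of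
    \<open>B\<close> then bounds the coordinates.\<close>
  have box: "\<bar>c b'\<bar> \<le> R" if k: "y - P y + (\<Sum>b\<in>B. c b *\<^sub>R b) \<in> K" and b': "b' \<in> B" for y c b'
  proof -
    define x where "x = (\<Sum>b\<in>B. c b *\<^sub>R b)"
    have x: "x \<in> F" unfolding x_def B(3)[symmetric] by (intro span_sum span_scale span_base)
    obtain x0 z0 where y: "y = x0 + z0" "x0 \<in> F" "z0 \<in> F'" using proj unfolding is_projection_along_def by blast
    have "P y = x0" using proj y unfolding is_projection_along_def by blast
    then have "y - P y = z0" using y by simp
    moreover have "P (x + z0) = x" using proj x y(3) unfolding is_projection_along_def by blast
    ultimately have "P (y - P y + x) = x" by (simp add: add.commute)
    then have "norm x \<le> norm P * norm (y - P y + x)" using norm_blinfun[of P "y - P y + x"] by simp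
    also have "\<dots> \<le> norm P * RK" using K(2)[OF k] by (intro mult_left_mono) (auto simp: x_def)
    finally have "CB * norm x \<le> R" unfolding R_def by (intro mult_left_mono CB)
    then show ?thesis using CB(2)[OF b', of c] by (simp add: x_def)
  qed
  define L' where "L' = max L 0"
  have L': "0 \<le> L'" by (simp add: L'_def)
  have lip': "\<bar>\<rho> \<xi> y - \<rho> \<xi> y'\<bar> \<le> L' * norm (y - y')" if "\<xi> \<in> \<E>" for \<xi> y y'
  proof -
    have "\<bar>\<rho> \<xi> y - \<rho> \<xi> y'\<bar> \<le> L * (hist_dist \<iota> \<xi> \<xi> + norm (y - y'))" using lip that by blast
    also have "hist_dist \<iota> \<xi> \<xi> = 0" by (simp add: hist_dist_def)
    also have "L * (0 + norm (y - y')) \<le> L' * norm (y - y')" by (simp add: L'_def mult_right_mono)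
    finally show ?thesis .
  qed
  define N where "N = (\<Sum>b\<in>B. norm b)"
  have N: "0 \<le> N" "\<And>b. b \<in> B \<Longrightarrow> norm b \<le> N"
    using member_le_sum[of _ B norm] B(1) by (auto simp: N_def intro: sum_nonneg)
  define M where "M = N * (2 + L' * (2 * R) ^ card B)"
  \<comment> \<open>Chosen so that \<open>\<alpha> * norm b \<le> 1/2\<close> for every basis
    vector, which keeps the shifted coordinate expanding by a factor at least 1/2.\<close>
  define \<alpha>0 where "\<alpha>0 = 1 / (2 * (1 + N))"
  show ?thesis
  proof (rule exI[of _ B], rule exI[of _ M], rule exI[of _ \<alpha>0], intro conjI ballI allI impI)
    show "0 \<le> M" "0 < \<alpha>0" using N L' R by (auto simp: M_def \<alpha>0_def)
    fix b and a :: "'e \<Rightarrow> real" and \<alpha> and g :: "'e \<Rightarrow> ennreal" and \<xi>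
    assume b: "b \<in> B" and \<alpha>: "0 \<le> \<alpha>" "\<alpha> \<le> \<alpha>0" and a: "\<forall>y. \<bar>a y\<bar> \<le> \<alpha>" "\<forall>y y'. \<bar>a y - a y'\<bar> \<le> \<alpha> * norm (y - y')"
      and g: "g \<in> borel_measurable borel" "\<forall>y. g y \<le> (1::ennreal)" and \<xi>: "\<xi> \<in> \<E>"
    have "\<alpha> * norm b \<le> \<alpha>0 * (1 + N)" using N(2)[OF b] N(1) \<alpha> by (intro mult_mono) auto
    also have "\<dots> = 1/2" using N(1) by (simp add: \<alpha>0_def)
    finally have small: "\<alpha> * norm b \<le> 1/2" .
    have Q\<xi>: "prob_space (Q \<xi>)" "sets (Q \<xi>) = sets borel" "emeasure (Q \<xi>) K = 1"
      using Q[OF \<xi>] by (auto simp: prob_on_def)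
    have "(\<integral>\<^sup>+y. g (y + a y *\<^sub>R b) \<partial>Q \<xi>) \<le> (\<integral>\<^sup>+y. g y \<partial>Q \<xi>) + ennreal (2 * \<alpha> * norm b + L' * \<alpha> * norm b * (2 * R) ^ card B)"
    proof (rule nn_integral_direction_shift[where Q="Q \<xi>" and \<rho>="\<rho> \<xi>" and P=P and K=K and B=B and b=b
          and a=a and g=g and L=L' and R=R and \<alpha>=\<alpha> and \<beta>=\<alpha>])
      show "\<bar>\<rho> \<xi> y - \<rho> \<xi> y'\<bar> \<le> L' * norm (y - y')" for y y' by (rule lip'[OF \<xi>])
      show "\<bar>c b'\<bar> \<le> R" if "y - P y + (\<Sum>b\<in>B. c b *\<^sub>R b) \<in> K" "b' \<in> B" for y c b' using that by (rule box)
      show "emeasure (Q \<xi>) A = (\<integral>\<^sup>+z. (\<integral>\<^sup>+x. indicator A (z + x) * ennreal (\<rho> \<xi> (z + x)) \<partial>span_lebesgue B)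
                \<partial>distr (Q \<xi>) borel (\<lambda>y. y - P y))" if "A \<in> sets borel" for A
        using dis \<xi> that unfolding B(4) by blast
    qed (use \<rho>0 \<xi> a \<alpha> small g Q\<xi> B(1) b L' R K(1) in \<open>simp_all\<close>)
    also have "2 * \<alpha> * norm b + L' * \<alpha> * norm b * (2 * R) ^ card B = norm b * (2 + L' * (2 * R) ^ card B) * \<alpha>"
      by (simp add: algebra_simps)
    also have "(\<integral>\<^sup>+y. g y \<partial>Q \<xi>) + ennreal (norm b * (2 + L' * (2 * R) ^ card B) * \<alpha>) \<le> (\<integral>\<^sup>+y. g y \<partial>Q \<xi>) + ennreal (M * \<alpha>)"
      unfolding M_def by (intro add_left_mono ennreal_leI mult_right_mono N b \<alpha>) (use L' R in auto)
    finally show "(\<integral>\<^sup>+y. g (y + a y *\<^sub>R b) \<partial>Q \<xi>) \<le> (\<integral>\<^sup>+y. g y \<partial>Q \<xi>) + ennreal (M * \<alpha>)" .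
  qed (use B in auto)
qed

text \<open>With h = S (u, y) - S (u', y), the part of h orthogonal to \<open>G\<close> is at most
  \<kappa> |u - u'| up to second order, because \<open>G\<close> is determining, and the part in
  \<open>G\<close> is cancelled by the control up to an arbitrarily small fraction. All other errors
  are quadratic in |u - u'| and are absorbed by \<open>d0\<close>. Of the gap 1 - \<kappa>, a
  quarter is spent on the control error and a quarter on the quadratic terms, which leaves (1 +
  \<kappa>) / 2.\<close>

lemma squeezing:
  fixes S :: "'h::{real_inner, banach, second_countable_topology} \<times> 'e::{banach, second_countable_topology} \<Rightarrow> 'h"
    and Q :: "(nat \<Rightarrow> 'e) \<Rightarrow> 'e measure"
  assumes S: "C2_bounded S" and X: "compact X" and K: "compact K" and alc: "hyp_ALC S X K" and dlp: "hyp_DLP \<iota> \<E> Q"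
    and Q: "\<And>\<xi>. \<xi> \<in> \<E> \<Longrightarrow> Q \<xi> \<in> prob_on K"
  shows "\<exists>\<kappa> C d0. 0 \<le> \<kappa> \<and> \<kappa> < 1 \<and> 0 \<le> C \<and> 0 < d0 \<and> (\<forall>u\<in>X. \<forall>u'\<in>X. norm (u - u') \<le> d0 \<longrightarrow>
    (\<exists>\<Phi>. continuous_on UNIV \<Phi> \<and> (\<forall>y\<in>K. norm (S (u, y) - S (u', \<Phi> y)) \<le> \<kappa> * norm (u - u')) \<and>
      (\<forall>y. norm (\<Phi> y - y) \<le> C * norm (u - u')) \<and>
      (\<forall>\<xi>\<in>\<E>. \<forall>g. g \<in> borel_measurable borel \<longrightarrow> (\<forall>y. g y \<le> 1) \<longrightarrow>
         (\<integral>\<^sup>+y. g (\<Phi> y) \<partial>Q \<xi>) \<le> (\<integral>\<^sup>+y. g y \<partial>Q \<xi>) + ennreal (C * norm (u - u')))))"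
proof -
  obtain S' where S': "\<And>z. (S has_derivative blinfun_apply (S' z)) (at z)" "continuous_on UNIV S'"
    and est: "\<And>R. \<exists>c\<ge>0. \<forall>p\<in>cball 0 R \<times> cball 0 R. \<forall>q\<in>cball 0 R \<times> cball 0 R.
       norm (S' p) \<le> c \<and> norm (S q - S p) \<le> c * norm (q - p) \<and> norm (S' q - S' p) \<le> c * norm (q - p) \<and>
       norm (S q - S p - S' p (q - p)) \<le> norm (q - p) * (c * norm (q - p))"
    using C2_estimates[OF S] by blast
  obtain RX where RX: "\<And>u. u \<in> X \<Longrightarrow> norm u \<le> RX" using compact_imp_bounded[OF X] by (auto simp: bounded_iff)
  obtain RK where RK: "0 < RK" "\<And>y. y \<in> K \<Longrightarrow> norm y \<le> RK" using compact_imp_bounded[OF K] by (auto simp: bounded_pos)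
  \<comment> \<open>The margin 1 around \<open>K\<close> leaves room for the moved noise, whose
    displacement \<open>d0\<close> will keep at most 1.\<close>
  define R where "R = max RX (RK + 1)"
  have RuX: "norm u \<le> R" if "u \<in> X" for u using RX[OF that] by (simp add: R_def)
  have RyK: "norm y + 1 \<le> R" if "y \<in> K" for y using RK(2)[OF that] by (simp add: R_def)
  obtain c where c0: "0 \<le> c" and cc: "\<forall>p\<in>cball 0 R \<times> cball 0 R. \<forall>q\<in>cball 0 R \<times> cball 0 R.
       norm (S' p) \<le> c \<and> norm (S q - S p) \<le> c * norm (q - p) \<and> norm (S' q - S' p) \<le> c * norm (q - p) \<and>
       norm (S q - S p - S' p (q - p)) \<le> norm (q - p) * (c * norm (q - p))"
    using est[of R] by blast
  have c1: "norm (S' (u, y)) \<le> c" if "norm u \<le> R" "norm y \<le> R" for u y using cc that by simp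
  have c2: "norm (S (u, y) - S (u', y')) \<le> c * norm ((u, y) - (u', y'))"
    and c3: "norm (S' (u, y) - S' (u', y')) \<le> c * norm ((u, y) - (u', y'))"
    and c4: "norm (S (u, y) - S (u', y') - S' (u', y') ((u, y) - (u', y'))) \<le> norm ((u, y) - (u', y')) * (c * norm ((u, y) - (u', y')))"
    if "norm u \<le> R" "norm y \<le> R" "norm u' \<le> R" "norm y' \<le> R" for u y u' y'
    using cc[rule_format, of "(u', y')" "(u, y)"] that by simp_all
  have est1: "norm (S (u, y) - S (u', y)) \<le> c * norm (u - u')" if "u \<in> X" "u' \<in> X" "norm y \<le> R" for u u' y
    using c2[of u y u' y] RuX that by (simp add: norm_Pair)
  \<comment> \<open>The derivative in y of the difference is a difference of values of
    \<open>S'\<close> at u and u', which is O(|u - u'|) since \<open>S'\<close> is Lipschitz on the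
    ball.\<close>
  have est2: "norm ((S (u, y) - S (u', y)) - (S (u, y') - S (u', y'))) \<le> c * norm (u - u') * norm (y - y')"
    if u: "u \<in> X" "u' \<in> X" and y: "norm y \<le> R" "norm y' \<le> R" for u u' y y'
  proof (rule differentiable_bound[of "cball 0 R" "\<lambda>y. S (u, y) - S (u', y)" "\<lambda>y v. S' (u, y) (0, v) - S' (u', y) (0, v)"])
    fix x :: 'e assume x: "x \<in> cball 0 R"
    show "((\<lambda>y. S (u, y) - S (u', y)) has_derivative (\<lambda>v. S' (u, x) (0, v) - S' (u', x) (0, v))) (at x within cball 0 R)"
      by (rule has_derivative_at_withinI[OF has_derivative_diff[OF has_derivative_partial(1)[OF S'(1), of u x] has_derivative_partial(1)[OF S'(1), of u' x]]])
    show "onorm (\<lambda>v. S' (u, x) (0, v) - S' (u', x) (0, v)) \<le> c * norm (u - u')"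
    proof (rule onorm_bound)
      fix v
      have "norm (S' (u, x) (0, v) - S' (u', x) (0, v)) \<le> norm (S' (u, x) - S' (u', x)) * norm (0::'h, v)"
        using norm_blinfun[of "S' (u, x) - S' (u', x)" "(0, v)"] by (simp add: blinfun.diff_left)
      also have "\<dots> \<le> c * norm (u - u') * norm v"
        using c3[of u x u' x] RuX u x by (intro mult_mono) (auto simp: norm_Pair c0)
      finally show "norm (S' (u, x) (0, v) - S' (u', x) (0, v)) \<le> c * norm (u - u') * norm v" .
    qed (simp add: c0)
  qed (use y in auto)
  obtain W G Bg where W: "X \<times> K \<subseteq> W" and G: "finite Bg" "G = span Bg" and det: "determining S X K G"
    and dense0: "\<forall>(u, \<zeta>)\<in>W. G \<subseteq> closure (range (frechet_derivative (\<lambda>y. S (u, y)) (at \<zeta>)))"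
    using alc unfolding hyp_ALC_def by (elim exE conjE) (rule that)
  have dense: "G \<subseteq> closure (range (frechet_derivative (\<lambda>y. S (u, y)) (at \<zeta>)))" if "(u, \<zeta>) \<in> W" for u \<zeta>
    using bspec[OF dense0 that] by simp
  have fd: "frechet_derivative (\<lambda>y. S (u, y)) (at y) = (\<lambda>v. S' (u, y) (0, v))"
    "frechet_derivative (\<lambda>w. S (w, y)) (at u) = (\<lambda>v. S' (u, y) (v, 0))" for u y
    using frechet_derivative_at[OF has_derivative_partial(1)[OF S'(1)], of u y]
      frechet_derivative_at[OF has_derivative_partial(2)[OF S'(1)], of u y] by simp_all
  obtain C where C: "finite C" "0 \<notin> C" "C \<subseteq> G"
    and P: "\<And>x. orth_proj G x = (\<Sum>c\<in>C. (c \<bullet> x / (c \<bullet> c)) *\<^sub>R c)" "\<And>x. norm (x - orth_proj G x) \<le> norm x"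
    by (rule orth_proj_span[OF G(1), folded G(2)]) (rule that)
  obtain \<kappa> where \<kappa>: "0 < \<kappa>" "\<kappa> < 1"
    and \<kappa>_on: "\<And>u y. u \<in> X \<Longrightarrow> y \<in> K \<Longrightarrow> onorm (\<lambda>v. S' (u, y) (v, 0) - orth_proj G (S' (u, y) (v, 0))) \<le> \<kappa>"
    using det unfolding determining_def fd by (elim exE conjE) (rule that; blast)
  have blP: "bounded_linear (\<lambda>x. x - orth_proj G x)"
    unfolding P(1) divide_inverse
    by (intro bounded_linear_sub bounded_linear_ident bounded_linear_sum bounded_linear_scaleR_const bounded_linear_mult_const bounded_linear_inner_right)
  have diffP: "(x + z) - orth_proj G (x + z) = (x - orth_proj G x) + (z - orth_proj G z)" for x z
    using blP by (rule bounded_linear.linear[THEN linear_add])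
  have \<kappa>_le: "norm (S' (u, y) (v, 0) - orth_proj G (S' (u, y) (v, 0))) \<le> \<kappa> * norm v" if "u \<in> X" "y \<in> K" for u y v
  proof -
    have "bounded_linear (\<lambda>v::'h. (v, 0::'e))" by (intro bounded_linear_Pair bounded_linear_zero bounded_linear_ident)
    then have "bounded_linear (\<lambda>v. S' (u, y) (v, 0))"
      by (rule bounded_linear_compose[OF blinfun.bounded_linear_right])
    then have "bounded_linear (\<lambda>v. S' (u, y) (v, 0) - orth_proj G (S' (u, y) (v, 0)))"
      by (rule bounded_linear_compose[OF blP])
    from onorm[OF this, of v] show ?thesis
      using mult_right_mono[OF \<kappa>_on[OF that] norm_ge_zero[of v]] by linarith
  qed
  \<comment> \<open>The control error is \<epsilon> times norm h, and norm h is at most c |u - u'|,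
    so this makes it at most (1 - \<kappa>) / 4 times |u - u'|.\<close>
  define \<epsilon> where "\<epsilon> = (1 - \<kappa>) / (4 * (c + 1))"
  have \<epsilon>: "0 < \<epsilon>" "\<epsilon> * c \<le> (1 - \<kappa>) / 4" using \<kappa> c0 by (auto simp: \<epsilon>_def field_simps)
  have dense': "z' \<in> closure (range (\<lambda>v. S' z (0, v)))" if "z \<in> X \<times> K" "z' \<in> C" for z z'
    using dense[of "fst z" "snd z"] W C(3) that by (auto simp: fd)
  obtain F :: "nat \<Rightarrow> 'e set" and F' P' leb \<rho> where F: "incseq F" "\<And>n. is_projection_along (F n) (F' n) (P' n)" "closure (\<Union>n. F n) = UNIV"
    and leb: "\<And>n. is_lebesgue_measure_on (F n) (leb n)"
    and \<rho>0: "\<And>n. \<forall>\<xi>\<in>\<E>. \<forall>y. \<rho> n \<xi> y \<ge> 0"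
    and lip: "\<And>n. \<exists>L. \<forall>\<xi>\<in>\<E>. \<forall>\<xi>'\<in>\<E>. \<forall>y y'. \<bar>\<rho> n \<xi> y - \<rho> n \<xi>' y'\<bar> \<le> L * (hist_dist \<iota> \<xi> \<xi>' + norm (y - y'))"
    and dis: "\<And>n. \<forall>\<xi>\<in>\<E>. \<forall>A \<in> sets borel. emeasure (Q \<xi>) A =
             (\<integral>\<^sup>+z. (\<integral>\<^sup>+x. indicator A (z + x) * ennreal (\<rho> n \<xi> (z + x)) \<partial>leb n)
                \<partial>distr (Q \<xi>) borel (\<lambda>y. y - P' n y))"
    using dlp unfolding hyp_DLP_def by (elim exE conjE) (rule that; (assumption | erule allE, assumption))
  have Fs: "subspace (F n)" for n using F(2)[of n] by (simp add: is_projection_along_def)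
  have ex_n: "\<exists>n. \<forall>B. finite B \<longrightarrow> independent B \<longrightarrow> span B = F n \<longrightarrow> (\<exists>A a. 0 \<le> A \<and>
      (\<forall>u\<in>X. \<forall>u'\<in>X. \<forall>b\<in>B. (\<forall>y. \<bar>a u u' b y\<bar> \<le> A * norm (u - u')) \<and>
         (\<forall>y y'. \<bar>a u u' b y - a u u' b y'\<bar> \<le> A * norm (u - u') * norm (y - y'))) \<and>
      (\<forall>u\<in>X. \<forall>u'\<in>X. \<forall>y\<in>K. norm (S' (u', y) (0, \<Sum>b\<in>B. a u u' b y *\<^sub>R b)
          - (\<Sum>c\<in>C. (c \<bullet> (S (u, y) - S (u', y)) / (c \<bullet> c)) *\<^sub>R c)) \<le> \<epsilon> * norm (S (u, y) - S (u', y))))"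
    by (rule control_coefficients[OF S'(2) est1 est2 c0 K RyK X C(1,2) dense' F(1) Fs F(3) \<epsilon>(1)]) assumption+
  then obtain n where n: "\<forall>B. finite B \<longrightarrow> independent B \<longrightarrow> span B = F n \<longrightarrow> (\<exists>A a. 0 \<le> A \<and>
      (\<forall>u\<in>X. \<forall>u'\<in>X. \<forall>b\<in>B. (\<forall>y. \<bar>a u u' b y\<bar> \<le> A * norm (u - u')) \<and>
         (\<forall>y y'. \<bar>a u u' b y - a u u' b y'\<bar> \<le> A * norm (u - u') * norm (y - y'))) \<and>
      (\<forall>u\<in>X. \<forall>u'\<in>X. \<forall>y\<in>K. norm (S' (u', y) (0, \<Sum>b\<in>B. a u u' b y *\<^sub>R b)
          - (\<Sum>c\<in>C. (c \<bullet> (S (u, y) - S (u', y)) / (c \<bullet> c)) *\<^sub>R c)) \<le> \<epsilon> * norm (S (u, y) - S (u', y))))" ..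
  obtain L where L: "\<forall>\<xi>\<in>\<E>. \<forall>\<xi>'\<in>\<E>. \<forall>y y'. \<bar>\<rho> n \<xi> y - \<rho> n \<xi>' y'\<bar> \<le> L * (hist_dist \<iota> \<xi> \<xi>' + norm (y - y'))"
    using lip[of n] ..
  have "\<exists>B M \<alpha>0. finite B \<and> independent B \<and> span B = F n \<and> 0 \<le> M \<and> 0 < \<alpha>0 \<and>
    (\<forall>b\<in>B. \<forall>a \<alpha> g. \<forall>\<xi>\<in>\<E>. 0 \<le> \<alpha> \<longrightarrow> \<alpha> \<le> \<alpha>0 \<longrightarrow> (\<forall>y. \<bar>a y\<bar> \<le> \<alpha>) \<longrightarrow>
      (\<forall>y y'. \<bar>a y - a y'\<bar> \<le> \<alpha> * norm (y - y')) \<longrightarrow> g \<in> borel_measurable borel \<longrightarrow> (\<forall>y. g y \<le> 1) \<longrightarrow>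
      (\<integral>\<^sup>+y. g (y + a y *\<^sub>R b) \<partial>Q \<xi>) \<le> (\<integral>\<^sup>+y. g y \<partial>Q \<xi>) + ennreal (M * \<alpha>))"
    by (rule density_shift[OF F(2)[of n] leb[of n] \<rho>0[of n] L dis[of n] compact_imp_closed[OF K] RK(2) less_imp_le[OF RK(1)] Q]) assumption+
  then obtain B M \<alpha>0 where B: "finite B" "independent B" "span B = F n" and M: "0 \<le> M" and \<alpha>0: "0 < \<alpha>0"
    and shift: "\<forall>b\<in>B. \<forall>a \<alpha> g. \<forall>\<xi>\<in>\<E>. 0 \<le> \<alpha> \<longrightarrow> \<alpha> \<le> \<alpha>0 \<longrightarrow> (\<forall>y. \<bar>a y\<bar> \<le> \<alpha>) \<longrightarrow>
      (\<forall>y y'. \<bar>a y - a y'\<bar> \<le> \<alpha> * norm (y - y')) \<longrightarrow> g \<in> borel_measurable borel \<longrightarrow> (\<forall>y. g y \<le> 1) \<longrightarrow>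
      (\<integral>\<^sup>+y. g (y + a y *\<^sub>R b) \<partial>Q \<xi>) \<le> (\<integral>\<^sup>+y. g y \<partial>Q \<xi>) + ennreal (M * \<alpha>)"
    by (elim exE conjE) (rule that)
  obtain A a where A: "0 \<le> A"
    and a12: "\<forall>u\<in>X. \<forall>u'\<in>X. \<forall>b\<in>B. (\<forall>y. \<bar>a u u' b y\<bar> \<le> A * norm (u - u')) \<and>
         (\<forall>y y'. \<bar>a u u' b y - a u u' b y'\<bar> \<le> A * norm (u - u') * norm (y - y'))"
    and a3': "\<forall>u\<in>X. \<forall>u'\<in>X. \<forall>y\<in>K. norm (S' (u', y) (0, \<Sum>b\<in>B. a u u' b y *\<^sub>R b)
          - (\<Sum>c\<in>C. (c \<bullet> (S (u, y) - S (u', y)) / (c \<bullet> c)) *\<^sub>R c)) \<le> \<epsilon> * norm (S (u, y) - S (u', y))"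
    using n[THEN spec, THEN mp, THEN mp, THEN mp, OF B] by (elim exE conjE) (rule that)
  have a1: "\<bar>a u u' b y\<bar> \<le> A * norm (u - u')"
    and a2: "\<bar>a u u' b y - a u u' b y'\<bar> \<le> A * norm (u - u') * norm (y - y')"
    if "u \<in> X" "u' \<in> X" "b \<in> B" for u u' b y y'
    using a12 that by blast+
  have a3: "norm (S' (u', y) (0, \<Sum>b\<in>B. a u u' b y *\<^sub>R b)
          - orth_proj G (S (u, y) - S (u', y))) \<le> \<epsilon> * norm (S (u, y) - S (u', y))"
    if "u \<in> X" "u' \<in> X" "y \<in> K" for u u' y
    unfolding P(1) using a3' that by blast
  obtain bs where bs: "set bs = B" "distinct bs" using finite_distinct_list[OF B(1)] by blast
  obtain C1 where C1: "0 \<le> C1" and chain: "\<And>a \<alpha>. 0 \<le> \<alpha> \<Longrightarrow> \<alpha> \<le> \<alpha>0 \<Longrightarrow> (\<forall>b\<in>set bs. \<forall>y. \<bar>a b y\<bar> \<le> \<alpha>) \<Longrightarrow>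
      (\<forall>b\<in>set bs. \<forall>y y'. \<bar>a b y - a b y'\<bar> \<le> \<alpha> * norm (y - y')) \<Longrightarrow>
      (\<exists>\<Phi>. approx_shift Q \<E> (\<lambda>y. \<Sum>b\<leftarrow>bs. a b y *\<^sub>R b) C1 \<alpha> \<Phi>)"
  proof -
    have "\<exists>C\<ge>0. \<forall>a \<alpha>. 0 \<le> \<alpha> \<longrightarrow> \<alpha> \<le> \<alpha>0 \<longrightarrow> (\<forall>b\<in>set bs. \<forall>y. \<bar>a b y\<bar> \<le> \<alpha>) \<longrightarrow>
      (\<forall>b\<in>set bs. \<forall>y y'. \<bar>a b y - a b y'\<bar> \<le> \<alpha> * norm (y - y')) \<longrightarrow>
      (\<exists>\<Phi>. approx_shift Q \<E> (\<lambda>y. \<Sum>b\<leftarrow>bs. a b y *\<^sub>R b) C \<alpha> \<Phi>)"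
      by (rule chain_of_shifts[OF _ M]) (use shift bs(1) in simp)
    then show ?thesis using that by blast
  qed
  define C2 where "C2 = C1 * A"
  have C2: "0 \<le> C2" using C1 A by (simp add: C2_def)
  \<comment> \<open>The three quadratic errors: the remainder of \<open>S\<close> in the noise, the
    deviation of the composed shifts from the wanted sum, and the remainder of \<open>S\<close> in
    the state.\<close>
  define \<Psi> where "\<Psi> = c * C2\<^sup>2 + c * (C1 * A\<^sup>2) + c"
  have \<Psi>: "0 \<le> \<Psi>" using c0 C1 by (simp add: \<Psi>_def)
  \<comment> \<open>Three demands, in this order: displacement at most 1, coefficients within the
    admissible size \<open>\<alpha>0\<close>, quadratic errors at most (1 - \<kappa>) / 4 times the
    distance.\<close>
  define d0 where "d0 = min (1 / (C2 + 1)) (min (\<alpha>0 / (A + 1)) ((1 - \<kappa>) / (4 * (\<Psi> + 1))))"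
  have d0: "0 < d0" "C2 * d0 \<le> 1" "A * d0 \<le> \<alpha>0" "\<Psi> * d0 \<le> (1 - \<kappa>) / 4"
  proof -
    show "0 < d0" using C2 A \<alpha>0 \<Psi> \<kappa> by (simp add: d0_def)
    have "C2 * d0 \<le> C2 * (1 / (C2 + 1))" using C2 by (intro mult_left_mono) (auto simp: d0_def)
    also have "\<dots> \<le> 1" using C2 by (simp add: field_simps)
    finally show "C2 * d0 \<le> 1" .
    have "A * d0 \<le> A * (\<alpha>0 / (A + 1))" using A by (intro mult_left_mono) (auto simp: d0_def)
    also have "\<dots> \<le> \<alpha>0" using A \<alpha>0 by (simp add: field_simps)
    finally show "A * d0 \<le> \<alpha>0" .
    have "\<Psi> * d0 \<le> \<Psi> * ((1 - \<kappa>) / (4 * (\<Psi> + 1)))" using \<Psi> by (intro mult_left_mono) (auto simp: d0_def)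
    also have "\<dots> = (\<Psi> / (\<Psi> + 1)) * ((1 - \<kappa>) / 4)" by simp
    also have "\<dots> \<le> 1 * ((1 - \<kappa>) / 4)" using \<Psi> \<kappa> by (intro mult_right_mono) auto
    finally show "\<Psi> * d0 \<le> (1 - \<kappa>) / 4" by simp
  qed
  show ?thesis
  proof (rule exI[of _ "(1 + \<kappa>) / 2"], rule exI[of _ C2], rule exI[of _ d0], intro conjI ballI impI)
    fix u u' assume u: "u \<in> X" "u' \<in> X" and small: "norm (u - u') \<le> d0"
    define d where "d = norm (u - u')"
    have d: "0 \<le> d" "d \<le> d0" using small by (auto simp: d_def)
    have Ad: "A * d \<le> \<alpha>0" using mult_left_mono[OF d(2) A] d0(3) by linarith
    have Cd: "C2 * d \<le> 1" using mult_left_mono[OF d(2) C2] d0(2) by linarith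
    have Pd: "\<Psi> * d \<le> (1 - \<kappa>) / 4" using mult_left_mono[OF d(2) \<Psi>] d0(4) by linarith
    have "\<exists>\<Phi>. approx_shift Q \<E> (\<lambda>y. \<Sum>b\<leftarrow>bs. a u u' b y *\<^sub>R b) C1 (A * d) \<Phi>"
      by (rule chain) (use A d(1) Ad a1[OF u] a2[OF u] in \<open>auto simp: bs(1) d_def\<close>)
    then obtain \<Phi> where \<Phi>: "approx_shift Q \<E> (\<lambda>y. \<Sum>b\<leftarrow>bs. a u u' b y *\<^sub>R b) C1 (A * d) \<Phi>" ..
    have \<Phi>1: "norm (\<Phi> y - y) \<le> C2 * d" for y using \<Phi> by (simp add: approx_shift_def C2_def mult.assoc)
    have \<Phi>2: "norm (\<Phi> y - y - (\<Sum>b\<in>B. a u u' b y *\<^sub>R b)) \<le> C1 * A\<^sup>2 * d\<^sup>2" for y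
      using \<Phi> bs by (simp add: approx_shift_def sum_list_distinct_conv_sum_set power_mult_distrib mult.assoc)
    show "\<exists>\<Phi>. continuous_on UNIV \<Phi> \<and> (\<forall>y\<in>K. norm (S (u, y) - S (u', \<Phi> y)) \<le> (1 + \<kappa>) / 2 * norm (u - u')) \<and>
      (\<forall>y. norm (\<Phi> y - y) \<le> C2 * norm (u - u')) \<and>
      (\<forall>\<xi>\<in>\<E>. \<forall>g. g \<in> borel_measurable borel \<longrightarrow> (\<forall>y. g y \<le> 1) \<longrightarrow>
         (\<integral>\<^sup>+y. g (\<Phi> y) \<partial>Q \<xi>) \<le> (\<integral>\<^sup>+y. g y \<partial>Q \<xi>) + ennreal (C2 * norm (u - u')))"
    proof (rule exI[of _ \<Phi>], intro conjI ballI allI impI)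
      show "continuous_on UNIV \<Phi>" using \<Phi> by (simp add: approx_shift_def)
      show "norm (\<Phi> y - y) \<le> C2 * norm (u - u')" for y using \<Phi>1 by (simp add: d_def)
      show "(\<integral>\<^sup>+y. g (\<Phi> y) \<partial>Q \<xi>) \<le> (\<integral>\<^sup>+y. g y \<partial>Q \<xi>) + ennreal (C2 * norm (u - u'))"
        if "\<xi> \<in> \<E>" "g \<in> borel_measurable borel" "\<forall>y. g y \<le> 1" for \<xi> g
        using \<Phi> that by (simp add: approx_shift_def C2_def d_def mult.assoc)
      fix y assume y: "y \<in> K"
      define e where "e = \<Phi> y - y"
      define b where "b = (\<Sum>b\<in>B. a u u' b y *\<^sub>R b)"
      define h where "h = S (u, y) - S (u', y)"
      define w where "w = h - S' (u', y) (u - u', 0)"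
      have e: "norm e \<le> C2 * d" "norm (e - b) \<le> C1 * A\<^sup>2 * d\<^sup>2" using \<Phi>1 \<Phi>2 by (simp_all add: e_def b_def)
      have yR: "norm y \<le> R" using RyK[OF y] by linarith
      have yeR: "norm (y + e) \<le> R" using norm_triangle_ineq[of y e] e(1) Cd RyK[OF y] by linarith
      have u'R: "norm u' \<le> R" and uR: "norm u \<le> R" using RuX u by auto
      have t1: "norm (S (u', y + e) - S (u', y) - S' (u', y) (0, e)) \<le> c * C2\<^sup>2 * d\<^sup>2"
      proof -
        have "norm (S (u', y + e) - S (u', y) - S' (u', y) (0, e)) \<le> norm e * (c * norm e)"
          using c4[OF u'R yeR u'R yR] by (simp add: norm_Pair)
        also have "\<dots> \<le> (C2 * d) * (c * (C2 * d))" using e(1) c0 C2 d(1) by (intro mult_mono) auto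
        finally show ?thesis by (simp add: power2_eq_square mult_ac)
      qed
      have t2: "norm (S' (u', y) (0, e) - S' (u', y) (0, b)) \<le> c * (C1 * A\<^sup>2) * d\<^sup>2"
      proof -
        have "S' (u', y) (0, e) - S' (u', y) (0, b) = S' (u', y) (0, e - b)" by (simp add: blinfun.diff_right[symmetric])
        moreover have "norm (S' (u', y) (0, e - b)) \<le> norm (S' (u', y)) * norm (0::'h, e - b)" by (rule norm_blinfun)
        moreover have "\<dots> \<le> c * (C1 * A\<^sup>2 * d\<^sup>2)" using c1[OF u'R yR] e(2) c0 by (intro mult_mono) (auto simp: norm_Pair)
        ultimately show ?thesis by (simp add: mult_ac)
      qed
      have t3: "norm (S' (u', y) (0, b) - orth_proj G h) \<le> (1 - \<kappa>) / 4 * d"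
      proof -
        have "norm (S' (u', y) (0, b) - orth_proj G h) \<le> \<epsilon> * norm h" using a3[OF u y] by (simp add: b_def h_def)
        also have "\<dots> \<le> \<epsilon> * (c * d)" using est1[OF u yR] \<epsilon>(1) by (intro mult_left_mono) (auto simp: h_def d_def)
        also have "\<dots> = (\<epsilon> * c) * d" by simp
        also have "\<dots> \<le> (1 - \<kappa>) / 4 * d" by (intro mult_right_mono \<epsilon> d)
        finally show ?thesis .
      qed
      have t4: "norm (h - orth_proj G h) \<le> \<kappa> * d + c * d\<^sup>2"
      proof -
        have "norm w \<le> d * (c * d)" using c4[OF uR yR u'R yR] by (simp add: w_def h_def norm_Pair d_def)
        then have "norm (w - orth_proj G w) \<le> c * d\<^sup>2" using P(2)[of w] by (simp add: power2_eq_square mult_ac)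
        moreover have "h - orth_proj G h = (S' (u', y) (u - u', 0) - orth_proj G (S' (u', y) (u - u', 0))) + (w - orth_proj G w)"
          using diffP[of "S' (u', y) (u - u', 0)" w] by (simp add: w_def)
        moreover have "norm (S' (u', y) (u - u', 0) - orth_proj G (S' (u', y) (u - u', 0))) \<le> \<kappa> * d"
          using \<kappa>_le[OF u(2) y, of "u - u'"] by (simp add: d_def)
        ultimately show ?thesis by (simp only: norm_triangle_mono)
      qed
      define x1 x2 x3 x4 where x: "x1 = h - orth_proj G h" "x2 = S (u', y + e) - S (u', y) - S' (u', y) (0, e)"
        "x3 = S' (u', y) (0, e) - S' (u', y) (0, b)" "x4 = S' (u', y) (0, b) - orth_proj G h"
      \<comment> \<open>Here x1 is the uncontrolled part, x2 and x3 are quadratic, and x4 is the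
        error of the control.\<close>
      have eq: "S (u, y) - S (u', \<Phi> y) = x1 - (x2 + x3 + x4)"
        by (simp add: x h_def e_def)
      have "norm (S (u, y) - S (u', \<Phi> y)) \<le> norm x1 + (norm x2 + norm x3 + norm x4)"
        unfolding eq using norm_triangle_ineq4[of x1 "x2 + x3 + x4"] norm_triangle_ineq[of "x2 + x3" x4]
          norm_triangle_ineq[of x2 x3] by linarith
      also have "\<dots> \<le> (\<kappa> * d + c * d\<^sup>2) + (c * C2\<^sup>2 * d\<^sup>2 + c * (C1 * A\<^sup>2) * d\<^sup>2 + (1 - \<kappa>) / 4 * d)"
        unfolding x by (intro add_mono t1 t2 t3 t4)
      also have "\<dots> = (\<kappa> + (1 - \<kappa>) / 4 + \<Psi> * d) * d" by (simp add: \<Psi>_def power2_eq_square algebra_simps)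
      also have "\<dots> \<le> (1 + \<kappa>) / 2 * d"
      proof (rule mult_right_mono[OF _ d(1)])
        show "\<kappa> + (1 - \<kappa>) / 4 + \<Psi> * d \<le> (1 + \<kappa>) / 2" using Pd by argo
      qed
      finally show "norm (S (u, y) - S (u', \<Phi> y)) \<le> (1 + \<kappa>) / 2 * norm (u - u')" by (simp add: d_def)
    qed
  qed (use \<kappa> C2 d0 in auto)
qed

section \<open>Weak compactness\<close>

text \<open>With digits 0 and 1 in base 3 there is no carrying: the first differing digit, at place
  m, contributes (1/3)^m and all later ones together at most half of that. So close numbers must
  share their leading digits.\<close>

lemma ternary_digits_eq:
  fixes d d' :: "nat \<Rightarrow> real"
  assumes d: "\<And>n. d n \<in> {0, 1}" "\<And>n. d' n \<in> {0, 1}"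
    and close: "\<bar>(\<Sum>n. d n * (1/3)^n) - (\<Sum>n. d' n * (1/3)^n)\<bar> < (1/3)^N / 2" and n: "n < N"
  shows "d n = d' n"
proof (rule ccontr)
  assume "d n \<noteq> d' n"
  define c where "c k = d k - d' k" for k
  define m where "m = (LEAST k. c k \<noteq> 0)"
  have cn: "c n \<noteq> 0" using \<open>d n \<noteq> d' n\<close> by (simp add: c_def)
  have cm: "c m \<noteq> 0" unfolding m_def by (rule LeastI[of "\<lambda>k. c k \<noteq> 0" n, OF cn])
  have mN: "m < N" using Least_le[of "\<lambda>k. c k \<noteq> 0", OF cn] n by (simp add: m_def)
  have cz: "c k = 0" if "k < m" for k using not_less_Least[of k "\<lambda>k. c k \<noteq> 0"] that by (simp add: m_def)
  have c1: "\<bar>c k\<bar> \<le> 1" for k using d(1)[of k] d(2)[of k] by (auto simp: c_def)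
  have cm1: "\<bar>c m\<bar> = 1" using cm d(1)[of m] d(2)[of m] by (auto simp: c_def)
  have sg: "summable (\<lambda>n. (1/3::real)^n)" by (rule summable_geometric) simp
  have nd: "norm (d n * (1/3)^n) \<le> (1/3)^n" "norm (d' n * (1/3)^n) \<le> (1/3)^n" for n
    using d(1)[of n] d(2)[of n] by auto
  have sd: "summable (\<lambda>n. d n * (1/3)^n)" and sd': "summable (\<lambda>n. d' n * (1/3)^n)"
    by (rule summable_comparison_test'[OF sg, of 0], rule nd)+
  have sc: "summable (\<lambda>n. c n * (1/3)^n)"
    unfolding c_def left_diff_distrib by (intro summable_diff sd sd')
  have "(\<Sum>n. d n * (1/3)^n) - (\<Sum>n. d' n * (1/3)^n) = (\<Sum>n. c n * (1/3)^n)"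
    unfolding c_def left_diff_distrib by (rule suminf_diff[OF sd sd'])
  also have "\<dots> = (\<Sum>k. c (k + Suc m) * (1/3)^(k + Suc m)) + (\<Sum>k<Suc m. c k * (1/3)^k)"
    by (rule suminf_split_initial_segment[OF sc])
  also have "(\<Sum>k<Suc m. c k * (1/3)^k) = c m * (1/3)^m" using cz by simp
  finally have eq: "(\<Sum>n. d n * (1/3)^n) - (\<Sum>n. d' n * (1/3)^n) =
    (\<Sum>k. c (k + Suc m) * (1/3)^(k + Suc m)) + c m * (1/3)^m" .
  have "\<bar>\<Sum>k. c (k + Suc m) * (1/3)^(k + Suc m)\<bar> \<le> (\<Sum>k. (1/3)^Suc m * (1/3::real)^k)"
  proof (rule order_trans[OF summable_rabs])
    show s1: "summable (\<lambda>k. \<bar>c (k + Suc m) * (1 / 3) ^ (k + Suc m)\<bar>)"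
      by (rule summable_comparison_test'[of "\<lambda>k. (1/3)^Suc m * (1/3::real)^k" 0])
        (use c1 in \<open>auto intro!: summable_mult sg mult_right_mono simp: abs_mult power_add mult_le_one\<close>)
    show "(\<Sum>k. \<bar>c (k + Suc m) * (1 / 3) ^ (k + Suc m)\<bar>) \<le> (\<Sum>k. (1 / 3) ^ Suc m * (1 / 3) ^ k)"
      by (rule suminf_le[OF _ s1 summable_mult[OF sg]])
        (use c1 in \<open>auto simp: abs_mult power_add mult_le_one\<close>)
  qed
  also have "\<dots> = (1/3)^m / 2"
    by (subst suminf_mult[OF sg]) (simp add: suminf_geometric)
  finally have "(1/3)^m / 2 \<le> \<bar>(\<Sum>k. c (k + Suc m) * (1/3)^(k + Suc m)) + c m * (1/3)^m\<bar>"
    using cm1 by (cases "c m = 1") (auto simp: abs_if split: if_splits)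
  moreover have "(1/3)^N \<le> (1/3::real)^m" using mN by (intro power_decreasing) auto
  ultimately show False using close unfolding eq by linarith
qed

text \<open>The proof codes the points of \<open>X\<close> by real numbers, with a code that has a continuous left
  inverse on the closure of its range, so that Helly's selection theorem applies.\<close>

lemma compact_weak_limit:
  fixes X :: "'a::{complete_space, second_countable_topology} set"
  assumes X: "compact X" and \<Lambda>: "\<And>n::nat. \<Lambda> n \<in> prob_on X"
  obtains \<mu> r where "\<mu> \<in> prob_on X" "strict_mono (r :: nat \<Rightarrow> nat)"
    "\<And>f B. continuous_on UNIV f \<Longrightarrow> (\<And>x. \<bar>f x\<bar> \<le> B) \<Longrightarrow> (\<lambda>n. \<integral>x. f x \<partial>\<Lambda> (r n)) \<longlonglongrightarrow> (\<integral>x. (f x :: real) \<partial>\<mu>)"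
proof -
  have ps: "prob_space (\<Lambda> n)" and sets: "sets (\<Lambda> n) = sets borel" and em: "emeasure (\<Lambda> n) X = 1" for n
    using \<Lambda>[of n] by (auto simp: prob_on_def)
  have [measurable_cong]: "sets (\<Lambda> n) = sets borel" for n by fact
  have closedX: "closed X" using X by (rule compact_imp_closed)
  have AEX: "AE x in \<Lambda> n. x \<in> X" for n
    using em[of n] by (intro prob_space.AE_prob_1[OF ps]) (simp add: measure_def)
  have "X \<noteq> {}" using em[of 0] by auto
  then obtain x0 where x0: "x0 \<in> X" by auto
  obtain \<B> :: "'a set set" where \<B>: "countable \<B>" "topological_basis \<B>"
    using ex_countable_basis by blast
  have "\<B> \<noteq> {}"
  proof
    assume "\<B> = {}"
    then have "(UNIV :: 'a set) = {}" using topological_basisE[OF \<B>(2), of UNIV x0] by auto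
    then show False by simp
  qed
  define U where "U = from_nat_into \<B>"
  have U: "open (U n)" for n
    using \<B>(2) from_nat_into[OF \<open>\<B> \<noteq> {}\<close>, of n] by (auto simp: U_def topological_basis_open)
  have U_ex: "\<exists>n. x \<in> U n \<and> U n \<subseteq> V" if V: "open V" "x \<in> V" for V x
  proof -
    obtain B where "B \<in> \<B>" "x \<in> B" "B \<subseteq> V" using topological_basisE[OF \<B>(2) V] by blast
    then show ?thesis using from_nat_into_surj[OF \<B>(1), of B] by (auto simp: U_def)
  qed
  \<comment> \<open>Finitely many basic open sets of small diameter cover \<open>X\<close>. Two
    points with the same membership pattern in them lie in a common one.\<close>
  have sep: "\<exists>N. \<forall>x\<in>X. \<forall>y\<in>X. (\<forall>n<N. x \<in> U n \<longleftrightarrow> y \<in> U n) \<longrightarrow> dist x y < e" if "0 < e" for e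
  proof -
    have "\<exists>n. x \<in> U n \<and> U n \<subseteq> ball x (e/2)" for x
      using U_ex[of "ball x (e/2)" x] that by simp
    note ex = this
    define n where "n x = (SOME n. x \<in> U n \<and> U n \<subseteq> ball x (e/2))" for x
    have n: "x \<in> U (n x) \<and> U (n x) \<subseteq> ball x (e/2)" for x
      unfolding n_def by (rule someI_ex) (rule ex)
    obtain D where D: "D \<subseteq> X" "finite D" "X \<subseteq> (\<Union>x\<in>D. U (n x))"
    proof (rule compactE_image[OF X, of X "\<lambda>x. U (n x)"])
      show "X \<subseteq> (\<Union>x\<in>X. U (n x))" using conjunct1[OF n] by auto
    qed (use U that in auto)
    have "dist x y < e" if xy: "x \<in> X" "y \<in> X" "\<forall>k<Suc (Max (n ` D)). x \<in> U k \<longleftrightarrow> y \<in> U k" for x y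
    proof -
      obtain z where z: "z \<in> D" "x \<in> U (n z)" using D xy(1) by auto
      have "n z < Suc (Max (n ` D))" using z D by (simp add: less_Suc_eq_le)
      then have "y \<in> U (n z)" using xy(3) z by blast
      then show ?thesis using n[of z] z dist_triangle_half_r[of z x e y] by (auto simp: subset_iff)
    qed
    then show ?thesis by blast
  qed
  define s where "s x = (\<Sum>n. indicator (U n) x * (1/3::real)^n)" for x
  have sg: "summable (\<lambda>n. (1/3::real)^n)" by (rule summable_geometric) simp
  have ss: "summable (\<lambda>n. indicator (U n) x * (1/3::real)^n)" for x
    by (rule summable_comparison_test'[OF sg, of 0]) (auto simp: indicator_def)
  have s0: "0 \<le> s x" for x unfolding s_def by (intro suminf_nonneg ss) auto
  have "s x \<le> (\<Sum>n. (1/3::real)^n)" for x unfolding s_def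
    by (intro suminf_le ss sg) (auto simp: indicator_def)
  then have s2: "s x \<le> 3/2" for x by (simp add: suminf_geometric)
  have [measurable]: "U n \<in> sets borel" for n using U by auto
  have sM[measurable]: "s \<in> borel_measurable borel" unfolding s_def by measurable
  \<comment> \<open>The code \<open>s\<close> itself is merely Borel, but its inverse is uniformly
    continuous: close codes share their first \<open>N\<close> digits, hence the membership
    pattern.\<close>
  have code: "\<exists>d>0. \<forall>x\<in>X. \<forall>y\<in>X. \<bar>s x - s y\<bar> < d \<longrightarrow> dist x y < e" if e: "0 < e" for e
  proof -
    obtain N where N: "\<forall>x\<in>X. \<forall>y\<in>X. (\<forall>n<N. x \<in> U n \<longleftrightarrow> y \<in> U n) \<longrightarrow> dist x y < e"
      using sep[OF e] by blast
    have "dist x y < e" if xy: "x \<in> X" "y \<in> X" "\<bar>s x - s y\<bar> < (1/3)^N / 2" for x y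
    proof -
      have "x \<in> U n \<longleftrightarrow> y \<in> U n" if "n < N" for n
        using ternary_digits_eq[of "\<lambda>n. indicator (U n) x" "\<lambda>n. indicator (U n) y" N n] xy(3) that
        unfolding s_def by (auto simp: indicator_def split: if_splits)
      then show ?thesis using N xy by blast
    qed
    then show ?thesis by (intro exI[of _ "(1/3)^N / 2"]) auto
  qed
  define v where "v = inv_into X s"
  have v: "v t \<in> X" "s (v t) = t" if "t \<in> s ` X" for t
    using that by (auto simp: v_def inv_into_into f_inv_into_f)
  have vs: "v (s x) = x" if "x \<in> X" for x
  proof (rule ccontr)
    assume "v (s x) \<noteq> x"
    then obtain d where "d > 0" "\<forall>y\<in>X. \<forall>z\<in>X. \<bar>s y - s z\<bar> < d \<longrightarrow> dist y z < dist (v (s x)) x"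
      using code[of "dist (v (s x)) x"] by auto
    then show False using v[of "s x"] that by force
  qed
  have "uniformly_continuous_on (s ` X) v"
    unfolding uniformly_continuous_on_def
  proof (intro allI impI)
    fix e :: real assume "0 < e"
    from code[OF this] obtain d where d: "0 < d" "\<forall>x\<in>X. \<forall>y\<in>X. \<bar>s x - s y\<bar> < d \<longrightarrow> dist x y < e" by blast
    show "\<exists>d>0. \<forall>t\<in>s ` X. \<forall>t'\<in>s ` X. dist t' t < d \<longrightarrow> dist (v t') (v t) < e"
      by (intro exI[of _ d] conjI d(1)) (auto simp: vs dist_real_def d(2))
  qed
  \<comment> \<open>Uniform continuity extends the decoding to the closure of the set of codes. This
    matters because the limit law may charge limits of codes that are not codes themselves.\<close>
  then obtain g where g: "uniformly_continuous_on (closure (s ` X)) g" "\<And>t. t \<in> s ` X \<Longrightarrow> v t = g t"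
    using uniformly_continuous_on_extension_on_closure by metis
  define C where "C = closure (s ` X)"
  have C: "closed C" by (simp add: C_def)
  have gc: "continuous_on C g" using g(1) by (simp add: C_def uniformly_continuous_imp_continuous)
  have gs: "g (s x) = x" if "x \<in> X" for x using g(2)[of "s x"] vs that by auto
  have gX: "g ` C \<subseteq> X" unfolding C_def
    by (rule image_closure_subset) (use gc gs closedX in \<open>auto simp: C_def\<close>)
  have sC: "s x \<in> C" if "x \<in> X" for x
    unfolding C_def by (rule subsetD[OF closure_subset]) (use that in auto)
  define \<nu> where "\<nu> n = distr (\<Lambda> n) borel s" for n
  have rd: "real_distribution (\<nu> n)" for n
    unfolding \<nu>_def by (rule prob_space.real_distribution_distr[OF ps]) simp
  have "tight \<nu>" unfolding tight_def
  proof (intro conjI allI impI rd)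
    fix e :: real assume "0 < e"
    have "-1 < s x" "s x \<le> 2" for x using s0[of x] s2[of x] by linarith+
    then have "s -` {-1<..2} = UNIV" by auto
    then have "measure (\<nu> n) {-1<..2} = 1" for n
      using prob_space.prob_space[OF ps[of n]] sets_eq_imp_space_eq[OF sets[of n]] by (simp add: \<nu>_def measure_distr)
    then show "\<exists>a b. a < b \<and> (\<forall>n. 1 - e < measure (\<nu> n) {a<..b})"
      using \<open>0 < e\<close> by (intro exI[of _ "-1"] exI[of _ 2]) auto
  qed
  from tight_imp_convergent_subsubsequence[OF this strict_mono_id] obtain r N where
    r: "strict_mono r" and N: "real_distribution N" and wc: "weak_conv_m (\<nu> \<circ> id \<circ> r) N" by blast
  interpret N: real_distribution N by fact
  have conv: "(\<lambda>n. \<integral>x. h (s x) \<partial>\<Lambda> (r n)) \<longlonglongrightarrow> (\<integral>t. h t \<partial>N)"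
    if h: "continuous_on UNIV h" "\<And>t. \<bar>h t\<bar> \<le> B" for h :: "real \<Rightarrow> real" and B
  proof -
    have [measurable]: "h \<in> borel_measurable borel" using h(1) by (rule borel_measurable_continuous_onI)
    have "(\<lambda>n. \<integral>t. h t \<partial>((\<nu> \<circ> id \<circ> r) n)) \<longlonglongrightarrow> (\<integral>t. h t \<partial>N)"
      by (rule weak_conv_imp_integral_bdd_continuous_conv[OF _ N wc])
        (use rd h in \<open>auto simp: continuous_on_eq_continuous_at\<close>)
    then show ?thesis by (simp add: \<nu>_def integral_distr)
  qed
  \<comment> \<open>The truncated distance to \<open>C\<close> is a bounded continuous test function
    that vanishes on all codes, so its integral vanishes in the limit.\<close>
  have NC: "AE t in N. t \<in> C"
  proof -
    define h where "h t = min 1 (infdist t C)" for t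
    have h: "continuous_on UNIV h" "\<And>t. \<bar>h t\<bar> \<le> 1"
      unfolding h_def by (auto intro!: continuous_intros simp: infdist_nonneg)
    have [measurable]: "h \<in> borel_measurable borel" using h(1) by (rule borel_measurable_continuous_onI)
    have "(\<integral>x. h (s x) \<partial>\<Lambda> n) = (\<integral>x. 0 \<partial>\<Lambda> n)" for n
    proof (rule integral_cong_AE)
      show "AE x in \<Lambda> n. h (s x) = 0"
        using AEX[of n] by eventually_elim (use sC in \<open>auto simp: h_def\<close>)
    qed measurable
    then have "(\<integral>t. h t \<partial>N) = 0" using conv[OF h] LIMSEQ_unique[OF conv[OF h], of 0] by simp
    moreover have "integrable N h" using h(2) by (intro N.integrable_const_bound[of _ 1]) auto
    ultimately have h0: "AE t in N. h t = 0"
      by (subst (asm) integral_nonneg_eq_0_iff_AE) (auto simp: h_def infdist_nonneg)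
    have hC: "t \<in> C" if "h t = 0" for t
      using that C sC[OF x0] in_closed_iff_infdist_zero[of C t] by (auto simp: h_def min_def split: if_splits)
    show ?thesis using h0 by eventually_elim (rule hC)
  qed
  \<comment> \<open>The value \<open>x0\<close> off \<open>C\<close> is arbitrary; it is taken on a
    null set only and keeps the map Borel with values in \<open>X\<close>.\<close>
  define \<pi> where "\<pi> t = (if t \<in> C then g t else x0)" for t
  have \<pi>M[measurable]: "\<pi> \<in> borel_measurable borel"
    unfolding \<pi>_def using C gc by (intro borel_measurable_continuous_on_if) auto
  have \<pi>X: "\<pi> t \<in> X" for t using gX x0 by (auto simp: \<pi>_def)
  define \<mu> where "\<mu> = distr N borel \<pi>"
  show thesis
  proof (rule that[of \<mu> r])
    have "emeasure \<mu> X = emeasure N (space N)" using closedX \<pi>X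
      by (simp add: \<mu>_def emeasure_distr vimage_def)
    then show "\<mu> \<in> prob_on X" using N.prob_space_distr[of \<pi> borel]
      using N.emeasure_space_1 by (auto simp: prob_on_def \<mu>_def)
    show "strict_mono r" by fact
    fix f :: "'a \<Rightarrow> real" and B assume f: "continuous_on UNIV f" "\<And>x. \<bar>f x\<bar> \<le> B"
    have [measurable]: "f \<in> borel_measurable borel" using f(1) by (rule borel_measurable_continuous_onI)
    have "continuous_on C (\<lambda>t. f (g t))"
      by (rule continuous_on_compose2[OF f(1) gc]) simp
    \<comment> \<open>Tietze's theorem turns \<open>f\<close> composed with the decoding into a
      bounded continuous function on the line, the kind of test function that weak convergence on
      the reals admits.\<close>
    then obtain h where h: "continuous_on UNIV h" "\<And>t. t \<in> C \<Longrightarrow> h t = f (g t)" "\<And>t. t \<in> UNIV \<Longrightarrow> norm (h t) \<le> B"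
    proof (rule Tietze[of C "\<lambda>t. f (g t)" UNIV B])
      show "0 \<le> B" using f(2)[of x0] by linarith
    qed (use f(2) C that in auto)
    have [measurable]: "h \<in> borel_measurable borel" using h(1) by (rule borel_measurable_continuous_onI)
    have "(\<integral>x. h (s x) \<partial>\<Lambda> n) = (\<integral>x. f x \<partial>\<Lambda> n)" for n
    proof (rule integral_cong_AE)
      show "AE x in \<Lambda> n. h (s x) = f x"
        using AEX[of n] by eventually_elim (simp add: h(2) sC gs)
    qed measurable
    moreover have "(\<integral>t. h t \<partial>N) = (\<integral>x. f x \<partial>\<mu>)"
    proof -
      have "(\<integral>t. h t \<partial>N) = (\<integral>t. f (\<pi> t) \<partial>N)"
      proof (rule integral_cong_AE)
        show "AE t in N. h t = f (\<pi> t)" using NC by eventually_elim (simp add: h(2) \<pi>_def)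
      qed measurable
      then show ?thesis by (simp add: \<mu>_def integral_distr)
    qed
    ultimately show "(\<lambda>n. \<integral>x. f x \<partial>\<Lambda> (r n)) \<longlonglongrightarrow> (\<integral>x. f x \<partial>\<mu>)"
      using conv[OF h(1), of B] h(3) by simp
  qed
qed

section \<open>The chain of states and noise histories\<close>

lemma case_nat_measurable [measurable (raw)]:
  fixes f :: "'a \<Rightarrow> 'e::second_countable_topology"
  assumes [measurable]: "f \<in> borel_measurable M" "g \<in> borel_measurable M"
  shows "(\<lambda>x. (case_nat (f x) (g x) :: nat \<Rightarrow> 'e)) \<in> borel_measurable M"
proof (rule measurable_coordinatewise_then_product)
  fix i show "(\<lambda>x. (case_nat (f x) (g x) :: nat \<Rightarrow> 'e) i) \<in> borel_measurable M"
    by (cases i) (simp_all add: measurable_compose[OF assms(2) measurable_product_coordinates])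
qed

lemma hist_append_measurable [measurable (raw)]:
  fixes f :: "'a \<Rightarrow> nat \<Rightarrow> 'e::second_countable_topology"
  assumes [measurable]: "f \<in> borel_measurable M" "g \<in> measurable M (Pi\<^sub>M {1..k} (\<lambda>_. borel))"
  shows "(\<lambda>x. hist_append (f x) k (g x)) \<in> borel_measurable M"
proof (rule measurable_coordinatewise_then_product)
  fix i show "(\<lambda>x. hist_append (f x) k (g x) i) \<in> borel_measurable M"
    by (cases "i < k") (auto simp: hist_append_def measurable_compose[OF assms(1) measurable_product_coordinates]
      intro!: measurable_compose[OF assms(2) measurable_component_singleton])
qed

lemma hist_append_0 [simp]: "hist_append \<xi> 0 y = \<xi>"
  by (simp add: hist_append_def)

lemma hist_append_Suc: "hist_append \<xi> (Suc k) (y(Suc k := z)) = case_nat z (hist_append \<xi> k y)"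
  by (auto simp: hist_append_def fun_eq_iff split: nat.split)

lemma traj_cong: "(\<And>j. 1 \<le> j \<Longrightarrow> j \<le> k \<Longrightarrow> y j = y' j) \<Longrightarrow> traj S u y k = traj S u y' k"
  by (induction k) auto

lemma traj_add: "traj S u y (k + n) = traj S (traj S u y k) (\<lambda>j. y (k + j)) n"
  by (induction n) auto

lemma traj_in:
  assumes "S ` (X \<times> K) \<subseteq> X" "u \<in> X" "\<And>j. 1 \<le> j \<Longrightarrow> j \<le> k \<Longrightarrow> y j \<in> K"
  shows "traj S u y k \<in> X"
  using assms(3) by (induction k) (use assms(1,2) in \<open>auto simp: image_subset_iff\<close>)

locale driven_chain =
  fixes S :: "'h::{real_normed_vector, second_countable_topology} \<times> 'e::{real_normed_vector, second_countable_topology} \<Rightarrow> 'h"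
    and Q :: "(nat \<Rightarrow> 'e) \<Rightarrow> 'e measure"
  assumes S_cont: "continuous_on UNIV S"
    and Q_kernel: "Q \<in> measurable borel (prob_algebra borel)"
begin

lemma S_measurable [measurable (raw)]:
  assumes [measurable]: "f \<in> borel_measurable M" "g \<in> borel_measurable M"
  shows "(\<lambda>x. S (f x, g x)) \<in> borel_measurable M"
  by (rule measurable_compose[OF borel_measurable_Pair[OF assms] borel_measurable_continuous_onI[OF S_cont]])

lemma Q_compose [measurable (raw)]:
  "f \<in> borel_measurable M \<Longrightarrow> (\<lambda>x. Q (f x)) \<in> measurable M (prob_algebra borel)"
  by (rule measurable_compose[OF _ Q_kernel])

lemma prob_space_Q: "prob_space (Q \<xi>)" and sets_Q [measurable_cong, simp]: "sets (Q \<xi>) = sets borel"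
  and space_Q [simp]: "space (Q \<xi>) = UNIV"
  using measurable_space[OF Q_kernel, of \<xi>]
  by (auto simp: space_prob_algebra dest: sets_eq_imp_space_eq)

definition step :: "('h \<times> (nat \<Rightarrow> 'e) \<Rightarrow> real) \<Rightarrow> 'h \<times> (nat \<Rightarrow> 'e) \<Rightarrow> real" where
  "step f z = (\<integral>y. f (S (fst z, y), case_nat y (snd z)) \<partial>Q (snd z))"

text \<open>Bounds and measurability are imposed everywhere and not only on states and histories
  that occur. The class is thus stable under \<open>step\<close> with no appeal to invariance, and
  integrability is automatic.\<close>

definition unit_fun :: "('h \<times> (nat \<Rightarrow> 'e) \<Rightarrow> real) \<Rightarrow> bool" where
  "unit_fun f \<longleftrightarrow> f \<in> borel_measurable borel \<and> (\<forall>z. 0 \<le> f z \<and> f z \<le> 1)"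

lemma unit_fun_compose:
  assumes "unit_fun f" "g \<in> borel_measurable M" "h \<in> borel_measurable M"
  shows "(\<lambda>x. f (g x, h x)) \<in> borel_measurable M"
  using assms by (auto simp: unit_fun_def intro!: measurable_compose[OF borel_measurable_Pair])

lemma unit_fun_integrable:
  assumes "unit_fun f" "prob_space M" "g \<in> borel_measurable M" "h \<in> borel_measurable M"
  shows "integrable M (\<lambda>x. f (g x, h x))"
proof -
  interpret prob_space M by fact
  show ?thesis using assms(1) unit_fun_compose[OF assms(1,3,4)]
    by (intro integrable_const_bound[of _ 1]) (auto simp: unit_fun_def)
qed

lemma step_integrable: "unit_fun f \<Longrightarrow> integrable (Q \<xi>) (\<lambda>y. f (S (u, y), case_nat y \<xi>))"
  by (rule unit_fun_integrable[OF _ prob_space_Q]) measurable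

lemma unit_fun_step:
  assumes f: "unit_fun f"
  shows "unit_fun (step f)"
proof -
  have [measurable]: "f \<in> borel_measurable borel" using f by (simp add: unit_fun_def)
  have "(\<lambda>z. distr (Q (snd z)) borel (\<lambda>y. (S (fst z, y), case_nat y (snd z)))) \<in> measurable borel (prob_algebra borel)"
    by (rule measurable_distr_prob_space2[where M=borel]) (auto simp: case_prod_beta' borel_prod[symmetric] intro!: borel_measurable_Pair measurable_compose[OF measurable_fst] S_measurable case_nat_measurable)
  from measurable_compose[OF measurable_prob_algebraD[OF this] integral_measurable_subprob_algebra[of f borel]]
  have "(\<lambda>z. \<integral>w. f w \<partial>distr (Q (snd z)) borel (\<lambda>y. (S (fst z, y), case_nat y (snd z)))) \<in> borel_measurable borel"
    by simp
  then have "step f \<in> borel_measurable borel"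
    unfolding step_def[abs_def] by (simp add: integral_distr borel_measurable_Pair)
  moreover have "0 \<le> step f z \<and> step f z \<le> 1" for z
  proof -
    interpret prob_space "Q (snd z)" by (rule prob_space_Q)
    have "step f z \<le> (\<integral>y. 1 \<partial>Q (snd z))"
      unfolding step_def by (intro integral_mono step_integrable f) (use f in \<open>auto simp: unit_fun_def\<close>)
    moreover have "prob UNIV = 1" using prob_space by simp
    ultimately show ?thesis using f by (auto simp: step_def unit_fun_def)
  qed
  ultimately show ?thesis by (simp add: unit_fun_def)
qed

lemma unit_fun_steps: "unit_fun f \<Longrightarrow> unit_fun ((step ^^ k) f)"
  by (induction k) (auto intro: unit_fun_step)

lemma path_kernel_measurable [measurable]:
  "path_kernel Q k \<in> measurable borel (prob_algebra (Pi\<^sub>M {1..k} (\<lambda>_. borel)))"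
proof (induction k)
  case 0
  have "(\<lambda>_. undefined) \<in> space (Pi\<^sub>M {1..0::nat} (\<lambda>_. borel :: 'e measure))"
    by (simp add: space_PiM PiE_def extensional_def)
  then show ?case
    by (auto intro!: measurable_const simp: space_prob_algebra prob_space_return cong: measurable_cong)
next
  case (Suc k)
  have upd: "(\<lambda>x. (snd (fst x))(Suc k := snd x)) \<in> measurable
      ((borel \<Otimes>\<^sub>M Pi\<^sub>M {1..k} (\<lambda>_. borel)) \<Otimes>\<^sub>M borel) (Pi\<^sub>M {1..Suc k} (\<lambda>_. borel))"
    by (rule measurable_fun_upd[where J="{1..k}"]) auto
  show ?case unfolding path_kernel.simps
    by (rule measurable_bind_prob_space2[OF Suc])
      (auto simp: case_prod_beta' intro!: measurable_distr_prob_space2[where M=borel] upd[unfolded One_nat_def] Q_compose hist_append_measurable)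
qed

lemma prob_space_path: "prob_space (path_kernel Q k \<xi>)"
  and sets_path [measurable_cong, simp]: "sets (path_kernel Q k \<xi>) = sets (Pi\<^sub>M {1..k} (\<lambda>_. borel))"
  using measurable_space[OF path_kernel_measurable, of \<xi> k]
  by (auto simp: space_prob_algebra)

lemma traj_measurable:
  assumes "k \<le> n"
  shows "(\<lambda>y. traj S u y k) \<in> borel_measurable (Pi\<^sub>M {1..n} (\<lambda>_. borel))"
  using assms by (induction k) (auto intro!: S_measurable measurable_component_singleton)

lemma path_last_measurable:
  "(\<lambda>y. distr (Q (hist_append \<xi> k y)) (Pi\<^sub>M {1..Suc k} (\<lambda>_. borel)) (\<lambda>z. y(Suc k := z)))
    \<in> measurable (path_kernel Q k \<xi>) (prob_algebra (Pi\<^sub>M {1..Suc k} (\<lambda>_. borel)))"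
  and path_upd_measurable: "y \<in> space (path_kernel Q k \<xi>) \<Longrightarrow>
    (\<lambda>z. y(Suc k := z)) \<in> measurable borel (Pi\<^sub>M {1..Suc k} (\<lambda>_. borel))"
proof -
  have upd: "(\<lambda>x. (fst x)(Suc k := snd x)) \<in> measurable
      (Pi\<^sub>M {1..k} (\<lambda>_. borel) \<Otimes>\<^sub>M borel) (Pi\<^sub>M {1..Suc k} (\<lambda>_. borel :: 'e measure))"
    by (rule measurable_fun_upd[where J="{1..k}"]) auto
  then show "(\<lambda>y. distr (Q (hist_append \<xi> k y)) (Pi\<^sub>M {1..Suc k} (\<lambda>_. borel)) (\<lambda>z. y(Suc k := z)))
    \<in> measurable (path_kernel Q k \<xi>) (prob_algebra (Pi\<^sub>M {1..Suc k} (\<lambda>_. borel)))"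
    unfolding measurable_cong_sets[OF sets_path refl]
    by (auto simp: case_prod_beta' intro!: measurable_distr_prob_space2[where M=borel] Q_compose hist_append_measurable)
  assume "y \<in> space (path_kernel Q k \<xi>)"
  then have "y \<in> space (Pi\<^sub>M {1..k} (\<lambda>_. borel :: 'e measure))" using sets_eq_imp_space_eq[OF sets_path] by blast
  from measurable_compose[OF measurable_Pair1'[OF this] upd]
  show "(\<lambda>z. y(Suc k := z)) \<in> measurable borel (Pi\<^sub>M {1..Suc k} (\<lambda>_. borel))" by simp
qed

text \<open>The induction applies the innermost \<open>step\<close> to \<open>f\<close>, that is, it
  treats the last time step first. This matches the recursion of \<open>path_kernel\<close>, which
  appends the newest entry at the end.\<close>

lemma steps_path_kernel:
  assumes f: "unit_fun f"
  shows "(step ^^ k) f (u, \<xi>) = (\<integral>y. f (traj S u y k, hist_append \<xi> k y) \<partial>path_kernel Q k \<xi>)"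
  using f
proof (induction k arbitrary: f)
  case 0
  have "(\<lambda>_. undefined) \<in> space (Pi\<^sub>M {1..0::nat} (\<lambda>_. borel :: 'e measure))"
    by (simp add: space_PiM PiE_def extensional_def)
  then show ?case unfolding path_kernel.simps
    by (subst integral_return) (simp_all only: traj.simps hist_append_0 measurable_const funpow_0 space_borel UNIV_I)
next
  case (Suc k)
  have fM: "(\<lambda>y. f (traj S u y (Suc k), hist_append \<xi> (Suc k) y)) \<in> borel_measurable (Pi\<^sub>M {1..Suc k} (\<lambda>_. borel))"
    by (intro unit_fun_compose[OF Suc.prems] traj_measurable hist_append_measurable) auto
  have "(step ^^ Suc k) f (u, \<xi>) = (step ^^ k) (step f) (u, \<xi>)" by (simp add: funpow_swap1)
  also have "\<dots> = (\<integral>y. step f (traj S u y k, hist_append \<xi> k y) \<partial>path_kernel Q k \<xi>)"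
    by (rule Suc.IH[OF unit_fun_step[OF Suc.prems]])
  also have "\<dots> = (\<integral>y. (\<integral>y. f (traj S u y (Suc k), hist_append \<xi> (Suc k) y)
      \<partial>distr (Q (hist_append \<xi> k y)) (Pi\<^sub>M {1..Suc k} (\<lambda>_. borel)) (\<lambda>z. y(Suc k := z))) \<partial>path_kernel Q k \<xi>)"
  proof (rule Bochner_Integration.integral_cong[OF refl])
    fix y assume y: "y \<in> space (path_kernel Q k \<xi>)"
    have "traj S u (y(Suc k := z)) k = traj S u y k" for z by (rule traj_cong) auto
    then show "step f (traj S u y k, hist_append \<xi> k y) = (\<integral>y. f (traj S u y (Suc k), hist_append \<xi> (Suc k) y)
      \<partial>distr (Q (hist_append \<xi> k y)) (Pi\<^sub>M {1..Suc k} (\<lambda>_. borel)) (\<lambda>z. y(Suc k := z)))"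
      using path_upd_measurable[OF y] by (subst integral_distr[OF _ fM]) (simp_all add: step_def hist_append_Suc)
  qed
  also have "\<dots> = (\<integral>y. f (traj S u y (Suc k), hist_append \<xi> (Suc k) y) \<partial>path_kernel Q (Suc k) \<xi>)"
    unfolding path_kernel.simps
  proof (rule integral_bind[symmetric, OF fM _ measurable_prob_algebraD[OF path_last_measurable]])
    show "\<bar>f (traj S u y (Suc k), hist_append \<xi> (Suc k) y)\<bar> \<le> 1" for y
      using Suc.prems unfolding unit_fun_def by (metis abs_of_nonneg)
    show "finite_measure (path_kernel Q k \<xi>)" using prob_space_path by (rule prob_space.finite_measure)
    show "AE x in path_kernel Q k \<xi>. emeasure (distr (Q (hist_append \<xi> k x)) (Pi\<^sub>M {1..Suc k} (\<lambda>_. borel)) (\<lambda>z. x(Suc k := z)))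
         (space (distr (Q (hist_append \<xi> k x)) (Pi\<^sub>M {1..Suc k} (\<lambda>_. borel)) (\<lambda>z. x(Suc k := z)))) \<le> ennreal 1"
    proof (rule AE_I2)
      fix x assume x: "x \<in> space (path_kernel Q k \<xi>)"
      have "prob_space (distr (Q (hist_append \<xi> k x)) (Pi\<^sub>M {1..Suc k} (\<lambda>_. borel)) (\<lambda>z. x(Suc k := z)))"
        by (rule prob_space.prob_space_distr[OF prob_space_Q]) (use path_upd_measurable[OF x] in simp)
      from prob_space.emeasure_space_1[OF this]
      show "emeasure (distr (Q (hist_append \<xi> k x)) (Pi\<^sub>M {1..Suc k} (\<lambda>_. borel)) (\<lambda>z. x(Suc k := z)))
         (space (distr (Q (hist_append \<xi> k x)) (Pi\<^sub>M {1..Suc k} (\<lambda>_. borel)) (\<lambda>z. x(Suc k := z)))) \<le> ennreal 1" by simp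
    qed
  qed
  finally show ?case .
qed

text \<open>One-step invariance is applied at the extended history, so the statement about
  \<open>E\<close> has to travel along in the induction.\<close>

lemma AE_path_kernel:
  assumes E: "E \<in> sets borel" and K: "K \<in> sets borel"
    and inv: "\<And>\<xi>. \<xi> \<in> E \<Longrightarrow> AE y in Q \<xi>. y \<in> K \<and> case_nat y \<xi> \<in> E" and \<xi>: "\<xi> \<in> E"
  shows "AE y in path_kernel Q k \<xi>. hist_append \<xi> k y \<in> E \<and> (\<forall>j\<in>{1..k}. y j \<in> K)"
proof (induction k)
  case 0
  have "(\<lambda>_. undefined) \<in> space (Pi\<^sub>M {1..0::nat} (\<lambda>_. borel :: 'e measure))"
    by (simp add: space_PiM PiE_def extensional_def)
  then show ?case using \<xi> by (simp add: AE_return)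
next
  case (Suc k)
  note [measurable] = E K
  have P: "Measurable.pred (Pi\<^sub>M {1..Suc k} (\<lambda>_. borel)) (\<lambda>y. hist_append \<xi> (Suc k) y \<in> E \<and> (\<forall>j\<in>{1..Suc k}. y j \<in> K))"
  proof (intro pred_intros_logic pred_intros_finite)
    show "Measurable.pred (Pi\<^sub>M {1..Suc k} (\<lambda>_. borel)) (\<lambda>y. hist_append \<xi> (Suc k) y \<in> E)"
      by (rule pred_sets2[OF E]) (intro hist_append_measurable measurable_const, auto)
  qed (auto intro!: pred_sets2[OF K] measurable_component_singleton)
  show ?case unfolding path_kernel.simps AE_bind[OF measurable_prob_algebraD[OF path_last_measurable] P]
    using Suc.IH AE_space
  proof eventually_elim
    fix y assume y: "hist_append \<xi> k y \<in> E \<and> (\<forall>j\<in>{1..k}. y j \<in> K)" "y \<in> space (path_kernel Q k \<xi>)"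
    have *: "hist_append \<xi> (Suc k) (y(Suc k := z)) \<in> E \<and> (\<forall>j\<in>{1..Suc k}. (y(Suc k := z)) j \<in> K)"
      if "z \<in> K \<and> case_nat z (hist_append \<xi> k y) \<in> E" for z
      using y(1) that by (auto simp: hist_append_Suc)
    show "AE y in distr (Q (hist_append \<xi> k y)) (Pi\<^sub>M {1..Suc k} (\<lambda>_. borel)) (\<lambda>z. y(Suc k := z)).
          hist_append \<xi> (Suc k) y \<in> E \<and> (\<forall>j\<in>{1..Suc k}. y j \<in> K)"
    proof (subst AE_distr_iff)
      show "AE z in Q (hist_append \<xi> k y). hist_append \<xi> (Suc k) (y(Suc k := z)) \<in> E \<and> (\<forall>j\<in>{1..Suc k}. (y(Suc k := z)) j \<in> K)"
        using inv[OF conjunct1[OF y(1)]] by eventually_elim (rule *)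
    qed (use path_upd_measurable[OF y(2)] P in \<open>auto simp: pred_def\<close>)
  qed
qed

lemma measure_last_kernel:
  "measure (last_kernel Q s n \<xi>) (PiE {1..n} (\<lambda>_. ball 0 \<delta>))
    = measure (path_kernel Q (s + n) \<xi>) {y \<in> space (path_kernel Q (s + n) \<xi>). \<forall>i\<in>{1..n}. norm (y (s + i)) < \<delta>}"
proof -
  have "(\<lambda>y. \<lambda>i\<in>{1..n}. y (s + i)) \<in> measurable (path_kernel Q (s + n) \<xi>) (Pi\<^sub>M {1..n} (\<lambda>_. borel))"
    unfolding measurable_cong_sets[OF sets_path refl]
    by (rule measurable_restrict) (auto intro!: measurable_component_singleton)
  then show ?thesis unfolding last_kernel_def
    by (subst measure_distr) (auto simp: Pi_iff intro!: sets_PiM_I_finite arg_cong[where f="measure _"])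
qed

end

section \<open>From the stationary process to the chain\<close>

lemma past_measurable [measurable]:
  assumes "stationary_process M \<eta>"
  shows "(\<lambda>\<omega>. (\<lambda>i. \<eta> (k - int i) \<omega>) :: nat \<Rightarrow> 'e::second_countable_topology) \<in> borel_measurable M"
  by (rule measurable_coordinatewise_then_product) (use assms in \<open>auto simp: stationary_process_def\<close>)

text \<open>Stationarity is stated for the law of the whole two-sided path. A functional of the past
  and the next value is a function \<open>H\<close> of that path, so its expectation does not depend
  on the reference time.\<close>

lemma stationary_shift:
  fixes \<eta> :: "int \<Rightarrow> 'w \<Rightarrow> 'e::second_countable_topology" and G :: "(nat \<Rightarrow> 'e) \<times> 'e \<Rightarrow> real"
  assumes st: "stationary_process M \<eta>" and G: "G \<in> borel_measurable borel"
  shows "(\<integral>\<omega>. G ((\<lambda>i. \<eta> (k - int i) \<omega>), \<eta> (k + 1) \<omega>) \<partial>M) = (\<integral>\<omega>. G (past \<eta> \<omega>, \<eta> 1 \<omega>) \<partial>M)"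
proof -
  let ?P = "Pi\<^sub>M UNIV (\<lambda>_::int. borel :: 'e measure)"
  define H where "H x = G ((\<lambda>i. x (- int i)), x 1)" for x :: "int \<Rightarrow> 'e"
  have H: "H \<in> borel_measurable ?P"
    unfolding H_def
    by (intro measurable_compose[OF borel_measurable_Pair G] measurable_coordinatewise_then_product measurable_component_singleton) auto
  have m: "(\<lambda>\<omega> j. \<eta> (j + h) \<omega>) \<in> measurable M ?P" for h
    using st by (intro measurable_PiM_single') (auto simp: stationary_process_def)
  have "(\<integral>\<omega>. H (\<lambda>j. \<eta> (j + k) \<omega>) \<partial>M) = (\<integral>x. H x \<partial>distr M ?P (\<lambda>\<omega> j. \<eta> (j + k) \<omega>))"
    by (rule integral_distr[symmetric, OF m H])
  also have "\<dots> = (\<integral>x. H x \<partial>distr M ?P (\<lambda>\<omega> j. \<eta> j \<omega>))"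
    using st by (simp add: stationary_process_def)
  also have "\<dots> = (\<integral>\<omega>. H (\<lambda>j. \<eta> j \<omega>) \<partial>M)"
    using m[of 0] by (intro integral_distr H) simp
  finally show ?thesis by (simp add: H_def past_def[abs_def] add.commute)
qed

context driven_chain
begin

text \<open>\<open>conditional_law\<close> fixes the joint law on rectangles only. These form an
  intersection-stable generator, so the law of the pair (past, next value) is the past law composed
  with \<open>Q\<close>.\<close>

lemma integral_conditional_law:
  fixes G :: "(nat \<Rightarrow> 'e) \<times> 'e \<Rightarrow> real"
  assumes M: "prob_space M" "stationary_process M \<eta>" "conditional_law M \<eta> Q"
    and G: "G \<in> borel_measurable borel" "\<And>p. \<bar>G p\<bar> \<le> 1"
  shows "(\<integral>\<omega>. G (past \<eta> \<omega>, \<eta> 1 \<omega>) \<partial>M) = (\<integral>\<xi>. (\<integral>y. G (\<xi>, y) \<partial>Q \<xi>) \<partial>past_law M \<eta>)"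
proof -
  interpret prob_space M by fact
  have [measurable]: "past \<eta> \<in> borel_measurable M" "\<eta> 1 \<in> borel_measurable M"
    using past_measurable[OF M(2), of 0] M(2) by (auto simp: past_def[abs_def] stationary_process_def)
  have ps: "prob_space (past_law M \<eta>)" unfolding past_law_def by (rule prob_space_distr) simp
  have sl [measurable_cong, simp]: "sets (past_law M \<eta>) = sets borel" by (simp add: past_law_def)
  have spl [simp]: "space (past_law M \<eta>) = UNIV" by (simp add: past_law_def)
  let ?N = "borel :: ((nat \<Rightarrow> 'e) \<times> 'e) measure"
  define N1 where "N1 = distr M ?N (\<lambda>\<omega>. (past \<eta> \<omega>, \<eta> 1 \<omega>))"
  define N2 where "N2 = past_law M \<eta> \<bind> (\<lambda>\<xi>. distr (Q \<xi>) ?N (Pair \<xi>))"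
  have kern: "(\<lambda>\<xi>. distr (Q \<xi>) ?N (Pair \<xi>)) \<in> measurable (past_law M \<eta>) (prob_algebra ?N)"
    unfolding measurable_cong_sets[OF sl refl]
    by (rule measurable_distr_prob_space2[where M=borel]) (auto simp: borel_prod)
  note kern' = measurable_prob_algebraD[OF kern]
  have sN2: "sets N2 = sets borel" unfolding N2_def by (rule sets_bind) auto
  have "N1 = N2"
  proof (rule measure_eqI_generator_eq[where \<Omega>=UNIV and E="{A \<times> B | A B. A \<in> sets borel \<and> B \<in> sets borel}" and A="\<lambda>_. UNIV"])
    show "Int_stable {A \<times> B | A B. A \<in> sets (borel :: (nat \<Rightarrow> 'e) measure) \<and> B \<in> sets (borel :: 'e measure)}"
      using Int_stable_pair_measure_generator[of "borel :: (nat \<Rightarrow> 'e) measure" "borel :: 'e measure"] by simp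
    have "sets ?N = sets (borel \<Otimes>\<^sub>M borel)" by (simp only: borel_prod)
    also have "\<dots> = sigma_sets UNIV {A \<times> B | A B. A \<in> sets borel \<and> B \<in> sets borel}"
      by (simp add: sets_pair_measure)
    finally have sN: "sets ?N = sigma_sets UNIV {A \<times> B | A B. A \<in> sets borel \<and> B \<in> sets borel}" .
    show "sets N1 = sigma_sets UNIV {A \<times> B | A B. A \<in> sets borel \<and> B \<in> sets borel}" by (simp add: N1_def sN)
    show "sets N2 = sigma_sets UNIV {A \<times> B | A B. A \<in> sets borel \<and> B \<in> sets borel}" by (simp add: sN2 sN)
    show "range (\<lambda>_. UNIV) \<subseteq> {A \<times> B | A B. A \<in> sets (borel :: (nat \<Rightarrow> 'e) measure) \<and> B \<in> sets (borel :: 'e measure)}"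
      by (intro image_subsetI CollectI exI[of _ UNIV]) simp
    have "prob_space N1" unfolding N1_def by (rule prob_space_distr) (simp add: borel_measurable_Pair)
    then show "emeasure N1 UNIV \<noteq> \<infinity>" for i :: nat
      using prob_space.emeasure_space_1[of N1] by (simp add: N1_def)
    fix Z assume "Z \<in> {A \<times> B | A B. A \<in> sets (borel :: (nat \<Rightarrow> 'e) measure) \<and> B \<in> sets (borel :: 'e measure)}"
    then obtain A B where Z: "Z = A \<times> B" and AB [measurable]: "A \<in> sets borel" "B \<in> sets borel" by auto
    have ZM [measurable]: "Z \<in> sets ?N" unfolding Z borel_prod[symmetric] by simp
    have "emeasure N1 Z = emeasure M {\<omega> \<in> space M. past \<eta> \<omega> \<in> A \<and> \<eta> 1 \<omega> \<in> B}"
      unfolding N1_def by (subst emeasure_distr) (auto simp: Z borel_measurable_Pair AB intro!: arg_cong[where f="emeasure M"] ZM[unfolded Z])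
    also have "\<dots> = (\<integral>\<^sup>+\<xi>. emeasure (Q \<xi>) B * indicator A \<xi> \<partial>past_law M \<eta>)"
      using M(3) AB by (simp add: conditional_law_def)
    also have "\<dots> = (\<integral>\<^sup>+\<xi>. emeasure (distr (Q \<xi>) ?N (Pair \<xi>)) Z \<partial>past_law M \<eta>)"
    proof (rule nn_integral_cong)
      fix \<xi>
      have "Pair \<xi> -` Z = (if \<xi> \<in> A then B else {})" by (auto simp: Z)
      then show "emeasure (Q \<xi>) B * indicator A \<xi> = emeasure (distr (Q \<xi>) ?N (Pair \<xi>)) Z"
        by (subst emeasure_distr) (auto simp: borel_measurable_Pair ZM)
    qed
    also have "\<dots> = emeasure N2 Z"
      unfolding N2_def by (rule emeasure_bind[symmetric, OF _ kern' ZM]) simp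
    finally show "emeasure N1 Z = emeasure N2 Z" .
  qed auto
  have "(\<integral>\<omega>. G (past \<eta> \<omega>, \<eta> 1 \<omega>) \<partial>M) = (\<integral>p. G p \<partial>N1)"
    unfolding N1_def by (rule integral_distr[symmetric]) (auto simp: borel_measurable_Pair G)
  also have "\<dots> = (\<integral>\<xi>. (\<integral>p. G p \<partial>distr (Q \<xi>) ?N (Pair \<xi>)) \<partial>past_law M \<eta>)"
    unfolding \<open>N1 = N2\<close> N2_def
  proof (rule integral_bind[OF G(1) _ kern'])
    show "finite_measure (past_law M \<eta>)" using ps by (rule prob_space.finite_measure)
    have "prob_space (distr (Q \<xi>) ?N (Pair \<xi>))" for \<xi>
      by (rule prob_space.prob_space_distr[OF prob_space_Q]) (simp add: borel_measurable_Pair)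
    note em = prob_space.emeasure_space_1[OF this]
    show "AE \<xi> in past_law M \<eta>. emeasure (distr (Q \<xi>) ?N (Pair \<xi>)) (space (distr (Q \<xi>) ?N (Pair \<xi>))) \<le> ennreal 1"
      unfolding em by simp
  qed (rule G(2))
  also have "\<dots> = (\<integral>\<xi>. (\<integral>y. G (\<xi>, y) \<partial>Q \<xi>) \<partial>past_law M \<eta>)"
    by (intro Bochner_Integration.integral_cong refl integral_distr) (auto simp: borel_measurable_Pair G)
  finally show ?thesis .
qed

text \<open>The link between the process and the operator: the state starts at a fixed u, while the
  history is drawn from its stationary law. Given the noise up to time k, the next value has law
  \<open>Q\<close> of that history by stationarity, and the state at time k is a function of the
  history.\<close>

lemma expectation_traj:
  assumes M: "prob_space M" "stationary_process M \<eta>" "conditional_law M \<eta> Q" and f: "unit_fun f"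
  shows "(\<integral>\<omega>. f (traj S u (\<lambda>j. \<eta> (int j) \<omega>) k, (\<lambda>i. \<eta> (int k - int i) \<omega>)) \<partial>M)
    = (\<integral>\<xi>. (step ^^ k) f (u, \<xi>) \<partial>past_law M \<eta>)"
  using f
proof (induction k arbitrary: f)
  case 0
  have "past \<eta> \<in> borel_measurable M" using past_measurable[OF M(2), of 0] by (simp add: past_def[abs_def])
  then have "(\<integral>\<xi>. f (u, \<xi>) \<partial>past_law M \<eta>) = (\<integral>\<omega>. f (u, past \<eta> \<omega>) \<partial>M)"
    unfolding past_law_def by (rule integral_distr) (rule unit_fun_compose[OF 0], auto)
  then show ?case by (simp add: past_def[abs_def])
next
  case (Suc k)
  \<comment> \<open>In the history that ends at time k, the noise of time j sits at index k - j.
    Only times 1 to k are read, so truncated subtraction does no harm.\<close>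
  define U where "U \<xi> = traj S u (\<lambda>j. \<xi> (k - j)) k" for \<xi>
  have UM: "U \<in> borel_measurable borel"
  proof -
    have "(\<lambda>\<xi>. traj S u (\<lambda>j. \<xi> (k - j)) m) \<in> borel_measurable borel" for m
      by (induction m) (auto intro!: S_measurable)
    then show ?thesis unfolding U_def[abs_def] .
  qed
  define pa where "pa \<omega> = (\<lambda>i. \<eta> (int k - int i) \<omega>)" for \<omega>
  have Upa: "U (pa \<omega>) = traj S u (\<lambda>j. \<eta> (int j) \<omega>) k" for \<omega>
    unfolding U_def pa_def by (rule traj_cong) (simp add: of_nat_diff)
  have cons: "(\<lambda>i. \<eta> (int (Suc k) - int i) \<omega>) = case_nat (\<eta> (int k + 1) \<omega>) (pa \<omega>)" for \<omega>
    by (auto simp: fun_eq_iff pa_def add.commute split: nat.split)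
  define G where "G p = f (S (U (fst p), snd p), case_nat (snd p) (fst p))" for p
  have G: "G \<in> borel_measurable borel" "\<And>p. \<bar>G p\<bar> \<le> 1"
    unfolding G_def borel_prod[symmetric]
    using Suc.prems by (auto simp: unit_fun_def intro!: unit_fun_compose[OF Suc.prems] S_measurable case_nat_measurable
        measurable_compose[OF measurable_fst UM])
  define g where "g \<xi> = step f (U \<xi>, \<xi>)" for \<xi>
  have gM: "g \<in> borel_measurable borel" unfolding g_def[abs_def]
    by (rule unit_fun_compose[OF unit_fun_step[OF Suc.prems] UM]) simp
  have past: "past \<eta> \<in> borel_measurable M" using past_measurable[OF M(2), of 0] by (simp add: past_def[abs_def])
  have "(\<integral>\<omega>. f (traj S u (\<lambda>j. \<eta> (int j) \<omega>) (Suc k), (\<lambda>i. \<eta> (int (Suc k) - int i) \<omega>)) \<partial>M)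
    = (\<integral>\<omega>. G (pa \<omega>, \<eta> (int k + 1) \<omega>) \<partial>M)"
    unfolding cons by (simp add: G_def Upa add.commute)
  also have "\<dots> = (\<integral>\<omega>. G (past \<eta> \<omega>, \<eta> 1 \<omega>) \<partial>M)"
    unfolding pa_def by (rule stationary_shift[OF M(2) G(1)])
  also have "\<dots> = (\<integral>\<xi>. g \<xi> \<partial>past_law M \<eta>)"
    unfolding integral_conditional_law[OF M G] by (simp add: G_def g_def step_def)
  also have "\<dots> = (\<integral>\<omega>. g (past \<eta> \<omega>) \<partial>M)"
    unfolding past_law_def by (rule integral_distr[OF past gM])
  \<comment> \<open>Stationarity for the second time: the expectation was moved to time 0 to use the
    conditional law and now returns to time k for the induction hypothesis.\<close>
  also have "\<dots> = (\<integral>\<omega>. g (pa \<omega>) \<partial>M)"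
    using stationary_shift[OF M(2), of "\<lambda>p. g (fst p)" "int k"] gM
    by (simp add: pa_def borel_prod[symmetric])
  also have "\<dots> = (\<integral>\<omega>. step f (traj S u (\<lambda>j. \<eta> (int j) \<omega>) k, (\<lambda>i. \<eta> (int k - int i) \<omega>)) \<partial>M)"
    by (simp add: g_def Upa) (simp add: pa_def)
  also have "\<dots> = (\<integral>\<xi>. (step ^^ k) (step f) (u, \<xi>) \<partial>past_law M \<eta>)"
    by (rule Suc.IH[OF unit_fun_step[OF Suc.prems]])
  finally show ?case by (simp add: funpow_swap1)
qed

end

section \<open>Supports, the distance of histories, and variation\<close>

text \<open>The complement is the union of all null open sets. By the Lindelof property countably
  many of them suffice, so it is null.\<close>

lemma msupport_complement_null:
  fixes \<mu> :: "'a::second_countable_topology measure"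
  assumes "sets \<mu> = sets borel"
  shows "closed (msupport \<mu>)" "emeasure \<mu> (- msupport \<mu>) = 0" "AE x in \<mu>. x \<in> msupport \<mu>"
proof -
  define \<O> where "\<O> = {U. open U \<and> emeasure \<mu> U = 0}"
  have eq: "- msupport \<mu> = \<Union>\<O>"
    by (auto simp: msupport_def \<O>_def zero_less_iff_neq_zero)
  have "open (\<Union>\<O>)" by (rule open_Union) (auto simp: \<O>_def)
  then show "closed (msupport \<mu>)" by (simp add: closed_def eq)
  obtain \<F> where \<F>: "\<F> \<subseteq> \<O>" "countable \<F>" "\<Union>\<F> = \<Union>\<O>"
    by (rule Lindelof[of \<O>]) (auto simp: \<O>_def)
  have "\<Union>\<F> \<in> null_sets \<mu>"
    using \<F>(1,2) assms by (intro null_sets_UN'[of \<F> "\<lambda>x. x", simplified]) (auto simp: \<O>_def null_sets_def)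
  then have N: "- msupport \<mu> \<in> null_sets \<mu>" by (simp add: eq \<F>(3))
  then show "emeasure \<mu> (- msupport \<mu>) = 0" by auto
  show "AE x in \<mu>. x \<in> msupport \<mu>" by (rule AE_I'[OF N]) auto
qed

context
  fixes \<iota> R :: real
  assumes \<iota>: "1 < \<iota>"
begin

lemma hist_dist_summable:
  assumes "\<And>i. norm (\<xi> i) \<le> R" "\<And>i. norm (\<xi>' i) \<le> R"
  shows "summable (\<lambda>i. norm (\<xi> i - \<xi>' i) / \<iota> ^ i)"
proof (rule summable_comparison_test'[of "\<lambda>i. 2 * R * (1 / \<iota>) ^ i" 0])
  show "summable (\<lambda>i. 2 * R * (1 / \<iota>) ^ i)"
    by (intro summable_mult summable_geometric) (use \<iota> in auto)
  fix i
  have "norm (\<xi> i - \<xi>' i) \<le> 2 * R" using norm_triangle_ineq4[of "\<xi> i" "\<xi>' i"] assms(1)[of i] assms(2)[of i] by linarith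
  then show "norm (norm (\<xi> i - \<xi>' i) / \<iota> ^ i) \<le> 2 * R * (1 / \<iota>) ^ i"
    using \<iota> by (simp add: power_one_over divide_right_mono)
qed

lemma hist_dist_nonneg:
  assumes "\<And>i. norm (\<xi> i) \<le> R" "\<And>i. norm (\<xi>' i) \<le> R"
  shows "0 \<le> hist_dist \<iota> \<xi> \<xi>'"
  unfolding hist_dist_def by (rule suminf_nonneg[OF hist_dist_summable[OF assms]]) (use \<iota> in auto)

lemma hist_dist_case_nat:
  assumes "\<And>i. norm (\<xi> i) \<le> R" "\<And>i. norm (\<xi>' i) \<le> R" "norm y \<le> R" "norm y' \<le> R"
  shows "hist_dist \<iota> (case_nat y \<xi>) (case_nat y' \<xi>') = norm (y - y') + hist_dist \<iota> \<xi> \<xi>' / \<iota>"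
proof -
  define f where "f i = norm ((case_nat y \<xi> i) - (case_nat y' \<xi>' i)) / \<iota> ^ i" for i
  have "summable f" unfolding f_def
    by (rule hist_dist_summable) (use assms in \<open>auto split: nat.split\<close>)
  have "(\<Sum>i. f (Suc i)) = (\<Sum>i. norm (\<xi> i - \<xi>' i) / \<iota> ^ i / \<iota>)"
    by (simp add: f_def mult.commute)
  also have "\<dots> = hist_dist \<iota> \<xi> \<xi>' / \<iota>"
    unfolding hist_dist_def by (rule suminf_divide[OF hist_dist_summable[OF assms(1,2)]])
  finally have "suminf f - f 0 = hist_dist \<iota> \<xi> \<xi>' / \<iota>" using suminf_split_head[OF \<open>summable f\<close>] by simp
  moreover have "hist_dist \<iota> (case_nat y \<xi>) (case_nat y' \<xi>') = suminf f" by (simp add: hist_dist_def f_def[abs_def])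
  moreover have "f 0 = norm (y - y')" by (simp add: f_def)
  ultimately show ?thesis by simp
qed

text \<open>Compares the distance with cylinder neighbourhoods of the product topology. Beyond n the
  common bound \<open>R\<close> gives a geometric tail below e / 2, and the first n entries
  contribute at most \<delta> / (1 - 1 / \<iota>) = e / 2.\<close>

lemma hist_dist_small:
  assumes "0 < e"
  shows "\<exists>n \<delta>. 0 < \<delta> \<and> (\<forall>\<xi> \<xi>'. (\<forall>i. norm (\<xi> i) \<le> R) \<longrightarrow> (\<forall>i. norm (\<xi>' i) \<le> R) \<longrightarrow>
    (\<forall>i<n. norm (\<xi> i - \<xi>' i :: 'e::real_normed_vector) < \<delta>) \<longrightarrow> hist_dist \<iota> \<xi> \<xi>' < e)"
proof -
  define q where "q = 1 / \<iota>"
  have q: "0 < q" "q < 1" using \<iota> by (auto simp: q_def)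
  define T where "T = 2 * \<bar>R\<bar> / (1 - q)"
  have "(\<lambda>n. T * q ^ n) \<longlonglongrightarrow> T * 0" by (intro tendsto_mult_left LIMSEQ_power_zero) (use q in auto)
  then have "\<forall>\<^sub>F n in sequentially. T * q ^ n < e / 2" by (rule order_tendstoD) (use assms in simp)
  then obtain n where n: "T * q ^ n < e / 2" by (auto simp: eventually_sequentially)
  define \<delta> where "\<delta> = e / 2 * (1 - q)"
  have \<delta>: "0 < \<delta>" using assms q by (simp add: \<delta>_def)
  have sg: "summable (\<lambda>i. q ^ i)" by (rule summable_geometric) (use q in auto)
  have sumq: "(\<Sum>i. q ^ i) = 1 / (1 - q)" by (rule suminf_geometric) (use q in auto)
  have "hist_dist \<iota> \<xi> \<xi>' < e" if b: "\<forall>i. norm (\<xi> i) \<le> R" "\<forall>i. norm (\<xi>' i) \<le> R"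
    and c: "\<forall>i<n. norm (\<xi> i - \<xi>' i) < \<delta>" for \<xi> \<xi>' :: "nat \<Rightarrow> 'e"
  proof -
    define f where "f i = norm (\<xi> i - \<xi>' i) * q ^ i" for i
    have feq: "f = (\<lambda>i. norm (\<xi> i - \<xi>' i) / \<iota> ^ i)" by (simp add: f_def q_def power_one_over fun_eq_iff)
    have sf: "summable f" unfolding feq by (rule hist_dist_summable) (use b in auto)
    have "(\<Sum>i. f (i + n)) \<le> (\<Sum>i. 2 * \<bar>R\<bar> * q ^ n * q ^ i)"
    proof (rule suminf_le[OF _ summable_ignore_initial_segment[OF sf] summable_mult[OF sg]])
      fix i
      have "norm (\<xi> (i + n) - \<xi>' (i + n)) \<le> 2 * \<bar>R\<bar>"
        using norm_triangle_ineq4[of "\<xi> (i + n)" "\<xi>' (i + n)"] b(1)[rule_format, of "i + n"] b(2)[rule_format, of "i + n"] by linarith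
      then have "f (i + n) \<le> 2 * \<bar>R\<bar> * q ^ (i + n)" unfolding f_def using q by (intro mult_right_mono) auto
      then show "f (i + n) \<le> 2 * \<bar>R\<bar> * q ^ n * q ^ i" by (simp add: power_add mult_ac)
    qed
    also have "\<dots> = T * q ^ n" using suminf_mult[OF sg, of "2 * \<bar>R\<bar> * q ^ n"] by (simp add: sumq T_def)
    also have "\<dots> < e / 2" by (rule n)
    finally have t: "(\<Sum>i. f (i + n)) < e / 2" .
    have "(\<Sum>i<n. f i) \<le> (\<Sum>i<n. \<delta> * q ^ i)"
      unfolding f_def by (intro sum_mono mult_right_mono) (use c q in \<open>auto intro: less_imp_le\<close>)
    also have "\<dots> \<le> \<delta> * (\<Sum>i. q ^ i)"
      unfolding sum_distrib_left[symmetric] using \<delta> q by (intro mult_left_mono sum_le_suminf sg) auto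
    also have "\<dots> = e / 2" using q by (simp add: sumq \<delta>_def divide_simps)
    finally show ?thesis using t suminf_split_initial_segment[OF sf, of n] by (simp add: hist_dist_def feq[symmetric])
  qed
  then show ?thesis using \<delta> by blast
qed

end

text \<open>The sum counts the levels i / N below t and so equals the integer part of N t. It
  discretises a [0, 1]-valued function into N level sets.\<close>

lemma floor_sum_indicator:
  fixes t :: real
  assumes t: "0 \<le> t" "t \<le> 1" and N: "0 < N"
  shows "(\<Sum>i=1..N. if real i \<le> real N * t then 1 else 0) \<le> real N * t"
    "real N * t \<le> (\<Sum>i=1..N. if real i \<le> real N * t then 1 else 0) + 1"
proof -
  define m where "m = nat \<lfloor>real N * t\<rfloor>"
  have m: "real m \<le> real N * t" "real N * t < real m + 1" using t by (auto simp: m_def)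
  have "real m \<le> real N * 1" by (rule order_trans[OF m(1)]) (use t in \<open>intro mult_left_mono\<close>, auto)
  then have "{i \<in> {1..N}. real i \<le> real N * t} = {1..m}" using m by force
  then have "(\<Sum>i=1..N. if real i \<le> real N * t then 1 else 0) = real m"
    by (simp add: sum.If_cases Int_def)
  then show "(\<Sum>i=1..N. if real i \<le> real N * t then 1 else 0) \<le> real N * t"
    "real N * t \<le> (\<Sum>i=1..N. if real i \<le> real N * t then 1 else 0) + 1" using m by auto
qed

lemma measure_le_var_dist:
  fixes \<mu> \<nu> :: "'a::topological_space measure"
  assumes "prob_space \<mu>" "prob_space \<nu>" "A \<in> sets borel"
  shows "measure \<mu> A \<le> measure \<nu> A + var_dist \<mu> \<nu>"
proof -
  have "\<bar>measure \<mu> \<Gamma> - measure \<nu> \<Gamma>\<bar> \<le> 1" for \<Gamma>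
    using prob_space.prob_le_1[OF assms(1), of \<Gamma>] prob_space.prob_le_1[OF assms(2), of \<Gamma>]
      measure_nonneg[of \<mu> \<Gamma>] measure_nonneg[of \<nu> \<Gamma>] by linarith
  then have "\<bar>measure \<mu> A - measure \<nu> A\<bar> \<le> var_dist \<mu> \<nu>"
    unfolding var_dist_def by (intro cSUP_upper assms(3) bdd_aboveI[of _ 1]) auto
  then show ?thesis by linarith
qed

text \<open>\<open>var_dist\<close> is a supremum over sets. Averaging the indicators of N level
  sets approximates \<open>g\<close> within 1 / N, and each level set contributes at most
  \<open>var_dist\<close> divided by N; hence the constant is 1.\<close>

lemma integral_le_var_dist:
  fixes \<mu> \<nu> :: "'a::topological_space measure"
  assumes \<mu>: "prob_space \<mu>" "sets \<mu> = sets borel" and \<nu>: "prob_space \<nu>" "sets \<nu> = sets borel"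
    and g: "g \<in> borel_measurable borel" "\<And>x. 0 \<le> g x" "\<And>x. g x \<le> 1"
  shows "(\<integral>x. g x \<partial>\<mu>) \<le> (\<integral>x. g x \<partial>\<nu>) + var_dist \<mu> \<nu>"
proof (rule field_le_epsilon)
  fix e :: real assume "0 < e"
  then obtain N where N: "0 < N" "1 / real N < e" using nat_approx_posE by (metis zero_less_Suc)
  note [measurable] = g(1)
  note [measurable_cong] = \<mu>(2) \<nu>(2)
  have spc: "space \<mu> = UNIV" "space \<nu> = UNIV"
    using sets_eq_imp_space_eq[OF \<mu>(2)] sets_eq_imp_space_eq[OF \<nu>(2)] by auto
  interpret \<mu>: prob_space \<mu> by fact
  interpret \<nu>: prob_space \<nu> by fact
  define A where "A i = {x. real i \<le> real N * g x}" for i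
  have A[measurable]: "A i \<in> sets borel" for i unfolding A_def by measurable
  define s where "s x = (\<Sum>i=1..N. indicator (A i) x) / real N" for x
  have s: "s x = (\<Sum>i=1..N. if real i \<le> real N * g x then 1 else 0) / real N" for x
    unfolding s_def by (intro arg_cong2[where f="(/)"] sum.cong) (auto simp: A_def indicator_def)
  have s1: "s x \<le> g x" "g x \<le> s x + 1 / real N" for x
    using floor_sum_indicator[OF g(2,3) N(1), of x] N(1) unfolding s by (auto simp: field_simps)
  have gi: "integrable M g" if "prob_space M" "sets M = sets borel" for M
  proof -
    interpret prob_space M by fact
    show ?thesis by (rule integrable_const_bound[of _ 1]) (use g that in \<open>auto cong: measurable_cong_sets\<close>)
  qed
  have s_int: "integrable M s" "(\<integral>x. s x \<partial>M) = (\<Sum>i=1..N. measure M (A i)) / real N"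
    if M: "prob_space M" "sets M = sets borel" for M
  proof -
    interpret prob_space M by fact
    have "space M = UNIV" using sets_eq_imp_space_eq[OF M(2)] by simp
    have i: "integrable M (indicator (A i) :: _ \<Rightarrow> real)" for i
      by (rule integrable_real_indicator) (use M(2) A in \<open>auto simp: emeasure_eq_measure\<close>)
    show "integrable M s" unfolding s_def by (intro integrable_divide Bochner_Integration.integrable_sum i)
    show "(\<integral>x. s x \<partial>M) = (\<Sum>i=1..N. measure M (A i)) / real N"
      unfolding s_def using i M(2) A \<open>space M = UNIV\<close> by (simp add: Bochner_Integration.integral_sum)
  qed
  have "(\<integral>x. g x \<partial>\<mu>) \<le> (\<integral>x. s x + 1 / real N \<partial>\<mu>)"
    by (intro integral_mono gi \<mu> Bochner_Integration.integrable_add s_int s1) simp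
  also have "\<dots> = (\<Sum>i=1..N. measure \<mu> (A i)) / real N + 1 / real N"
    using s_int[OF \<mu>] \<mu>.prob_space by (subst Bochner_Integration.integral_add) auto
  also have "(\<Sum>i=1..N. measure \<mu> (A i)) / real N \<le> (\<Sum>i=1..N. measure \<nu> (A i) + var_dist \<mu> \<nu>) / real N"
    by (intro divide_right_mono sum_mono measure_le_var_dist \<mu> \<nu> A) auto
  also have "\<dots> = (\<Sum>i=1..N. measure \<nu> (A i)) / real N + var_dist \<mu> \<nu>"
    using N(1) by (simp add: sum.distrib add_divide_distrib)
  also have "(\<Sum>i=1..N. measure \<nu> (A i)) / real N = (\<integral>x. s x \<partial>\<nu>)" using s_int[OF \<nu>] by simp
  also have "\<dots> \<le> (\<integral>x. g x \<partial>\<nu>)" by (intro integral_mono gi \<nu> s_int s1)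
  finally show "(\<integral>x. g x \<partial>\<mu>) \<le> (\<integral>x. g x \<partial>\<nu>) + var_dist \<mu> \<nu> + e" using N(2) by linarith
qed

lemma AE_noise_in_support:
  fixes \<eta> :: "int \<Rightarrow> 'w \<Rightarrow> 'e::second_countable_topology"
  assumes M: "prob_space M" and st: "stationary_process M \<eta>"
  shows "AE \<omega> in M. \<eta> k \<omega> \<in> msupport (distr M borel (\<eta> 0))"
proof -
  interpret prob_space M by fact
  define K where "K = msupport (distr M borel (\<eta> 0))"
  have K: "closed K" "emeasure (distr M borel (\<eta> 0)) (- K) = 0"
    unfolding K_def using msupport_complement_null[of "distr M borel (\<eta> 0)"] by simp_all
  have [measurable]: "\<eta> k \<in> borel_measurable M" for k using st by (simp add: stationary_process_def)
  have Kb [measurable]: "- K \<in> sets borel" using K(1) by auto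
  define I where "I k = (\<integral>\<omega>. indicator (- K) (\<eta> k \<omega>) \<partial>M :: real)" for k
  have G: "(\<lambda>p. indicator (- K) (snd p) :: real) \<in> borel_measurable (borel :: ((nat \<Rightarrow> 'e) \<times> 'e) measure)"
    unfolding borel_prod[symmetric] by measurable
  have shift: "I (k + 1) = I 1" for k
    using stationary_shift[OF st G, of k] by (simp add: I_def)
  have I: "I k = measure M {\<omega> \<in> space M. \<eta> k \<omega> \<in> - K}" for k
  proof -
    have "I k = (\<integral>\<omega>. indicator {\<omega> \<in> space M. \<eta> k \<omega> \<in> - K} \<omega> \<partial>M)"
      unfolding I_def by (intro Bochner_Integration.integral_cong) (auto simp: indicator_def)
    moreover have "{\<omega> \<in> space M. \<eta> k \<omega> \<in> - K} \<inter> space M = {\<omega> \<in> space M. \<eta> k \<omega> \<in> - K}" by auto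
    ultimately show ?thesis by (simp only: Bochner_Integration.integral_indicator)
  qed
  have "I 0 = 0" using K(2) Kb unfolding I
    by (subst (asm) emeasure_distr) (auto simp: measure_def vimage_def Int_def conj_commute)
  \<comment> \<open>The shift relates every time to time 1; at k = -1 it relates time 0, where the
    null set is known, to time 1.\<close>
  then have "I k = 0" for k using shift[of "-1"] shift[of "k - 1"] by simp
  then have "prob {\<omega> \<in> space M. \<eta> k \<omega> \<in> - K} = 0" using I by metis
  moreover have "{\<omega> \<in> space M. \<eta> k \<omega> \<in> - K} \<in> events" by measurable
  ultimately have "AE \<omega> in M. \<omega> \<notin> {\<omega> \<in> space M. \<eta> k \<omega> \<in> - K}" by (simp only: prob_eq_0)
  then show ?thesis using AE_space by eventually_elim (simp add: K_def)
qed

lemma past_supp_in_support: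
  fixes \<eta> :: "int \<Rightarrow> 'w \<Rightarrow> 'e::second_countable_topology"
  assumes M: "prob_space M" and st: "stationary_process M \<eta>" and \<xi>: "\<xi> \<in> past_supp M \<eta>"
  shows "\<xi> i \<in> msupport (distr M borel (\<eta> 0))"
proof (rule ccontr)
  let ?K = "msupport (distr M borel (\<eta> 0))"
  assume "\<xi> i \<notin> ?K"
  have K: "closed ?K" using msupport_complement_null[of "distr M borel (\<eta> 0)"] by simp
  have "open ((\<lambda>\<zeta>::nat \<Rightarrow> 'e. \<zeta> i) -` (- ?K))"
    using K by (intro open_vimage continuous_on_product_coordinates) auto
  then have "0 < emeasure (past_law M \<eta>) ((\<lambda>\<zeta>. \<zeta> i) -` (- ?K))"
    using \<xi> \<open>\<xi> i \<notin> ?K\<close> by (simp add: past_supp_def msupport_def)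
  also have "emeasure (past_law M \<eta>) ((\<lambda>\<zeta>. \<zeta> i) -` (- ?K)) = emeasure M {\<omega> \<in> space M. \<eta> (- int i) \<omega> \<notin> ?K}"
  proof -
    have "past \<eta> \<in> borel_measurable M" using past_measurable[OF st, of 0] by (simp add: past_def[abs_def])
    then show ?thesis unfolding past_law_def using \<open>open _\<close>
      by (subst emeasure_distr) (auto simp: past_def intro!: arg_cong[where f="emeasure M"])
  qed
  also have "\<dots> = 0"
  proof -
    have [measurable]: "\<eta> (- int i) \<in> borel_measurable M" using st by (simp add: stationary_process_def)
    have [measurable]: "?K \<in> sets borel" using K by auto
    have "{\<omega> \<in> space M. \<not> \<eta> (- int i) \<omega> \<in> ?K} \<in> sets M" by measurable
    then show ?thesis using AE_noise_in_support[OF M st, of "- int i"] by (subst (asm) AE_iff_measurable) auto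
  qed
  finally show False by simp
qed

text \<open>The assertion is for every \<xi> in the support, while the conditional law is determined
  only almost surely. If some y in the support of \<open>Q \<xi>\<close> led out of the support of
  the past, a product neighbourhood U x V of (\<xi>, y) would carry no joint mass, so
  \<open>Q \<zeta>\<close> would give V no mass for almost every \<zeta> in U. Lipschitz dependence
  in variation forbids this for \<zeta> close to \<xi>, and such \<zeta> have positive
  probability.\<close>

lemma (in driven_chain) past_supp_invariant:
  assumes M: "prob_space M" and st: "stationary_process M \<eta>" and cond: "conditional_law M \<eta> Q" and \<iota>: "1 < \<iota>"
    and R: "\<And>y. y \<in> msupport (distr M borel (\<eta> 0)) \<Longrightarrow> norm y \<le> R"
    and QK: "\<And>\<xi>. \<xi> \<in> past_supp M \<eta> \<Longrightarrow> Q \<xi> \<in> prob_on (msupport (distr M borel (\<eta> 0)))"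
    and C: "0 < C" "\<And>\<xi> \<xi>'. \<xi> \<in> past_supp M \<eta> \<Longrightarrow> \<xi>' \<in> past_supp M \<eta> \<Longrightarrow> var_dist (Q \<xi>) (Q \<xi>') \<le> C * hist_dist \<iota> \<xi> \<xi>'"
    and \<xi>: "\<xi> \<in> past_supp M \<eta>"
  shows "AE y in Q \<xi>. y \<in> msupport (distr M borel (\<eta> 0)) \<and> case_nat y \<xi> \<in> past_supp M \<eta>"
proof -
  define E where "E = past_supp M \<eta>"
  interpret M: prob_space M by fact
  interpret Q\<xi>: prob_space "Q \<xi>" by (rule prob_space_Q)
  have past [measurable]: "past \<eta> \<in> borel_measurable M" using past_measurable[OF st, of 0] by (simp add: past_def[abs_def])
  have [measurable]: "\<eta> k \<in> borel_measurable M" for k using st by (simp add: stationary_process_def)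
  have sl [measurable_cong]: "sets (past_law M \<eta>) = sets borel" by (simp add: past_law_def)
  have E: "closed E" "AE \<zeta> in past_law M \<eta>. \<zeta> \<in> E"
    unfolding E_def past_supp_def using msupport_complement_null[OF sl] by auto
  have ER: "norm (\<zeta> i) \<le> R" if "\<zeta> \<in> E" for \<zeta> i
    using past_supp_in_support[OF M st, of \<zeta> i] that R by (simp add: E_def)
  have AE1: "AE y in Q \<xi>. y \<in> msupport (distr M borel (\<eta> 0))"
    using QK[OF \<xi>] by (intro Q\<xi>.AE_prob_1) (simp add: prob_on_def measure_def)
  have AE2: "AE y in Q \<xi>. y \<in> msupport (Q \<xi>)" by (rule msupport_complement_null) simp
  have inE: "case_nat y \<xi> \<in> E" if y: "y \<in> msupport (Q \<xi>)" for y
  proof (rule ccontr)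
    assume "case_nat y \<xi> \<notin> E"
    then obtain W where W: "open W" "case_nat y \<xi> \<in> W" "emeasure (past_law M \<eta>) W = 0"
      by (auto simp: E_def past_supp_def msupport_def zero_less_iff_neq_zero)
    have cont: "continuous_on UNIV (\<lambda>p::(nat \<Rightarrow> 'e) \<times> 'e. (case_nat (snd p) (fst p) :: nat \<Rightarrow> 'e))"
    proof (rule continuous_on_coordinatewise_then_product)
      fix i show "continuous_on UNIV (\<lambda>p::(nat \<Rightarrow> 'e) \<times> 'e. (case_nat (snd p) (fst p) :: nat \<Rightarrow> 'e) i)"
        by (cases i) (auto intro!: continuous_intros continuous_on_compose2[OF continuous_on_product_coordinates continuous_on_fst[OF continuous_on_id]])
    qed
    have "open ((\<lambda>p::(nat \<Rightarrow> 'e) \<times> 'e. (case_nat (snd p) (fst p) :: nat \<Rightarrow> 'e)) -` W)"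
      by (rule open_vimage[OF W(1) cont])
    moreover have "(\<xi>, y) \<in> (\<lambda>p::(nat \<Rightarrow> 'e) \<times> 'e. (case_nat (snd p) (fst p) :: nat \<Rightarrow> 'e)) -` W" using W(2) by simp
    ultimately obtain U V where UV0: "open U" "open V" "(\<xi>, y) \<in> U \<times> V"
      and UVW: "U \<times> V \<subseteq> (\<lambda>p::(nat \<Rightarrow> 'e) \<times> 'e. (case_nat (snd p) (fst p) :: nat \<Rightarrow> 'e)) -` W"
      by (rule open_prod_elim)
    have UV: "open U" "open V" "\<xi> \<in> U" "y \<in> V" using UV0 by auto
    have [measurable]: "U \<in> sets borel" "V \<in> sets borel" "W \<in> sets borel" using UV W by auto
    have "emeasure M {\<omega> \<in> space M. past \<eta> \<omega> \<in> U \<and> \<eta> 1 \<omega> \<in> V} = 0"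
    proof -
      let ?G = "\<lambda>p::(nat \<Rightarrow> 'e) \<times> 'e. indicator W (case_nat (snd p) (fst p)) :: real"
      have "?G \<in> borel_measurable borel"
        unfolding borel_prod[symmetric] by measurable
      \<comment> \<open>One step back in time: the past at time 0 is the past at time -1 with the
        value at time 0 in front, so the extended past has the law of the past and misses
        \<open>W\<close> almost surely.\<close>
      from stationary_shift[OF st this, of "-1"]
      have eq: "(\<integral>\<omega>. indicator W (case_nat (\<eta> 0 \<omega>) (\<lambda>i. \<eta> (- 1 - int i) \<omega>)) \<partial>M :: real) =
          (\<integral>\<omega>. indicator W (case_nat (\<eta> 1 \<omega>) (past \<eta> \<omega>)) \<partial>M)" by simp
      have "case_nat (\<eta> 0 \<omega>) (\<lambda>i. \<eta> (- 1 - int i) \<omega>) = past \<eta> \<omega>" for \<omega>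
        by (auto simp: fun_eq_iff past_def split: nat.split)
      then have "(\<integral>\<omega>. indicator W (case_nat (\<eta> 1 \<omega>) (past \<eta> \<omega>)) \<partial>M :: real) = (\<integral>\<omega>. indicator W (past \<eta> \<omega>) \<partial>M)"
        using eq by simp
      also have "\<dots> = (\<integral>\<zeta>. indicator W \<zeta> \<partial>past_law M \<eta>)"
        unfolding past_law_def by (rule integral_distr[symmetric]) measurable
      also have "\<dots> = 0" using W(3) by (simp add: measure_def past_law_def)
      finally have "(\<integral>\<omega>. indicator W (case_nat (\<eta> 1 \<omega>) (past \<eta> \<omega>)) \<partial>M :: real) = 0" .
      moreover have "integrable M (\<lambda>\<omega>. indicator W (case_nat (\<eta> 1 \<omega>) (past \<eta> \<omega>)) :: real)"
        by (rule M.integrable_const_bound[of _ 1]) (auto simp: indicator_def)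
      ultimately have "AE \<omega> in M. indicator W (case_nat (\<eta> 1 \<omega>) (past \<eta> \<omega>)) = (0::real)"
        by (subst (asm) integral_nonneg_eq_0_iff_AE) auto
      then have "AE \<omega> in M. \<not> (past \<eta> \<omega> \<in> U \<and> \<eta> 1 \<omega> \<in> V)"
        by eventually_elim (use UVW in \<open>auto simp: indicator_def split: if_splits\<close>)
      then show ?thesis by (subst (asm) AE_iff_measurable[OF _ refl]) (auto simp: )
    qed
    then have "(\<integral>\<^sup>+\<zeta>. emeasure (Q \<zeta>) V * indicator U \<zeta> \<partial>past_law M \<eta>) = 0"
      using cond unfolding conditional_law_def by simp
    moreover have "(\<lambda>\<zeta>. emeasure (Q \<zeta>) V) \<in> borel_measurable borel"
      by (rule measurable_emeasure_kernel[OF measurable_prob_algebraD[OF Q_kernel]]) simp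
    ultimately have AE0: "AE \<zeta> in past_law M \<eta>. emeasure (Q \<zeta>) V * indicator U \<zeta> = 0"
      by (subst (asm) nn_integral_0_iff_AE) auto
    define v where "v = measure (Q \<xi>) V"
    have "0 < emeasure (Q \<xi>) V" using y UV by (simp add: msupport_def)
    then have v: "0 < v" by (simp add: v_def Q\<xi>.emeasure_eq_measure)
    \<comment> \<open>Within this distance of \<xi> the mass of V changes by less than its value v
      at \<xi>, so it stays positive.\<close>
    have vC: "0 < v / C" using v C(1) by simp
    obtain n \<delta> where \<delta>: "0 < \<delta>" and small: "\<forall>(\<zeta>::nat \<Rightarrow> 'e) \<zeta>'. (\<forall>i. norm (\<zeta> i) \<le> R) \<longrightarrow> (\<forall>i. norm (\<zeta>' i) \<le> R) \<longrightarrow>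
        (\<forall>i<n. norm (\<zeta> i - \<zeta>' i) < \<delta>) \<longrightarrow> hist_dist \<iota> \<zeta> \<zeta>' < v / C"
      using hist_dist_small[OF \<iota> vC, of R] by (elim exE conjE) (rule that)
    have n: "0 < \<delta>" "hist_dist \<iota> \<zeta> \<xi> < v / C" if "\<zeta> \<in> E" "\<forall>i<n. norm (\<zeta> i - \<xi> i) < \<delta>" for \<zeta>
      using small[rule_format, of \<zeta> \<xi>] ER that \<xi> \<delta> by (auto simp: E_def)
    define U' where "U' = U \<inter> (\<Inter>i\<in>{..<n}. (\<lambda>\<zeta>::nat \<Rightarrow> 'e. \<zeta> i) -` ball (\<xi> i) \<delta>)"
    have "open U'" unfolding U'_def using UV(1)
      by (intro open_Int open_INT ballI open_vimage continuous_on_product_coordinates) auto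
    moreover have "\<xi> \<in> U'" using UV(3) \<delta> by (simp add: U'_def)
    ultimately have pos: "0 < emeasure (past_law M \<eta>) U'" using \<xi> by (simp add: past_supp_def msupport_def)
    have "AE \<zeta> in past_law M \<eta>. \<zeta> \<notin> U'"
      using AE0 E(2)
    proof eventually_elim
      case (elim \<zeta>)
      show "\<zeta> \<notin> U'"
      proof
        assume \<zeta>: "\<zeta> \<in> U'"
        then have "emeasure (Q \<zeta>) V = 0" using elim(1) by (simp add: U'_def)
        then have z: "measure (Q \<zeta>) V = 0" by (simp add: measure_def)
        have "\<forall>i<n. norm (\<zeta> i - \<xi> i) < \<delta>" using \<zeta> by (simp add: U'_def dist_norm norm_minus_commute)
        then have "hist_dist \<iota> \<zeta> \<xi> < v / C" by (rule n(2)[OF elim(2)])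
        moreover have "hist_dist \<iota> \<xi> \<zeta> = hist_dist \<iota> \<zeta> \<xi>" by (simp add: hist_dist_def norm_minus_commute)
        ultimately have "C * hist_dist \<iota> \<xi> \<zeta> < v" using C(1) by (simp add: field_simps)
        moreover have "v \<le> measure (Q \<zeta>) V + var_dist (Q \<xi>) (Q \<zeta>)"
          unfolding v_def by (rule measure_le_var_dist[OF prob_space_Q prob_space_Q]) simp
        moreover have "var_dist (Q \<xi>) (Q \<zeta>) \<le> C * hist_dist \<iota> \<xi> \<zeta>" using C(2)[OF \<xi>] elim(2) by (simp add: E_def)
        ultimately show False using z by linarith
      qed
    qed
    then have "emeasure (past_law M \<eta>) U' = 0"
      using \<open>open U'\<close> by (subst (asm) AE_iff_measurable[of U']) (auto simp: past_law_def)
    then show False using pos by simp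
  qed
  show ?thesis unfolding E_def[symmetric] using AE1 AE2 by eventually_elim (simp add: inE)
qed

section \<open>Contraction in the dual-Lipschitz sense\<close>

text \<open>The Hilbert structure, the determining subspace and the densities have been condensed
  into \<open>squeeze\<close>; from here on only norms are used. \<open>C\<close> is the price of
  the squeezing map, \<open>CV\<close> the Lipschitz constant of the kernel in variation.\<close>

locale contracting_chain = driven_chain S Q
  for S :: "'h::{real_normed_vector, second_countable_topology} \<times> 'e::{real_normed_vector, second_countable_topology} \<Rightarrow> 'h"
    and Q :: "(nat \<Rightarrow> 'e) \<Rightarrow> 'e measure" +
  fixes X :: "'h set" and K :: "'e set" and E :: "(nat \<Rightarrow> 'e) set" and \<iota> R C CV \<kappa> d0 :: real
  assumes \<iota>: "1 < \<iota>" and K_bounded: "\<And>y. y \<in> K \<Longrightarrow> norm y \<le> R"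
    and E_in_K: "\<And>\<xi> i. \<xi> \<in> E \<Longrightarrow> \<xi> i \<in> K"
    and K_borel: "K \<in> sets borel" and E_borel: "E \<in> sets borel"
    and E_invariant: "\<And>\<xi>. \<xi> \<in> E \<Longrightarrow> AE y in Q \<xi>. y \<in> K \<and> case_nat y \<xi> \<in> E"
    and S_invariant: "S ` (X \<times> K) \<subseteq> X"
    and CV: "0 \<le> CV" "\<And>\<xi> \<xi>'. \<xi> \<in> E \<Longrightarrow> \<xi>' \<in> E \<Longrightarrow> var_dist (Q \<xi>) (Q \<xi>') \<le> CV * hist_dist \<iota> \<xi> \<xi>'"
    and \<kappa>: "0 \<le> \<kappa>" "\<kappa> < 1" and C: "0 \<le> C" and d0: "0 < d0"
    and squeeze: "\<And>u u'. u \<in> X \<Longrightarrow> u' \<in> X \<Longrightarrow> norm (u - u') \<le> d0 \<Longrightarrow>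
      \<exists>\<Phi>. continuous_on UNIV \<Phi> \<and> (\<forall>y\<in>K. norm (S (u, y) - S (u', \<Phi> y)) \<le> \<kappa> * norm (u - u')) \<and>
      (\<forall>y. norm (\<Phi> y - y) \<le> C * norm (u - u')) \<and>
      (\<forall>\<xi>\<in>E. \<forall>g. g \<in> borel_measurable borel \<longrightarrow> (\<forall>y. g y \<le> 1) \<longrightarrow>
         (\<integral>\<^sup>+y. g (\<Phi> y) \<partial>Q \<xi>) \<le> (\<integral>\<^sup>+y. g y \<partial>Q \<xi>) + ennreal (C * norm (u - u')))"
begin

definition dst :: "real \<Rightarrow> real \<Rightarrow> 'h \<times> (nat \<Rightarrow> 'e) \<Rightarrow> 'h \<times> (nat \<Rightarrow> 'e) \<Rightarrow> real" where
  "dst \<theta> \<tau> z z' = (norm (fst z - fst z') + \<theta> * hist_dist \<iota> (snd z) (snd z')) / \<tau>"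

text \<open>The oscillation is controlled only on \<open>X \<times> E\<close>, the set that the
  chain does not leave. The truncation at 1 means that a function with constant \<open>L\<close> has
  oscillation at most \<open>L\<close> there.\<close>

definition lip_fun :: "real \<Rightarrow> real \<Rightarrow> real \<Rightarrow> ('h \<times> (nat \<Rightarrow> 'e) \<Rightarrow> real) \<Rightarrow> bool" where
  "lip_fun \<theta> \<tau> L f \<longleftrightarrow> unit_fun f \<and> (\<forall>z\<in>X \<times> E. \<forall>z'\<in>X \<times> E. \<bar>f z - f z'\<bar> \<le> L * min 1 (dst \<theta> \<tau> z z'))"

lemma E_bounded: "\<xi> \<in> E \<Longrightarrow> norm (\<xi> i) \<le> R"
  using E_in_K K_bounded by blast

lemma hist_nonneg: "\<xi> \<in> E \<Longrightarrow> \<xi>' \<in> E \<Longrightarrow> 0 \<le> hist_dist \<iota> \<xi> \<xi>'"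
  by (rule hist_dist_nonneg[OF \<iota>, of _ R]) (auto intro: E_bounded)

lemma dst_commute: "dst \<theta> \<tau> z z' = dst \<theta> \<tau> z' z"
  by (simp add: dst_def hist_dist_def norm_minus_commute)

lemma dst_nonneg: "z \<in> X \<times> E \<Longrightarrow> z' \<in> X \<times> E \<Longrightarrow> 0 \<le> \<theta> \<Longrightarrow> 0 < \<tau> \<Longrightarrow> 0 \<le> dst \<theta> \<tau> z z'"
  unfolding dst_def using hist_nonneg[of "snd z" "snd z'"] by auto

lemma AE_step: "z \<in> X \<times> E \<Longrightarrow> AE y in Q (snd z). (S (fst z, y), case_nat y (snd z)) \<in> X \<times> E \<and> y \<in> K"
proof -
  assume "z \<in> X \<times> E"
  then have z: "fst z \<in> X" "snd z \<in> E" by auto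
  show ?thesis using E_invariant[OF z(2)] by eventually_elim (use z(1) S_invariant in blast)
qed

lemma step_le:
  assumes f: "unit_fun f" and z: "z \<in> X \<times> E" and le: "\<And>w. w \<in> X \<times> E \<Longrightarrow> f w \<le> b"
  shows "step f z \<le> b"
proof -
  interpret prob_space "Q (snd z)" by (rule prob_space_Q)
  have "step f z \<le> (\<integral>y. b \<partial>Q (snd z))"
    unfolding step_def
  proof (rule integral_mono_AE[OF step_integrable[OF f]])
    show "AE y in Q (snd z). f (S (fst z, y), case_nat y (snd z)) \<le> b"
      using AE_step[OF z] by eventually_elim (use le in blast)
  qed simp
  then show ?thesis using prob_space by simp
qed

lemma step_ge:
  assumes f: "unit_fun f" and z: "z \<in> X \<times> E" and le: "\<And>w. w \<in> X \<times> E \<Longrightarrow> b \<le> f w"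
  shows "b \<le> step f z"
proof -
  interpret prob_space "Q (snd z)" by (rule prob_space_Q)
  have "(\<integral>y. b \<partial>Q (snd z)) \<le> step f z"
    unfolding step_def
  proof (rule integral_mono_AE[OF _ step_integrable[OF f]])
    show "AE y in Q (snd z). b \<le> f (S (fst z, y), case_nat y (snd z))"
      using AE_step[OF z] by eventually_elim (use le in blast)
  qed simp
  then show ?thesis using prob_space by simp
qed

lemma steps_le:
  assumes f: "unit_fun f" and le: "\<And>w. w \<in> X \<times> E \<Longrightarrow> f w \<le> b" and z: "z \<in> X \<times> E"
  shows "(step ^^ k) f z \<le> b"
  using z by (induction k arbitrary: z) (auto intro: step_le[OF unit_fun_steps[OF f]] le)

lemma steps_ge:
  assumes f: "unit_fun f" and le: "\<And>w. w \<in> X \<times> E \<Longrightarrow> b \<le> f w" and z: "z \<in> X \<times> E"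
  shows "b \<le> (step ^^ k) f z"
  using z by (induction k arbitrary: z) (auto intro: step_ge[OF unit_fun_steps[OF f]] le)

text \<open>Functions with values in [0, 1] are not a linear space, so scaling has to be tracked by
  hand. Equality on \<open>X \<times> E\<close> suffices because the chain stays there almost
  surely.\<close>

lemma steps_affine:
  assumes f: "unit_fun f" and g: "unit_fun g" and eq: "\<And>w. w \<in> X \<times> E \<Longrightarrow> f w = c + L * g w" and z: "z \<in> X \<times> E"
  shows "(step ^^ k) f z = c + L * (step ^^ k) g z"
  using z
proof (induction k arbitrary: z)
  case (Suc k)
  note fk = unit_fun_steps[OF f, of k] and gk = unit_fun_steps[OF g, of k]
  interpret prob_space "Q (snd z)" by (rule prob_space_Q)
  have "(step ^^ Suc k) f z = (\<integral>y. c + L * (step ^^ k) g (S (fst z, y), case_nat y (snd z)) \<partial>Q (snd z))"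
    unfolding funpow.simps o_def step_def[of "(step ^^ k) f"]
  proof (rule integral_cong_AE)
    show "AE y in Q (snd z). (step ^^ k) f (S (fst z, y), case_nat y (snd z)) = c + L * (step ^^ k) g (S (fst z, y), case_nat y (snd z))"
      using AE_step[OF Suc.prems] by eventually_elim (use Suc.IH in blast)
  qed (use step_integrable[OF fk] step_integrable[OF gk] in auto)
  also have "\<dots> = c + L * (step ^^ Suc k) g z"
    using step_integrable[OF gk] prob_space by (simp add: step_def)
  finally show ?case .
qed (use eq in simp)

text \<open>Since the distance is truncated at 1, the oscillation of \<open>f\<close> on
  \<open>X \<times> E\<close> is at most \<open>L\<close>. Subtracting the infimum and dividing by
  \<open>L\<close> gives values in [0, 1] there, and clipping takes care of the other points. This
  allows the contraction to be iterated although it is proved only for constant 1.\<close>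

lemma lip_fun_normalise:
  assumes f: "lip_fun \<theta> \<tau> L f" and L: "0 < L" and ne: "X \<noteq> {}" "E \<noteq> {}" and \<theta>: "0 \<le> \<theta>" "0 < \<tau>"
  obtains c g where "lip_fun \<theta> \<tau> 1 g" "\<And>z. z \<in> X \<times> E \<Longrightarrow> f z = c + L * g z"
proof -
  have uf: "unit_fun f" and lf: "\<And>z z'. z \<in> X \<times> E \<Longrightarrow> z' \<in> X \<times> E \<Longrightarrow> \<bar>f z - f z'\<bar> \<le> L * min 1 (dst \<theta> \<tau> z z')"
    using f by (auto simp: lip_fun_def)
  define c where "c = (INF z\<in>X \<times> E. f z)"
  have bdd: "bdd_below (f ` (X \<times> E))" using uf by (intro bdd_belowI[of _ 0]) (auto simp: unit_fun_def)
  have c1: "c \<le> f z" if "z \<in> X \<times> E" for z unfolding c_def by (rule cINF_lower[OF bdd that])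
  have c2: "f z \<le> c + L" if z: "z \<in> X \<times> E" for z
  proof -
    have "f z - L \<le> c" unfolding c_def
    proof (rule cINF_greatest)
      fix w assume w: "w \<in> X \<times> E"
      have "L * min 1 (dst \<theta> \<tau> z w) \<le> L * 1" using L by (intro mult_left_mono) auto
      then show "f z - L \<le> f w" using lf[OF z w] by linarith
    qed (use ne in auto)
    then show ?thesis by linarith
  qed
  define g where "g z = max 0 (min 1 ((f z - c) / L))" for z
  have [measurable]: "f \<in> borel_measurable borel" using uf by (simp add: unit_fun_def)
  have ug: "unit_fun g" unfolding unit_fun_def g_def by auto
  have g: "g z = (f z - c) / L" if "z \<in> X \<times> E" for z
    using c1[OF that] c2[OF that] L by (simp add: g_def min_absorb2 max_absorb2)
  have "\<bar>g z - g z'\<bar> \<le> 1 * min 1 (dst \<theta> \<tau> z z')" if z: "z \<in> X \<times> E" "z' \<in> X \<times> E" for z z'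
  proof -
    have "g z - g z' = (f z - f z') / L" using z by (simp add: g diff_divide_distrib)
    then have "\<bar>g z - g z'\<bar> = \<bar>f z - f z'\<bar> / L" using L by simp
    also have "\<dots> \<le> (L * min 1 (dst \<theta> \<tau> z z')) / L" using L lf[OF z] by (intro divide_right_mono) auto
    finally show ?thesis using L by simp
  qed
  then have "lip_fun \<theta> \<tau> 1 g" using ug by (simp add: lip_fun_def)
  moreover have "f z = c + L * g z" if "z \<in> X \<times> E" for z using g[OF that] L by simp
  ultimately show thesis by (rule that)
qed

text \<open>The law of the noise at \<open>z\<close> is moved by the squeezing map \<open>\<Phi>\<close>. Where the moved noise leaves
  the support, \<open>f\<close> is replaced by its upper bound 1; this set is null for the noise at \<open>z'\<close>.\<close>

lemma local_contraction_aux: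
  assumes f: "lip_fun \<theta> \<tau> 1 f" and z: "z \<in> X \<times> E" "z' \<in> X \<times> E" and \<theta>: "0 < \<theta>" and \<tau>: "0 < \<tau>" "\<tau> \<le> d0"
    and near: "dst \<theta> \<tau> z z' < 1"
  shows "step f z \<le> step f z' + (max (\<kappa> + \<theta> * C) (1 / \<iota>) + (C + CV / \<theta>) * \<tau>) * dst \<theta> \<tau> z z'"
proof -
  obtain u \<xi> u' \<xi>' where zz: "z = (u, \<xi>)" "z' = (u', \<xi>')" by (metis surj_pair)
  have u: "u \<in> X" "u' \<in> X" and \<xi>: "\<xi> \<in> E" "\<xi>' \<in> E" using z zz by auto
  have uf: "unit_fun f" and lf: "\<And>z z'. z \<in> X \<times> E \<Longrightarrow> z' \<in> X \<times> E \<Longrightarrow> \<bar>f z - f z'\<bar> \<le> min 1 (dst \<theta> \<tau> z z')"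
    using f by (auto simp: lip_fun_def)
  define d h D where "d = norm (u - u')" and "h = hist_dist \<iota> \<xi> \<xi>'" and "D = dst \<theta> \<tau> z z'"
  have dh: "0 \<le> d" "0 \<le> h" using hist_nonneg[OF \<xi>] by (auto simp: d_def h_def)
  have D: "d + \<theta> * h = \<tau> * D" using \<tau> by (simp add: D_def dst_def zz d_def h_def)
  have D0: "0 \<le> D" unfolding D_def by (rule dst_nonneg[OF z]) (use \<theta> \<tau> in auto)
  have "d \<le> \<tau> * D" using D dh \<theta> mult_nonneg_nonneg[of \<theta> h] by linarith
  also have "\<dots> \<le> \<tau> * 1" using near \<tau> by (intro mult_left_mono) (auto simp: D_def)
  finally have "norm (u - u') \<le> d0" using \<tau> by (simp add: d_def)
  from squeeze[OF u this] obtain \<Phi> where \<Phi>c: "continuous_on UNIV \<Phi>"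
    and \<Phi>1: "\<forall>y\<in>K. norm (S (u, y) - S (u', \<Phi> y)) \<le> \<kappa> * norm (u - u')"
    and \<Phi>2: "\<forall>y. norm (\<Phi> y - y) \<le> C * norm (u - u')"
    and \<Phi>3: "\<forall>\<xi>\<in>E. \<forall>g. g \<in> borel_measurable borel \<longrightarrow> (\<forall>y. g y \<le> 1) \<longrightarrow>
         (\<integral>\<^sup>+y. g (\<Phi> y) \<partial>Q \<xi>) \<le> (\<integral>\<^sup>+y. g y \<partial>Q \<xi>) + ennreal (C * norm (u - u'))"
    by (elim exE conjE) (rule that)
  have [measurable]: "\<Phi> \<in> borel_measurable borel" using \<Phi>c by (rule borel_measurable_continuous_onI)
  note [measurable] = K_borel E_borel
  define q0 where "q0 = max (\<kappa> + \<theta> * C) (1 / \<iota>)"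
  have q0: "0 \<le> q0" using \<iota> by (simp add: q0_def le_max_iff_disj)
  define G where "G y = (if y \<in> K \<and> case_nat y \<xi>' \<in> E then f (S (u', y), case_nat y \<xi>') else 1)" for y
  have fM: "(\<lambda>y. f (S (u', y), case_nat y \<xi>')) \<in> borel_measurable borel"
    by (intro unit_fun_compose[OF uf] S_measurable case_nat_measurable) auto
  have EM: "{y. case_nat y \<xi>' \<in> E} \<in> sets borel"
  proof -
    have "Measurable.pred (borel :: 'e measure) (\<lambda>y. (case_nat y \<xi>' :: nat \<Rightarrow> 'e) \<in> E)"
      by (rule pred_sets2[OF E_borel]) (intro case_nat_measurable, auto)
    then show ?thesis by (simp add: pred_def)
  qed
  have GM [measurable]: "G \<in> borel_measurable borel"
  proof -
    have "{y. y \<in> K \<and> case_nat y \<xi>' \<in> E} \<in> sets borel" using sets.Int[OF K_borel EM] by (simp add: Int_def)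
    then show ?thesis unfolding G_def[abs_def] by (intro measurable_If fM) auto
  qed
  have G01: "0 \<le> G y" "G y \<le> 1" for y using uf by (auto simp: G_def unit_fun_def)
  have G_int: "integrable M G" "integrable M (\<lambda>y. G (\<Phi> y))" if M: "prob_space M" "sets M = sets borel" for M
  proof -
    interpret prob_space M by fact
    note [measurable_cong] = M(2)
    show "integrable M G" "integrable M (\<lambda>y. G (\<Phi> y))"
      by (intro integrable_const_bound[of _ 1]; use G01 in \<open>auto\<close>)+
  qed
  \<comment> \<open>If the moved noise is admissible at z', the new state distance is at most
    \<kappa> d by squeezing and the new history distance at most C d + h / \<iota>; both
    coefficients are covered by \<open>q0\<close>.\<close>
  have ptw: "f (S (u, y), case_nat y \<xi>) \<le> G (\<Phi> y) + q0 * D" if y: "y \<in> K" "(S (u, y), case_nat y \<xi>) \<in> X \<times> E" for y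
  proof (cases "\<Phi> y \<in> K \<and> case_nat (\<Phi> y) \<xi>' \<in> E")
    case True
    define w w' where w: "w = (S (u, y), case_nat y \<xi>)" "w' = (S (u', \<Phi> y), case_nat (\<Phi> y) \<xi>')"
    have wX: "w \<in> X \<times> E" "w' \<in> X \<times> E" using y(2) True u S_invariant by (auto simp: w image_subset_iff)
    have "norm (y - \<Phi> y) \<le> C * d" using \<Phi>2 by (simp add: d_def norm_minus_commute)
    moreover have "hist_dist \<iota> (snd w) (snd w') = norm (y - \<Phi> y) + h / \<iota>"
      unfolding w h_def snd_conv by (rule hist_dist_case_nat[OF \<iota>, of _ R]) (use \<xi> y True E_bounded K_bounded in auto)
    moreover have "norm (fst w - fst w') \<le> \<kappa> * d" using \<Phi>1 y(1) by (simp add: w d_def)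
    ultimately have "\<tau> * dst \<theta> \<tau> w w' \<le> \<kappa> * d + \<theta> * (C * d + h / \<iota>)"
      using \<tau> \<theta> by (simp add: dst_def add_mono mult_left_mono)
    also have "\<dots> = (\<kappa> + \<theta> * C) * d + (1 / \<iota>) * (\<theta> * h)" by (simp add: algebra_simps)
    also have "\<dots> \<le> q0 * d + q0 * (\<theta> * h)" using dh \<theta> by (intro add_mono mult_right_mono) (auto simp: q0_def)
    also have "\<dots> = \<tau> * (q0 * D)" using D by (simp add: distrib_left[symmetric])
    finally have "dst \<theta> \<tau> w w' \<le> q0 * D" using \<tau> by simp
    moreover have "f w - f w' \<le> dst \<theta> \<tau> w w'" using lf[OF wX] by linarith
    moreover have "G (\<Phi> y) = f w'" using True by (simp add: G_def w)
    ultimately show ?thesis by (simp add: w)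
  next
    case False
    then have "G (\<Phi> y) = 1" unfolding G_def by (rule if_not_P)
    moreover have "f (S (u, y), case_nat y \<xi>) \<le> 1" using uf by (simp add: unit_fun_def)
    ultimately show ?thesis using mult_nonneg_nonneg[OF q0 D0] by linarith
  qed
  interpret Q\<xi>: prob_space "Q \<xi>" by (rule prob_space_Q)
  have "step f z \<le> (\<integral>y. G (\<Phi> y) + q0 * D \<partial>Q \<xi>)"
    unfolding step_def zz fst_conv snd_conv
  proof (rule integral_mono_AE[OF step_integrable[OF uf]])
    show "integrable (Q \<xi>) (\<lambda>y. G (\<Phi> y) + q0 * D)" using G_int(2)[OF prob_space_Q] by simp
    show "AE y in Q \<xi>. f (S (u, y), case_nat y \<xi>) \<le> G (\<Phi> y) + q0 * D"
      using AE_step[OF z(1)] unfolding zz fst_conv snd_conv by eventually_elim (rule ptw; blast)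
  qed
  also have "\<dots> = (\<integral>y. G (\<Phi> y) \<partial>Q \<xi>) + q0 * D"
    using G_int(2)[OF prob_space_Q] Q\<xi>.prob_space by simp
  also have "(\<integral>y. G (\<Phi> y) \<partial>Q \<xi>) \<le> (\<integral>y. G y \<partial>Q \<xi>) + C * d"
  proof -
    have "(\<integral>\<^sup>+y. ennreal (G (\<Phi> y)) \<partial>Q \<xi>) \<le> (\<integral>\<^sup>+y. ennreal (G y) \<partial>Q \<xi>) + ennreal (C * d)"
      using \<Phi>3[rule_format, OF \<xi>(1), of "\<lambda>y. ennreal (G y)"] G01 by (simp add: d_def)
    moreover have "(\<integral>\<^sup>+y. ennreal (G (\<Phi> y)) \<partial>Q \<xi>) = ennreal (\<integral>y. G (\<Phi> y) \<partial>Q \<xi>)"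
      by (rule nn_integral_eq_integral[OF G_int(2)[OF prob_space_Q]]) (use G01 in auto)
    moreover have "(\<integral>\<^sup>+y. ennreal (G y) \<partial>Q \<xi>) = ennreal (\<integral>y. G y \<partial>Q \<xi>)"
      by (rule nn_integral_eq_integral[OF G_int(1)[OF prob_space_Q]]) (use G01 in auto)
    moreover have "0 \<le> (\<integral>y. G y \<partial>Q \<xi>)" using G01 by (intro integral_nonneg_AE) auto
    ultimately show ?thesis using C dh by (simp add: ennreal_plus[symmetric] del: ennreal_plus)
  qed
  also have "(\<integral>y. G y \<partial>Q \<xi>) \<le> (\<integral>y. G y \<partial>Q \<xi>') + var_dist (Q \<xi>) (Q \<xi>')"
    by (rule integral_le_var_dist) (auto simp: prob_space_Q G01)
  also have "var_dist (Q \<xi>) (Q \<xi>') \<le> CV * h" using CV(2)[OF \<xi>] by (simp add: h_def)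
  also have "(\<integral>y. G y \<partial>Q \<xi>') = step f z'"
    unfolding step_def zz fst_conv snd_conv
  proof (rule integral_cong_AE)
    show "AE y in Q \<xi>'. G y = f (S (u', y), case_nat y \<xi>')"
      using E_invariant[OF \<xi>(2)] by eventually_elim (simp add: G_def)
  qed (use fM in auto)
  finally have "step f z \<le> step f z' + (CV * h + C * d + q0 * D)" by simp
  \<comment> \<open>Both costs in variation are measured by d + \<theta> h = \<tau> D, which
    produces the factor \<tau>. The history term pays the factor 1 / \<theta>.\<close>
  also have "CV * h + C * d \<le> (C + CV / \<theta>) * (d + \<theta> * h)"
    using \<theta> CV(1) C dh by (simp add: field_simps)
  also have "\<dots> = (C + CV / \<theta>) * \<tau> * D" by (simp add: D)
  finally show ?thesis by (simp add: q0_def D_def algebra_simps)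
qed

lemma local_contraction:
  obtains \<theta> \<tau> q where "0 < \<theta>" "0 < \<tau>" "\<tau> \<le> 2" "0 \<le> q" "q < 1"
    "\<And>f z z'. lip_fun \<theta> \<tau> 1 f \<Longrightarrow> z \<in> X \<times> E \<Longrightarrow> z' \<in> X \<times> E \<Longrightarrow> dst \<theta> \<tau> z z' < 1 \<Longrightarrow>
      \<bar>step f z - step f z'\<bar> \<le> q * dst \<theta> \<tau> z z'"
proof -
  define \<theta> where "\<theta> = (1 - \<kappa>) / (2 * (C + 1))"
  have \<theta>: "0 < \<theta>" using \<kappa> C by (simp add: \<theta>_def)
  have "\<theta> * C \<le> \<theta> * (C + 1)" using \<theta> by simp
  also have "\<dots> = (1 - \<kappa>) / 2"
  proof -
    have eq: "x / (2 * c) * c = x / 2" if "c \<noteq> 0" for x c :: real using that by simp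
    show ?thesis unfolding \<theta>_def by (rule eq) (use C in auto)
  qed
  finally have "\<kappa> + \<theta> * C < 1" using \<kappa> by (simp add: field_simps)
  define q0 where "q0 = max (\<kappa> + \<theta> * C) (1 / \<iota>)"
  have q0: "0 \<le> q0" "q0 < 1" using \<iota> \<open>\<kappa> + \<theta> * C < 1\<close> by (auto simp: q0_def le_max_iff_disj)
  define C3 where "C3 = C + CV / \<theta>"
  have C3: "0 \<le> C3" using C CV \<theta> by (simp add: C3_def)
  \<comment> \<open>The bound 1 secures \<open>\<tau> \<le> 2\<close>, with which (f + 1) / 2 is
    admissible for every f of the dual-Lipschitz class; \<open>d0\<close> opens the way to
    squeezing, and the last term leaves half of the gap 1 - q0.\<close>
  define \<tau> where "\<tau> = min 1 (min d0 ((1 - q0) / (2 * (C3 + 1))))"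
  have \<tau>: "0 < \<tau>" "\<tau> \<le> d0" "\<tau> \<le> 2" using q0 C3 d0 by (auto simp: \<tau>_def)
  have "C3 * \<tau> \<le> C3 * ((1 - q0) / (2 * (C3 + 1)))" using C3 by (intro mult_left_mono) (auto simp: \<tau>_def)
  also have "\<dots> = (C3 / (C3 + 1)) * ((1 - q0) / 2)" by simp
  also have "\<dots> \<le> 1 * ((1 - q0) / 2)" using C3 q0 by (intro mult_right_mono) auto
  finally have q: "q0 + C3 * \<tau> < 1" using q0 by simp
  show thesis
  proof (rule that[OF \<theta> \<tau>(1,3) _ q])
    show "0 \<le> q0 + C3 * \<tau>" using q0 C3 \<tau> by simp
    fix f z z' assume f: "lip_fun \<theta> \<tau> 1 f" and z: "z \<in> X \<times> E" "z' \<in> X \<times> E" and near: "dst \<theta> \<tau> z z' < 1"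
    have "step f z \<le> step f z' + (q0 + C3 * \<tau>) * dst \<theta> \<tau> z z'"
      unfolding q0_def C3_def by (rule local_contraction_aux[OF f z \<theta> \<tau>(1,2) near])
    moreover have "step f z' \<le> step f z + (q0 + C3 * \<tau>) * dst \<theta> \<tau> z' z"
      unfolding q0_def C3_def by (rule local_contraction_aux[OF f z(2,1) \<theta> \<tau>(1,2)]) (use near dst_commute in metis)
    ultimately show "\<bar>step f z - step f z'\<bar> \<le> (q0 + C3 * \<tau>) * dst \<theta> \<tau> z z'"
      unfolding dst_commute[of \<theta> \<tau> z' z] by linarith
  qed
qed

end

section \<open>Irreducibility and mixing\<close>

lemma traj_zero_contraction:
  assumes "\<And>u. norm (traj S u (\<lambda>_. 0) k) \<le> a * norm u" "0 \<le> a"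
  shows "norm (traj S u (\<lambda>_. 0) (k * l)) \<le> a ^ l * norm u"
proof (induction l)
  case (Suc l)
  have "traj S u (\<lambda>_. 0) (k * Suc l) = traj S (traj S u (\<lambda>_. 0) (k * l)) (\<lambda>_. 0) k"
    using traj_add[of S u "\<lambda>_. 0" "k * l" k] by (simp add: add.commute)
  then have "norm (traj S u (\<lambda>_. 0) (k * Suc l)) \<le> a * norm (traj S u (\<lambda>_. 0) (k * l))" using assms(1) by simp
  also have "\<dots> \<le> a * (a ^ l * norm u)" by (intro mult_left_mono Suc assms)
  finally show ?case by simp
qed simp

text \<open>Uniform continuity of \<open>S\<close> on the compact set \<open>X \<times> K\<close>
  propagates closeness step by step. That 0 lies in \<open>K\<close> keeps the unforced trajectory
  inside \<open>X\<close> as well.\<close>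

lemma traj_near_zero_noise:
  fixes S :: "'h::real_normed_vector \<times> 'e::real_normed_vector \<Rightarrow> 'h"
  assumes S: "continuous_on UNIV S" and X: "compact X" and K: "compact K" "0 \<in> K" and inv: "S ` (X \<times> K) \<subseteq> X" and e: "0 < e"
  shows "\<exists>\<delta>>0. \<forall>v\<in>X. \<forall>y. (\<forall>j. 1 \<le> j \<longrightarrow> j \<le> n \<longrightarrow> y j \<in> K \<and> norm (y j) < \<delta>) \<longrightarrow>
    norm (traj S v y n - traj S v (\<lambda>_. 0) n) < e"
  using e
proof (induction n arbitrary: e)
  case 0
  then show ?case by (intro exI[of _ 1]) auto
next
  case (Suc n)
  have "uniformly_continuous_on (X \<times> K) S"
    by (rule compact_uniformly_continuous[OF continuous_on_subset[OF S] compact_Times[OF X K(1)]]) simp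
  then obtain r where r: "0 < r" "\<And>p q. p \<in> X \<times> K \<Longrightarrow> q \<in> X \<times> K \<Longrightarrow> dist q p < r \<Longrightarrow> dist (S q) (S p) < e"
    using Suc.prems unfolding uniformly_continuous_on_def by blast
  obtain \<delta> where \<delta>: "0 < \<delta>" "\<forall>v\<in>X. \<forall>y. (\<forall>j. 1 \<le> j \<longrightarrow> j \<le> n \<longrightarrow> y j \<in> K \<and> norm (y j) < \<delta>) \<longrightarrow>
    norm (traj S v y n - traj S v (\<lambda>_. 0) n) < r / 2"
    using Suc.IH[of "r / 2"] r(1) by auto
  show ?case
  proof (rule exI[of _ "min \<delta> (r / 2)"], intro conjI ballI allI impI)
    show "0 < min \<delta> (r / 2)" using \<delta> r by simp
    fix v y assume v: "v \<in> X" and y: "\<forall>j. 1 \<le> j \<longrightarrow> j \<le> Suc n \<longrightarrow> y j \<in> K \<and> norm (y j) < min \<delta> (r / 2)"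
    have 1: "norm (traj S v y n - traj S v (\<lambda>_. 0) n) < r / 2" using \<delta>(2) v y by simp
    have 2: "traj S v y n \<in> X" by (rule traj_in[OF inv v]) (use y in auto)
    have 3: "traj S v (\<lambda>_. 0) n \<in> X" by (rule traj_in[OF inv v]) (use K in auto)
    have 4: "y (Suc n) \<in> K" "norm (y (Suc n)) < r / 2" using y by auto
    have "dist (traj S v y n, y (Suc n)) (traj S v (\<lambda>_. 0) n, 0) < r"
      using norm_Pair_le[of "traj S v y n - traj S v (\<lambda>_. 0) n" "y (Suc n)"] 1 4(2) by (simp add: dist_norm)
    then have "dist (S (traj S v y n, y (Suc n))) (S (traj S v (\<lambda>_. 0) n, 0)) < e"
      by (rule r(2)[rotated 2]) (use 2 3 4 K in auto)
    then show "norm (traj S v y (Suc n) - traj S v (\<lambda>_. 0) (Suc n)) < e" by (simp add: dist_norm)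
  qed
qed

lemma traj_small:
  fixes S :: "'h::real_normed_vector \<times> 'e::real_normed_vector \<Rightarrow> 'h"
  assumes S: "continuous_on UNIV S" and X: "compact X" and K: "compact K" "0 \<in> K" and inv: "S ` (X \<times> K) \<subseteq> X"
    and GD: "hyp_GD S" and e: "0 < e"
  shows "\<exists>n\<ge>n0. 1 \<le> n \<and> (\<exists>\<delta>>0. \<forall>v\<in>X. \<forall>y. (\<forall>j. 1 \<le> j \<longrightarrow> j \<le> n \<longrightarrow> y j \<in> K \<and> norm (y j) < \<delta>) \<longrightarrow> norm (traj S v y n) < e)"
proof -
  obtain k a where k: "1 \<le> k" and a: "0 < a" "a < 1" "\<And>u. norm (traj S u (\<lambda>_. 0) k) \<le> a * norm u"
    using GD unfolding hyp_GD_def by blast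
  obtain RX where RX: "0 < RX" "\<And>u. u \<in> X \<Longrightarrow> norm u \<le> RX" using compact_imp_bounded[OF X] by (auto simp: bounded_pos)
  have "(\<lambda>l. a ^ l * RX) \<longlonglongrightarrow> 0 * RX" by (intro tendsto_mult_right LIMSEQ_power_zero) (use a in auto)
  then have "\<forall>\<^sub>F l in sequentially. a ^ l * RX < e / 2" by (rule order_tendstoD) (use e in simp)
  then obtain l0 where l0: "\<And>l. l0 \<le> l \<Longrightarrow> a ^ l * RX < e / 2" by (auto simp: eventually_sequentially)
  \<comment> \<open>(GD) controls multiples of k only. The summand \<open>l0\<close> makes the
    unforced state small, \<open>n0\<close> provides enough recent entries of the history, and 1
    makes the time positive.\<close>
  define l where "l = l0 + n0 + 1"
  define n where "n = k * l"
  have n: "n0 \<le> n" "1 \<le> n" using mult_le_mono1[OF k, of l] by (auto simp: n_def l_def)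
  obtain \<delta> where \<delta>: "0 < \<delta>" "\<forall>v\<in>X. \<forall>y. (\<forall>j. 1 \<le> j \<longrightarrow> j \<le> n \<longrightarrow> y j \<in> K \<and> norm (y j) < \<delta>) \<longrightarrow>
    norm (traj S v y n - traj S v (\<lambda>_. 0) n) < e / 2"
    using traj_near_zero_noise[OF S X K inv, of "e / 2" n] e by auto
  have "norm (traj S v y n) < e" if v: "v \<in> X" and y: "\<forall>j. 1 \<le> j \<longrightarrow> j \<le> n \<longrightarrow> y j \<in> K \<and> norm (y j) < \<delta>" for v y
  proof -
    have "norm (traj S v (\<lambda>_. 0) n) \<le> a ^ l * norm v"
      unfolding n_def by (rule traj_zero_contraction) (use a in auto)
    also have "\<dots> \<le> a ^ l * RX" using RX(2)[OF v] a by (intro mult_left_mono) auto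
    also have "\<dots> < e / 2" by (rule l0) (simp add: l_def)
    finally have "norm (traj S v (\<lambda>_. 0) n) < e / 2" .
    moreover have "norm (traj S v y n - traj S v (\<lambda>_. 0) n) < e / 2" using \<delta>(2) v y by blast
    ultimately show ?thesis using norm_triangle_sub[of "traj S v y n" "traj S v (\<lambda>_. 0) n"] by linarith
  qed
  then show ?thesis using n \<delta>(1) by blast
qed

context contracting_chain
begin

lemma AE_path: "\<xi> \<in> E \<Longrightarrow> AE y in path_kernel Q k \<xi>. hist_append \<xi> k y \<in> E \<and> (\<forall>j\<in>{1..k}. y j \<in> K)"
  by (rule AE_path_kernel[OF E_borel K_borel E_invariant])

definition small_noise :: "nat \<Rightarrow> nat \<Rightarrow> real \<Rightarrow> (nat \<Rightarrow> 'e) \<Rightarrow> (nat \<Rightarrow> 'e) set" where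
  "small_noise s n \<delta> \<xi> = {y \<in> space (path_kernel Q (s + n) \<xi>). \<forall>i\<in>{1..n}. norm (y (s + i)) < \<delta>}"

lemma small_noise_sets: "small_noise s n \<delta> \<xi> \<in> sets (path_kernel Q (s + n) \<xi>)"
proof -
  have "(\<lambda>y. y (s + i)) \<in> borel_measurable (path_kernel Q (s + n) \<xi>)" if "i \<in> {1..n}" for i
    unfolding measurable_cong_sets[OF sets_path refl] using that by (intro measurable_component_singleton) auto
  note [measurable] = this
  have "{y \<in> space (path_kernel Q (s + n) \<xi>). norm (y (s + i)) < \<delta>} \<in> sets (path_kernel Q (s + n) \<xi>)" if "i \<in> {1..n}" for i
    using that by measurable
  then show ?thesis unfolding small_noise_def by (rule sets.sets_Collect_finite_All) auto
qed

lemma SRZ_small_noise: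
  assumes SRZ: "hyp_SRZ E Q" and n: "1 \<le> n" and \<delta>: "0 < \<delta>" and ne: "E \<noteq> {}"
  obtains s p where "0 < p" "p \<le> 1" "\<And>\<xi>. \<xi> \<in> E \<Longrightarrow> p \<le> measure (path_kernel Q (s + n) \<xi>) (small_noise s n \<delta> \<xi>)"
proof -
  obtain s where s: "0 < (INF \<xi>\<in>E. measure (last_kernel Q s n \<xi>) (PiE {1..n} (\<lambda>_. ball 0 \<delta>)))"
    using SRZ n \<delta> unfolding hyp_SRZ_def by blast
  define p where "p = (INF \<xi>\<in>E. measure (last_kernel Q s n \<xi>) (PiE {1..n} (\<lambda>_. ball 0 \<delta>)))"
  have p: "p \<le> measure (path_kernel Q (s + n) \<xi>) (small_noise s n \<delta> \<xi>)" if "\<xi> \<in> E" for \<xi>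
    unfolding small_noise_def measure_last_kernel[symmetric] p_def
    by (rule cINF_lower[OF _ that]) (auto intro!: bdd_belowI[of _ 0])
  obtain \<xi> where "\<xi> \<in> E" using ne by auto
  from p[OF this] have "p \<le> 1" using prob_space.prob_le_1[OF prob_space_path] order_trans by blast
  then show thesis using that[of p s] p s unfolding p_def[symmetric] by blast
qed

text \<open>Paths of the noise stay in \<open>K\<close> almost surely, yet by (SRZ) with n = 1 some
  entry is within \<delta> of 0 with positive probability. So 0 is a limit of points of
  \<open>K\<close>.\<close>

lemma zero_in_K:
  assumes SRZ: "hyp_SRZ E Q" and ne: "E \<noteq> {}" and K: "closed K"
  shows "0 \<in> K"
proof -
  obtain \<xi> where \<xi>: "\<xi> \<in> E" using ne by auto
  have "\<exists>y\<in>K. dist y 0 < \<delta>" if \<delta>: "0 < \<delta>" for \<delta>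
  proof (rule ccontr)
    assume no: "\<not> (\<exists>y\<in>K. dist y 0 < \<delta>)"
    obtain s p where p: "0 < p" "p \<le> measure (path_kernel Q (s + 1) \<xi>) (small_noise s 1 \<delta> \<xi>)"
      using SRZ_small_noise[OF SRZ order_refl \<delta> ne] \<xi> by metis
    interpret prob_space "path_kernel Q (s + 1) \<xi>" by (rule prob_space_path)
    have "AE y in path_kernel Q (s + 1) \<xi>. y \<notin> small_noise s 1 \<delta> \<xi>"
      using AE_path[OF \<xi>, of "s + 1"]
    proof eventually_elim
      fix y assume "hist_append \<xi> (s + 1) y \<in> E \<and> (\<forall>j\<in>{1..s + 1}. y j \<in> K)"
      then have "y (s + 1) \<in> K" by auto
      then show "y \<notin> small_noise s 1 \<delta> \<xi>" using no by (auto simp: small_noise_def)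
    qed
    then have "measure (path_kernel Q (s + 1) \<xi>) (small_noise s 1 \<delta> \<xi>) = 0"
      using prob_eq_0[OF small_noise_sets] by blast
    then show False using p by simp
  qed
  then have "0 \<in> closure K" unfolding closure_approachable by blast
  then show ?thesis using K by (simp add: closure_closed)
qed

text \<open>From every starting point the chain is in the set \<open>Gd\<close> after s + n steps
  with probability at least p, and \<open>Gd\<close> has diameter at most 1/2. With \<beta> the
  supremum of f on \<open>Gd\<close>, the expectation is at most 1 - (1 - \<beta>) p from one point
  and at least (\<beta> - 1/2) p from the other. In the difference \<beta> cancels and 1 - p / 2
  remains.\<close>

lemma irreducibility:
  assumes X: "compact X" and K: "compact K" and GD: "hyp_GD S" and SRZ: "hyp_SRZ E Q" and ne: "E \<noteq> {}"
    and \<theta>: "0 < \<theta>" and \<tau>: "0 < \<tau>"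
  obtains m p where "1 \<le> m" "0 < p" "p \<le> 1"
    "\<And>f z z'. lip_fun \<theta> \<tau> 1 f \<Longrightarrow> z \<in> X \<times> E \<Longrightarrow> z' \<in> X \<times> E \<Longrightarrow> (step ^^ m) f z - (step ^^ m) f z' \<le> 1 - p / 2"
proof -
  \<comment> \<open>Two states below \<tau> / 8 differ by at most \<tau> / 4, and \<theta> times the
    history distance is at most \<tau> / 4; divided by \<tau> the sum is at most 1/2.\<close>
  have e: "0 < \<tau> / (4 * \<theta>)" "0 < \<tau> / 8" using \<theta> \<tau> by auto
  obtain n0 \<delta>0 where \<delta>0: "0 < \<delta>0" and small: "\<forall>(\<xi>::nat \<Rightarrow> 'e) \<xi>'. (\<forall>i. norm (\<xi> i) \<le> R) \<longrightarrow> (\<forall>i. norm (\<xi>' i) \<le> R) \<longrightarrow>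
    (\<forall>i<n0. norm (\<xi> i - \<xi>' i) < \<delta>0) \<longrightarrow> hist_dist \<iota> \<xi> \<xi>' < \<tau> / (4 * \<theta>)"
    using hist_dist_small[OF \<iota> e(1), of R] by (elim exE conjE) (rule that)
  have K0: "0 \<in> K" by (rule zero_in_K[OF SRZ ne compact_imp_closed[OF K]])
  obtain n \<delta>1 where n: "n0 \<le> n" "1 \<le> n" and \<delta>1: "0 < \<delta>1"
    and tr: "\<forall>v\<in>X. \<forall>y. (\<forall>j. 1 \<le> j \<longrightarrow> j \<le> n \<longrightarrow> y j \<in> K \<and> norm (y j) < \<delta>1) \<longrightarrow> norm (traj S v y n) < \<tau> / 8"
    using traj_small[OF S_cont X K K0 S_invariant GD e(2), of n0] by (elim exE conjE) (rule that)
  define \<delta> where "\<delta> = min (\<delta>0 / 2) \<delta>1"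
  have \<delta>: "0 < \<delta>" "\<delta> \<le> \<delta>1" "\<delta> \<le> \<delta>0 / 2" using \<delta>0 \<delta>1 by (auto simp: \<delta>_def)
  obtain s p where p: "0 < p" "p \<le> 1" "\<And>\<xi>. \<xi> \<in> E \<Longrightarrow> p \<le> measure (path_kernel Q (s + n) \<xi>) (small_noise s n \<delta> \<xi>)"
    using SRZ_small_noise[OF SRZ n(2) \<delta>(1) ne] by blast
  define Gd where "Gd = {z \<in> X \<times> E. norm (fst z) < \<tau> / 8 \<and> (\<forall>i<n. norm (snd z i) < \<delta>)}"
  have Gd_close: "dst \<theta> \<tau> w w' \<le> 1/2" if w: "w \<in> Gd" "w' \<in> Gd" for w w'
  proof -
    have "norm (snd w i - snd w' i) < \<delta>0" if "i < n0" for i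
    proof -
      have "norm (snd w i) < \<delta>" "norm (snd w' i) < \<delta>" using w that n(1) by (auto simp: Gd_def)
      then show ?thesis using norm_triangle_ineq4[of "snd w i" "snd w' i"] \<delta>(3) by linarith
    qed
    then have "hist_dist \<iota> (snd w) (snd w') < \<tau> / (4 * \<theta>)"
      using small w E_bounded by (auto simp: Gd_def)
    then have "\<theta> * hist_dist \<iota> (snd w) (snd w') \<le> \<tau> / 4" using \<theta> by (simp add: field_simps)
    moreover have "norm (fst w - fst w') \<le> \<tau> / 4"
      using norm_triangle_ineq4[of "fst w" "fst w'"] w by (auto simp: Gd_def)
    ultimately show ?thesis using \<tau> by (simp add: dst_def field_simps)
  qed
  have AE_Gd: "AE y in path_kernel Q (s + n) \<xi>. y \<in> small_noise s n \<delta> \<xi> \<longrightarrow>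
      (traj S u y (s + n), hist_append \<xi> (s + n) y) \<in> Gd" if u: "u \<in> X" and \<xi>: "\<xi> \<in> E" for u \<xi>
    using AE_path[OF \<xi>, of "s + n"]
  proof eventually_elim
    fix y assume y: "hist_append \<xi> (s + n) y \<in> E \<and> (\<forall>j\<in>{1..s + n}. y j \<in> K)"
    show "y \<in> small_noise s n \<delta> \<xi> \<longrightarrow> (traj S u y (s + n), hist_append \<xi> (s + n) y) \<in> Gd"
    proof
      assume "y \<in> small_noise s n \<delta> \<xi>"
      then have sm: "norm (y (s + i)) < \<delta>" if "1 \<le> i" "i \<le> n" for i using that by (auto simp: small_noise_def)
      have v: "traj S u y s \<in> X" by (rule traj_in[OF S_invariant u]) (use y in auto)
      have ys: "y (s + j) \<in> K \<and> norm (y (s + j)) < \<delta>1" if "1 \<le> j" "j \<le> n" for j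
        using y sm[OF that] \<delta>(2) that by auto
      have "norm (traj S (traj S u y s) (\<lambda>j. y (s + j)) n) < \<tau> / 8"
        by (rule tr[rule_format, OF v]) (rule ys)
      moreover have "traj S u y (s + n) \<in> X" by (rule traj_in[OF S_invariant u]) (use y in auto)
      \<comment> \<open>Entry i of the new history is the noise of time s + n - i, which lies among
        the n small ones exactly when i < n.\<close>
      moreover have "norm (hist_append \<xi> (s + n) y i) < \<delta>" if "i < n" for i
        using sm[of "n - i"] that by (simp add: hist_append_def)
      ultimately show "(traj S u y (s + n), hist_append \<xi> (s + n) y) \<in> Gd"
        using y by (simp add: Gd_def traj_add)
    qed
  qed
  show thesis
  proof (rule that[of "s + n" p])
    show "1 \<le> s + n" using n by simp
    fix f z z' assume f: "lip_fun \<theta> \<tau> 1 f" and z: "z \<in> X \<times> E" "z' \<in> X \<times> E"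
    have uf: "unit_fun f" and lf: "\<And>z z'. z \<in> X \<times> E \<Longrightarrow> z' \<in> X \<times> E \<Longrightarrow> \<bar>f z - f z'\<bar> \<le> min 1 (dst \<theta> \<tau> z z')"
      using f by (auto simp: lip_fun_def)
    have f01: "0 \<le> f w" "f w \<le> 1" for w using uf unfolding unit_fun_def by blast+
    \<comment> \<open>All values of f on \<open>Gd\<close> lie in an interval of length 1/2 whose
      upper end \<beta> is at most 1. If \<open>Gd\<close> is empty, any such \<beta> will
      do.\<close>
    have "\<exists>\<beta>\<le>1. \<forall>w\<in>Gd. f w \<le> \<beta> \<and> \<beta> - 1/2 \<le> f w"
    proof (cases "Gd = {}")
      case False
      define \<beta> where "\<beta> = (SUP w\<in>Gd. f w)"
      have bdd: "bdd_above (f ` Gd)" using f01 by (intro bdd_aboveI[of _ 1]) auto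
      have "\<beta> \<le> 1" unfolding \<beta>_def by (rule cSUP_least[OF False]) (rule f01)
      moreover have "f w \<le> \<beta>" if "w \<in> Gd" for w unfolding \<beta>_def by (rule cSUP_upper[OF that bdd])
      moreover have "\<beta> \<le> f w + 1/2" if w: "w \<in> Gd" for w unfolding \<beta>_def
      proof (rule cSUP_least[OF False])
        fix w' assume w': "w' \<in> Gd"
        have "w \<in> X \<times> E" "w' \<in> X \<times> E" using w w' by (auto simp: Gd_def)
        from lf[OF this] Gd_close[OF w w'] show "f w' \<le> f w + 1/2" by linarith
      qed
      ultimately show ?thesis by (intro exI[of _ \<beta>]) force
    qed (auto intro: exI[of _ 1])
    then obtain \<beta> where \<beta>: "\<beta> \<le> 1" "\<And>w. w \<in> Gd \<Longrightarrow> f w \<le> \<beta>" "\<And>w. w \<in> Gd \<Longrightarrow> \<beta> - 1/2 \<le> f w" by blast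
    have int: "integrable (path_kernel Q (s + n) \<xi>) (\<lambda>y. f (traj S u y (s + n), hist_append \<xi> (s + n) y))" for u \<xi>
    proof (rule unit_fun_integrable[OF uf prob_space_path])
      show "(\<lambda>y. traj S u y (s + n)) \<in> borel_measurable (path_kernel Q (s + n) \<xi>)"
        unfolding measurable_cong_sets[OF sets_path refl] by (rule traj_measurable) simp
      show "(\<lambda>y. hist_append \<xi> (s + n) y) \<in> borel_measurable (path_kernel Q (s + n) \<xi>)"
        unfolding measurable_cong_sets[OF sets_path refl] by (intro hist_append_measurable) auto
    qed
    have upper: "(step ^^ (s + n)) f (u, \<xi>) \<le> 1 - (1 - \<beta>) * p" if u: "u \<in> X" and \<xi>: "\<xi> \<in> E" for u \<xi>
    proof -
      interpret prob_space "path_kernel Q (s + n) \<xi>" by (rule prob_space_path)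
      let ?A = "small_noise s n \<delta> \<xi>"
      have i: "integrable (path_kernel Q (s + n) \<xi>) (indicator ?A :: _ \<Rightarrow> real)"
        using small_noise_sets by (intro integrable_real_indicator) (auto simp: emeasure_eq_measure)
      have "(step ^^ (s + n)) f (u, \<xi>) \<le> (\<integral>y. 1 - (1 - \<beta>) * indicator ?A y \<partial>path_kernel Q (s + n) \<xi>)"
        unfolding steps_path_kernel[OF uf]
      proof (rule integral_mono_AE[OF int])
        show "AE y in path_kernel Q (s + n) \<xi>. f (traj S u y (s + n), hist_append \<xi> (s + n) y) \<le> 1 - (1 - \<beta>) * indicator ?A y"
          using AE_Gd[OF u \<xi>] by eventually_elim (use \<beta>(2) f01 in \<open>auto simp: indicator_def\<close>)
      qed (use i in auto)
      also have "\<dots> = 1 - (1 - \<beta>) * prob ?A"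
        using i prob_space small_noise_sets by (simp add: Int_absorb2 sets.sets_into_space)
      also have "\<dots> \<le> 1 - (1 - \<beta>) * p" using p(3)[OF \<xi>] \<beta>(1) by (simp add: mult_left_mono)
      finally show ?thesis .
    qed
    have lower: "(\<beta> - 1/2) * p \<le> (step ^^ (s + n)) f (u, \<xi>)" if u: "u \<in> X" and \<xi>: "\<xi> \<in> E" for u \<xi>
    \<comment> \<open>For a nonpositive factor the lower bound on the probability points the wrong
      way, but then the claim follows from positivity.\<close>
    proof (cases "\<beta> \<le> 1/2")
      case True
      have "(\<beta> - 1/2) * p \<le> 0" using True p(1) by (simp add: mult_nonpos_nonneg)
      also have "0 \<le> (step ^^ (s + n)) f (u, \<xi>)" using unit_fun_steps[OF uf] by (simp add: unit_fun_def)
      finally show ?thesis .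
    next
      case False
      interpret prob_space "path_kernel Q (s + n) \<xi>" by (rule prob_space_path)
      let ?A = "small_noise s n \<delta> \<xi>"
      have i: "integrable (path_kernel Q (s + n) \<xi>) (indicator ?A :: _ \<Rightarrow> real)"
        using small_noise_sets by (intro integrable_real_indicator) (auto simp: emeasure_eq_measure)
      have "(\<beta> - 1/2) * p \<le> (\<beta> - 1/2) * prob ?A" using p(3)[OF \<xi>] False by (intro mult_left_mono) auto
      also have "\<dots> = (\<integral>y. (\<beta> - 1/2) * indicator ?A y \<partial>path_kernel Q (s + n) \<xi>)"
        using i small_noise_sets by (simp add: Int_absorb2 sets.sets_into_space)
      also have "\<dots> \<le> (step ^^ (s + n)) f (u, \<xi>)"
        unfolding steps_path_kernel[OF uf]
      proof (rule integral_mono_AE[OF _ int])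
        show "AE y in path_kernel Q (s + n) \<xi>. (\<beta> - 1/2) * indicator ?A y \<le> f (traj S u y (s + n), hist_append \<xi> (s + n) y)"
          using AE_Gd[OF u \<xi>] by eventually_elim (use \<beta>(3) f01 in \<open>auto simp: indicator_def\<close>)
      qed (use i in auto)
      finally show ?thesis .
    qed
    have "(step ^^ (s + n)) f z - (step ^^ (s + n)) f z' \<le> (1 - (1 - \<beta>) * p) - (\<beta> - 1/2) * p"
      using upper[of "fst z" "snd z"] lower[of "fst z'" "snd z'"] z by auto
    also have "\<dots> = 1 - p / 2" by (simp add: algebra_simps)
    finally show "(step ^^ (s + n)) f z - (step ^^ (s + n)) f z' \<le> 1 - p / 2" .
  qed (use p in auto)
qed

text \<open>A single \<open>step\<close> contracts near pairs and is at least nonexpansive for far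
  ones; only m steps also contract far pairs. After normalisation the m-step operator multiplies the
  Lipschitz constant by r, and this can be repeated.\<close>

lemma uniform_mixing:
  assumes X: "compact X" "X \<noteq> {}" and K: "compact K" and GD: "hyp_GD S" and SRZ: "hyp_SRZ E Q" and ne: "E \<noteq> {}"
  obtains \<theta> \<tau> m r where "0 < \<theta>" "0 < \<tau>" "\<tau> \<le> 2" "1 \<le> m" "0 < r" "r < (1::real)"
    "\<And>f k z z'. lip_fun \<theta> \<tau> 1 f \<Longrightarrow> z \<in> X \<times> E \<Longrightarrow> z' \<in> X \<times> E \<Longrightarrow> \<bar>(step ^^ k) f z - (step ^^ k) f z'\<bar> \<le> r ^ (k div m)"
proof -
  obtain \<theta> \<tau> q where \<theta>: "0 < \<theta>" "0 < \<tau>" "\<tau> \<le> 2" and q: "0 \<le> q" "q < 1"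
    and loc: "\<And>f z z'. lip_fun \<theta> \<tau> 1 f \<Longrightarrow> z \<in> X \<times> E \<Longrightarrow> z' \<in> X \<times> E \<Longrightarrow> dst \<theta> \<tau> z z' < 1 \<Longrightarrow>
      \<bar>step f z - step f z'\<bar> \<le> q * dst \<theta> \<tau> z z'"
    by (rule local_contraction) (rule that; assumption)
  obtain m p where m: "1 \<le> m" and p: "0 < p" "p \<le> 1"
    and irr: "\<And>f z z'. lip_fun \<theta> \<tau> 1 f \<Longrightarrow> z \<in> X \<times> E \<Longrightarrow> z' \<in> X \<times> E \<Longrightarrow> (step ^^ m) f z - (step ^^ m) f z' \<le> 1 - p / 2"
    by (rule irreducibility[OF X(1) K GD SRZ ne \<theta>(1,2)]) (rule that; assumption)
  define r where "r = max q (1 - p / 2)"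
  have r: "0 < r" "r < 1" "q \<le> r" "1 - p / 2 \<le> r" using p q by (auto simp: r_def)
  have dn: "0 \<le> dst \<theta> \<tau> z z'" if "z \<in> X \<times> E" "z' \<in> X \<times> E" for z z'
    using dst_nonneg[OF that] \<theta> by simp
  have lip1: "lip_fun \<theta> \<tau> 1 (step f)" if f: "lip_fun \<theta> \<tau> 1 f" for f
    unfolding lip_fun_def
  proof (intro conjI ballI)
    have uf: "unit_fun f" using f by (simp add: lip_fun_def)
    show us: "unit_fun (step f)" by (rule unit_fun_step[OF uf])
    fix z z' assume z: "z \<in> X \<times> E" "z' \<in> X \<times> E"
    show "\<bar>step f z - step f z'\<bar> \<le> 1 * min 1 (dst \<theta> \<tau> z z')"
    proof (cases "dst \<theta> \<tau> z z' < 1")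
      case True
      have "\<bar>step f z - step f z'\<bar> \<le> q * dst \<theta> \<tau> z z'" by (rule loc[OF f z True])
      also have "\<dots> \<le> 1 * dst \<theta> \<tau> z z'" using q dn[OF z] by (intro mult_right_mono) auto
      finally show ?thesis using True by simp
    next
      case False
      have "0 \<le> step f z" "step f z \<le> 1" "0 \<le> step f z'" "step f z' \<le> 1" using us unfolding unit_fun_def by blast+
      then have "\<bar>step f z - step f z'\<bar> \<le> 1" by linarith
      then show ?thesis using False by simp
    qed
  qed
  have lips: "lip_fun \<theta> \<tau> 1 ((step ^^ k) f)" if "lip_fun \<theta> \<tau> 1 f" for f k
    using that by (induction k) (auto intro: lip1)
  have contr1: "lip_fun \<theta> \<tau> r ((step ^^ m) f)" if f: "lip_fun \<theta> \<tau> 1 f" for f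
    unfolding lip_fun_def
  proof (intro conjI ballI)
    have uf: "unit_fun f" using f by (simp add: lip_fun_def)
    show "unit_fun ((step ^^ m) f)" by (rule unit_fun_steps[OF uf])
    fix z z' assume z: "z \<in> X \<times> E" "z' \<in> X \<times> E"
    show "\<bar>(step ^^ m) f z - (step ^^ m) f z'\<bar> \<le> r * min 1 (dst \<theta> \<tau> z z')"
    proof (cases "dst \<theta> \<tau> z z' < 1")
      \<comment> \<open>For a near pair the local contraction is used once, for the outermost step;
        the inner steps merely preserve the class.\<close>
      case True
      obtain m' where m': "m = Suc m'" using m by (cases m) auto
      have "\<bar>(step ^^ m) f z - (step ^^ m) f z'\<bar> \<le> q * dst \<theta> \<tau> z z'"
        unfolding m' funpow.simps o_def by (rule loc[OF lips[OF f] z True])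
      also have "\<dots> \<le> r * dst \<theta> \<tau> z z'" using r dn[OF z] by (intro mult_right_mono) auto
      finally show ?thesis using True by simp
    next
      case False
      then show ?thesis using irr[OF f z] irr[OF f z(2,1)] r(4) by simp
    qed
  qed
  have contr: "lip_fun \<theta> \<tau> (r * L) ((step ^^ m) f)" if f: "lip_fun \<theta> \<tau> L f" and L: "0 < L" for f L
  proof -
    have uf: "unit_fun f" using f by (simp add: lip_fun_def)
    obtain c g where g: "lip_fun \<theta> \<tau> 1 g" "\<And>z. z \<in> X \<times> E \<Longrightarrow> f z = c + L * g z"
      using lip_fun_normalise[OF f L X(2) ne] \<theta> by (metis less_imp_le)
    have ug: "unit_fun g" using g by (simp add: lip_fun_def)
    have eq: "(step ^^ m) f z = c + L * (step ^^ m) g z" if "z \<in> X \<times> E" for z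
      by (rule steps_affine[OF uf ug g(2) that])
    show ?thesis unfolding lip_fun_def
    proof (intro conjI ballI unit_fun_steps[OF uf])
      fix z z' assume z: "z \<in> X \<times> E" "z' \<in> X \<times> E"
      have "\<bar>(step ^^ m) f z - (step ^^ m) f z'\<bar> = L * \<bar>(step ^^ m) g z - (step ^^ m) g z'\<bar>"
        using L by (simp add: eq z abs_mult right_diff_distrib[symmetric])
      also have "\<dots> \<le> L * (r * min 1 (dst \<theta> \<tau> z z'))"
        using contr1[OF g(1)] z L by (intro mult_left_mono) (auto simp: lip_fun_def)
      finally show "\<bar>(step ^^ m) f z - (step ^^ m) f z'\<bar> \<le> r * L * min 1 (dst \<theta> \<tau> z z')" by (simp add: mult_ac)
    qed
  qed
  have iter: "lip_fun \<theta> \<tau> (r ^ j) ((step ^^ (m * j)) f)" if f: "lip_fun \<theta> \<tau> 1 f" for f j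
  proof (induction j)
    case (Suc j)
    have "(step ^^ (m * Suc j)) f = (step ^^ m) ((step ^^ (m * j)) f)" by (simp add: funpow_add)
    then show ?case using contr[OF Suc.IH] r(1) by simp
  qed (use f in simp)
  show thesis
  proof (rule that[OF \<theta> m r(1,2)])
    fix f k z z' assume f: "lip_fun \<theta> \<tau> 1 f" and z: "z \<in> X \<times> E" "z' \<in> X \<times> E"
    \<comment> \<open>The remaining k mod m steps are applied first and keep the constant at
      1.\<close>
    have "(step ^^ k) f = (step ^^ (m * (k div m))) ((step ^^ (k mod m)) f)"
      by (metis comp_apply funpow_add mult_div_mod_eq)
    then have "lip_fun \<theta> \<tau> (r ^ (k div m)) ((step ^^ k) f)" using iter[OF lips[OF f, of "k mod m"]] by simp
    then have "\<bar>(step ^^ k) f z - (step ^^ k) f z'\<bar> \<le> r ^ (k div m) * min 1 (dst \<theta> \<tau> z z')"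
      using z unfolding lip_fun_def by blast
    also have "\<dots> \<le> r ^ (k div m) * 1" using r by (intro mult_left_mono) auto
    finally show "\<bar>(step ^^ k) f z - (step ^^ k) f z'\<bar> \<le> r ^ (k div m)" by simp
  qed
qed

text \<open>The value of \<open>step ^^ (j + k)\<close> at a point is an average of values of
  \<open>(step ^^ k) f\<close> over \<open>X \<times> E\<close>, hence within the oscillation \<rho>
  of any one of them. This compares times k and j + k, and two initial states, uniformly in
  j.\<close>

lemma integral_steps_near:
  assumes \<sigma>: "prob_space \<sigma>" "sets \<sigma> = sets borel" "AE \<xi> in \<sigma>. \<xi> \<in> E" and f: "unit_fun f"
    and u: "u \<in> X" "u0 \<in> X"
    and osc: "\<And>z z'. z \<in> X \<times> E \<Longrightarrow> z' \<in> X \<times> E \<Longrightarrow> \<bar>(step ^^ k) f z - (step ^^ k) f z'\<bar> \<le> \<rho>"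
  shows "\<bar>(\<integral>\<xi>. (step ^^ k) f (u, \<xi>) \<partial>\<sigma>) - (\<integral>\<xi>. (step ^^ (j + k)) f (u0, \<xi>) \<partial>\<sigma>)\<bar> \<le> \<rho>"
proof -
  interpret \<sigma>: prob_space \<sigma> by fact
  note [measurable_cong] = \<sigma>(2)
  note fk = unit_fun_steps[OF f]
  have int: "integrable \<sigma> (\<lambda>\<xi>. (step ^^ k) f (u, \<xi>))" for k u
    by (rule unit_fun_integrable[OF fk \<sigma>(1)]) auto
  have near: "\<bar>(step ^^ k) f (u, \<xi>) - (step ^^ (j + k)) f (u0, \<xi>)\<bar> \<le> \<rho>" if \<xi>: "\<xi> \<in> E" for \<xi>
  proof -
    have z: "(u, \<xi>) \<in> X \<times> E" "(u0, \<xi>) \<in> X \<times> E" using u \<xi> by auto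
    have le: "(step ^^ k) f w \<le> (step ^^ k) f (u, \<xi>) + \<rho>" "(step ^^ k) f (u, \<xi>) - \<rho> \<le> (step ^^ k) f w"
      if "w \<in> X \<times> E" for w
      using osc[OF that z(1)] by linarith+
    have "(step ^^ j) ((step ^^ k) f) (u0, \<xi>) \<le> (step ^^ k) f (u, \<xi>) + \<rho>"
      by (rule steps_le[OF fk le(1) z(2)])
    moreover have "(step ^^ k) f (u, \<xi>) - \<rho> \<le> (step ^^ j) ((step ^^ k) f) (u0, \<xi>)"
      by (rule steps_ge[OF fk le(2) z(2)])
    ultimately show ?thesis by (simp add: funpow_add abs_le_iff)
  qed
  have "(\<integral>\<xi>. (step ^^ k) f (u, \<xi>) \<partial>\<sigma>) - (\<integral>\<xi>. (step ^^ (j + k)) f (u0, \<xi>) \<partial>\<sigma>)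
      = (\<integral>\<xi>. (step ^^ k) f (u, \<xi>) - (step ^^ (j + k)) f (u0, \<xi>) \<partial>\<sigma>)"
    by (intro Bochner_Integration.integral_diff[symmetric] int)
  also have "\<bar>\<dots>\<bar> \<le> (\<integral>\<xi>. \<rho> \<partial>\<sigma>)"
  proof (rule order_trans[OF integral_abs_bound integral_mono_AE])
    show "AE \<xi> in \<sigma>. \<bar>(step ^^ k) f (u, \<xi>) - (step ^^ (j + k)) f (u0, \<xi>)\<bar> \<le> \<rho>"
      using \<sigma>(3) by eventually_elim (rule near)
  qed (use int in auto)
  finally show ?thesis by (simp add: \<sigma>.prob_space)
qed

end

theorem theorem3p4:
  fixes M :: "'w measure"
    and \<eta> :: "int \<Rightarrow> 'w \<Rightarrow> 'e::{banach, second_countable_topology}"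
    and S :: "'h::{real_inner, banach, second_countable_topology} \<times> 'e \<Rightarrow> 'h"
    and X :: "'h set"
    and K :: "'e set"
    and \<E> :: "(nat \<Rightarrow> 'e) set"
    and Q :: "(nat \<Rightarrow> 'e) \<Rightarrow> 'e measure"
    and \<iota> :: real
  assumes "prob_space M"
    and "stationary_process M \<eta>"
    and "K = msupport (distr M borel (\<eta> 0))"
    and "compact K"
    and "C2_bounded S"
    and "compact X" and "X \<noteq> {}"
    and "S ` (X \<times> K) \<subseteq> X"
    and "\<iota> > 1"
    and "\<E> = past_supp M \<eta>"
    and "conditional_law M \<eta> Q"
    and "hyp_SF \<iota> K \<E> Q"
    and "hyp_GD S"
    and "hyp_ALC S X K"
    and "hyp_DLP \<iota> \<E> Q"
    and "hyp_SRZ \<E> Q"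
  shows "\<exists>\<mu> \<in> prob_on X. \<exists>C>0. \<exists>\<gamma>>0. \<forall>u\<in>X. \<forall>k::nat.
           dual_lip_dist (distr M borel (\<lambda>\<omega>. traj S u (\<lambda>j. \<eta> (int j) \<omega>) k)) \<mu>
             \<le> C * exp (- \<gamma> * real k)"
proof -
  note M = \<open>prob_space M\<close> and st = \<open>stationary_process M \<eta>\<close> and cond = \<open>conditional_law M \<eta> Q\<close>
  interpret M: prob_space M by fact
  have QK: "Q \<xi> \<in> prob_on K" if "\<xi> \<in> \<E>" for \<xi>
    using \<open>hyp_SF \<iota> K \<E> Q\<close> that unfolding hyp_SF_def
    by (auto simp: continuous_map_def)
  obtain CV where CV: "0 < CV" "\<forall>\<xi>\<in>\<E>. \<forall>\<xi>'\<in>\<E>. var_dist (Q \<xi>) (Q \<xi>') \<le> CV * hist_dist \<iota> \<xi> \<xi>'"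
    using \<open>hyp_SF \<iota> K \<E> Q\<close> unfolding hyp_SF_def by (elim conjE exE) (rule that)
  have [measurable]: "\<eta> k \<in> borel_measurable M" for k using st by (simp add: stationary_process_def)
  have past [measurable]: "past \<eta> \<in> borel_measurable M" using past_measurable[OF st, of 0] by (simp add: past_def[abs_def])
  define \<sigma> where "\<sigma> = past_law M \<eta>"
  have \<sigma>: "prob_space \<sigma>" "sets \<sigma> = sets borel"
    unfolding \<sigma>_def past_law_def by (auto intro: M.prob_space_distr)
  have \<E>: "closed \<E>" "AE \<xi> in \<sigma>. \<xi> \<in> \<E>"
    using msupport_complement_null[OF \<sigma>(2)] assms(10) by (auto simp: past_supp_def \<sigma>_def)
  have "\<E> \<noteq> {}"
  proof
    assume "\<E> = {}"
    with \<E>(2) have "AE \<xi> in \<sigma>. False" by simp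
    then show False using prob_space.AE_False[OF \<sigma>(1)] by simp
  qed
  obtain R where R: "\<And>y. y \<in> K \<Longrightarrow> norm y \<le> R"
    using compact_imp_bounded[OF \<open>compact K\<close>] by (auto simp: bounded_iff)
  obtain S' where "\<And>z. (S has_derivative blinfun_apply (S' z)) (at z)"
    by (rule C2_estimates[OF \<open>C2_bounded S\<close>]) (rule that)
  then have S_cont: "continuous_on UNIV S"
    by (intro continuous_at_imp_continuous_on ballI has_derivative_continuous)
  interpret driven_chain S Q
    using S_cont cond by unfold_locales (simp_all add: conditional_law_def)
  have E_inv: "AE y in Q \<xi>. y \<in> K \<and> case_nat y \<xi> \<in> \<E>" if "\<xi> \<in> \<E>" for \<xi>
    unfolding assms(3) assms(10)
    by (rule past_supp_invariant[OF M st cond \<open>1 < \<iota>\<close>, of R CV])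
      (use R QK CV that in \<open>auto simp: assms(3,10)\<close>)
  have E_K: "\<xi> i \<in> K" if "\<xi> \<in> \<E>" for \<xi> i
    unfolding assms(3) by (rule past_supp_in_support[OF M st]) (use that assms(10) in simp)
  have "\<exists>\<kappa> C d0. 0 \<le> \<kappa> \<and> \<kappa> < 1 \<and> 0 \<le> C \<and> 0 < d0 \<and> (\<forall>u\<in>X. \<forall>u'\<in>X. norm (u - u') \<le> d0 \<longrightarrow>
    (\<exists>\<Phi>. continuous_on UNIV \<Phi> \<and> (\<forall>y\<in>K. norm (S (u, y) - S (u', \<Phi> y)) \<le> \<kappa> * norm (u - u')) \<and>
      (\<forall>y. norm (\<Phi> y - y) \<le> C * norm (u - u')) \<and>
      (\<forall>\<xi>\<in>\<E>. \<forall>g. g \<in> borel_measurable borel \<longrightarrow> (\<forall>y. g y \<le> 1) \<longrightarrow>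
         (\<integral>\<^sup>+y. g (\<Phi> y) \<partial>Q \<xi>) \<le> (\<integral>\<^sup>+y. g y \<partial>Q \<xi>) + ennreal (C * norm (u - u')))))"
    by (rule squeezing[OF \<open>C2_bounded S\<close> \<open>compact X\<close> \<open>compact K\<close> \<open>hyp_ALC S X K\<close> \<open>hyp_DLP \<iota> \<E> Q\<close> QK])
  then obtain \<kappa> C d0 where \<kappa>: "0 \<le> \<kappa>" "\<kappa> < 1" and C: "0 \<le> C" and d0: "0 < d0"
    and sq: "\<forall>u\<in>X. \<forall>u'\<in>X. norm (u - u') \<le> d0 \<longrightarrow>
    (\<exists>\<Phi>. continuous_on UNIV \<Phi> \<and> (\<forall>y\<in>K. norm (S (u, y) - S (u', \<Phi> y)) \<le> \<kappa> * norm (u - u')) \<and>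
      (\<forall>y. norm (\<Phi> y - y) \<le> C * norm (u - u')) \<and>
      (\<forall>\<xi>\<in>\<E>. \<forall>g. g \<in> borel_measurable borel \<longrightarrow> (\<forall>y. g y \<le> 1) \<longrightarrow>
         (\<integral>\<^sup>+y. g (\<Phi> y) \<partial>Q \<xi>) \<le> (\<integral>\<^sup>+y. g y \<partial>Q \<xi>) + ennreal (C * norm (u - u'))))"
    by (elim exE conjE) (rule that)
  interpret contracting_chain S Q X K \<E> \<iota> R C CV \<kappa> d0
  proof unfold_locales
    show "1 < \<iota>" by fact
    show "K \<in> sets borel" using compact_imp_closed[OF \<open>compact K\<close>] by auto
    show "\<E> \<in> sets borel" using \<E>(1) by auto
    show "S ` (X \<times> K) \<subseteq> X" by fact
    show "\<exists>\<Phi>. continuous_on UNIV \<Phi> \<and> (\<forall>y\<in>K. norm (S (u, y) - S (u', \<Phi> y)) \<le> \<kappa> * norm (u - u')) \<and>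
      (\<forall>y. norm (\<Phi> y - y) \<le> C * norm (u - u')) \<and>
      (\<forall>\<xi>\<in>\<E>. \<forall>g. g \<in> borel_measurable borel \<longrightarrow> (\<forall>y. g y \<le> 1) \<longrightarrow>
         (\<integral>\<^sup>+y. g (\<Phi> y) \<partial>Q \<xi>) \<le> (\<integral>\<^sup>+y. g y \<partial>Q \<xi>) + ennreal (C * norm (u - u')))"
      if "u \<in> X" "u' \<in> X" "norm (u - u') \<le> d0" for u u'
      using sq[THEN bspec, THEN bspec, THEN mp, OF that] .
  qed (use R E_K E_inv CV \<kappa> C d0 in auto)
  obtain \<theta> \<tau> m r where \<theta>: "0 < \<theta>" and \<tau>: "0 < \<tau>" "\<tau> \<le> 2" and m: "1 \<le> m" and r: "0 < r" "r < (1::real)"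
    and mix: "\<And>f k z z'. lip_fun \<theta> \<tau> 1 f \<Longrightarrow> z \<in> X \<times> \<E> \<Longrightarrow> z' \<in> X \<times> \<E> \<Longrightarrow> \<bar>(step ^^ k) f z - (step ^^ k) f z'\<bar> \<le> r ^ (k div m)"
    by (rule uniform_mixing[OF \<open>compact X\<close> \<open>X \<noteq> {}\<close> \<open>compact K\<close> \<open>hyp_GD S\<close> \<open>hyp_SRZ \<E> Q\<close> \<open>\<E> \<noteq> {}\<close>]) (rule that; assumption)
  define \<Lambda> where "\<Lambda> u k = distr M borel (\<lambda>\<omega>. traj S u (\<lambda>j. \<eta> (int j) \<omega>) k)" for u k
  have trM [measurable]: "(\<lambda>\<omega>. traj S u (\<lambda>j. \<eta> (int j) \<omega>) k) \<in> borel_measurable M" for u k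
    by (induction k) (auto intro!: S_measurable)
  have AEK: "AE \<omega> in M. \<forall>j. \<eta> (int j) \<omega> \<in> K"
    unfolding AE_all_countable assms(3) using AE_noise_in_support[OF M st] by blast
  have \<Lambda>: "\<Lambda> u k \<in> prob_on X" if "u \<in> X" for u k
  proof -
    have X: "X \<in> sets borel" using compact_imp_closed[OF \<open>compact X\<close>] by auto
    have "AE \<omega> in M. traj S u (\<lambda>j. \<eta> (int j) \<omega>) k \<in> X"
      using AEK by eventually_elim (rule traj_in[OF \<open>S ` (X \<times> K) \<subseteq> X\<close> that], simp)
    then have "AE x in \<Lambda> u k. x \<in> X" unfolding \<Lambda>_def using X by (subst AE_distr_iff) auto
    moreover have ps: "prob_space (\<Lambda> u k)" unfolding \<Lambda>_def by (rule M.prob_space_distr) simp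
    ultimately have "emeasure (\<Lambda> u k) X = 1"
      using X by (intro prob_space.emeasure_eq_1_AE) (auto simp: \<Lambda>_def)
    then show ?thesis using ps by (simp add: prob_on_def \<Lambda>_def)
  qed
  \<comment> \<open>One reference trajectory suffices: the limit point of its laws attracts the laws
    from every initial state.\<close>
  obtain u0 where u0: "u0 \<in> X" using \<open>X \<noteq> {}\<close> by auto
  obtain \<mu> l where \<mu>: "\<mu> \<in> prob_on X" and l: "strict_mono (l :: nat \<Rightarrow> nat)"
    and lim: "\<And>f B. continuous_on UNIV f \<Longrightarrow> (\<And>x. \<bar>f x\<bar> \<le> B) \<Longrightarrow> (\<lambda>n. \<integral>x. f x \<partial>\<Lambda> u0 (l n)) \<longlonglongrightarrow> (\<integral>x. (f x :: real) \<partial>\<mu>)"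
  proof (rule compact_weak_limit[OF \<open>compact X\<close>, of "\<Lambda> u0"])
    fix \<mu> r assume a: "\<mu> \<in> prob_on X" "strict_mono (r :: nat \<Rightarrow> nat)"
      and b: "\<And>f B. continuous_on UNIV f \<Longrightarrow> (\<And>x. \<bar>f x\<bar> \<le> B) \<Longrightarrow> (\<lambda>n. \<integral>x. f x \<partial>\<Lambda> u0 (r n)) \<longlonglongrightarrow> (\<integral>x. (f x :: real) \<partial>\<mu>)"
    show thesis by (rule that[OF a]) (rule b)
  qed (rule \<Lambda>[OF u0])
  have bound: "\<bar>(\<integral>x. f x \<partial>\<Lambda> u k) - (\<integral>x. f x \<partial>\<mu>)\<bar> \<le> 2 * r ^ (k div m)"
    if u: "u \<in> X" and f: "\<And>x. \<bar>f x\<bar> \<le> 1" "1-lipschitz_on UNIV f" for u k and f :: "'h \<Rightarrow> real"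
  proof -
    have fc: "continuous_on UNIV f" using f(2) by (rule lipschitz_on_continuous_on)
    have [measurable]: "f \<in> borel_measurable borel" using fc by (rule borel_measurable_continuous_onI)
    \<comment> \<open>An affine change brings values from [-1, 1] to [0, 1]; undoing it accounts for
      the factor 2 in the bound.\<close>
    define f1 where "f1 z = (f (fst z) + 1) / 2" for z :: "'h \<times> (nat \<Rightarrow> 'e)"
    have "0 \<le> f1 z \<and> f1 z \<le> 1" for z using f(1)[of "fst z"] by (simp add: f1_def abs_le_iff)
    moreover have "f1 \<in> borel_measurable borel" unfolding f1_def[abs_def] borel_prod[symmetric] by measurable
    ultimately have uf: "unit_fun f1" by (simp add: unit_fun_def)
    have lf: "lip_fun \<theta> \<tau> 1 f1"
      unfolding lip_fun_def
    proof (intro conjI ballI uf)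
      fix z z' assume z: "z \<in> X \<times> \<E>" "z' \<in> X \<times> \<E>"
      have "\<bar>f1 z - f1 z'\<bar> = \<bar>f (fst z) - f (fst z')\<bar> / 2" by (simp add: f1_def diff_divide_distrib[symmetric])
      moreover have "\<bar>f (fst z) - f (fst z')\<bar> \<le> norm (fst z - fst z')"
        using lipschitz_onD[OF f(2), of "fst z" "fst z'"] by (simp add: dist_norm)
      moreover have "\<bar>f (fst z) - f (fst z')\<bar> \<le> 2" using f(1)[of "fst z"] f(1)[of "fst z'"] by linarith
      moreover have "norm (fst z - fst z') / 2 \<le> dst \<theta> \<tau> z z'"
      proof -
        have h: "0 \<le> hist_dist \<iota> (snd z) (snd z')" using z by (intro hist_nonneg) auto
        have "norm (fst z - fst z') / 2 \<le> norm (fst z - fst z') / \<tau>" using \<tau> by (intro divide_left_mono) auto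
        also have "\<dots> \<le> dst \<theta> \<tau> z z'" unfolding dst_def using \<tau> \<theta> h by (intro divide_right_mono) auto
        finally show ?thesis .
      qed
      ultimately show "\<bar>f1 z - f1 z'\<bar> \<le> 1 * min 1 (dst \<theta> \<tau> z z')" by simp
    qed
    have law: "(\<integral>x. f x \<partial>\<Lambda> u k) = 2 * (\<integral>\<xi>. (step ^^ k) f1 (u, \<xi>) \<partial>\<sigma>) - 1" for u k
    proof -
      have "integrable M (\<lambda>\<omega>. f (traj S u (\<lambda>j. \<eta> (int j) \<omega>) k))"
        by (rule M.integrable_const_bound[of _ 1]) (auto simp: f(1))
      then have "(\<integral>\<omega>. f1 (traj S u (\<lambda>j. \<eta> (int j) \<omega>) k, (\<lambda>i. \<eta> (int k - int i) \<omega>)) \<partial>M)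
          = ((\<integral>\<omega>. f (traj S u (\<lambda>j. \<eta> (int j) \<omega>) k) \<partial>M) + 1) / 2"
        by (simp add: f1_def M.prob_space)
      moreover have "(\<integral>x. f x \<partial>\<Lambda> u k) = (\<integral>\<omega>. f (traj S u (\<lambda>j. \<eta> (int j) \<omega>) k) \<partial>M)"
        unfolding \<Lambda>_def by (rule integral_distr) simp_all
      ultimately show ?thesis using expectation_traj[OF M st cond uf, of u k] by (simp add: \<sigma>_def)
    qed
    have near: "\<bar>(\<integral>x. f x \<partial>\<Lambda> u k) - (\<integral>x. f x \<partial>\<Lambda> u0 (j + k))\<bar> \<le> 2 * r ^ (k div m)" for j
    proof -
      have "\<bar>(\<integral>\<xi>. (step ^^ k) f1 (u, \<xi>) \<partial>\<sigma>) - (\<integral>\<xi>. (step ^^ (j + k)) f1 (u0, \<xi>) \<partial>\<sigma>)\<bar> \<le> r ^ (k div m)"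
        by (rule integral_steps_near[OF \<sigma> \<E>(2) uf u u0]) (rule mix[OF lf]; assumption)
      then show ?thesis unfolding law by linarith
    qed
    \<comment> \<open>With k fixed, the later time runs to infinity along the subsequence, so the
      Cauchy estimate passes to the limit law.\<close>
    have lim': "(\<lambda>n. \<bar>(\<integral>x. f x \<partial>\<Lambda> u k) - (\<integral>x. f x \<partial>\<Lambda> u0 (l n))\<bar>) \<longlonglongrightarrow> \<bar>(\<integral>x. f x \<partial>\<Lambda> u k) - (\<integral>x. f x \<partial>\<mu>)\<bar>"
      by (intro tendsto_intros lim[OF fc f(1)])
    show ?thesis
    proof (rule LIMSEQ_le_const2[OF lim'], intro exI[of _ k] allI impI)
      fix n assume "k \<le> n"
      then have "k \<le> l n" using seq_suble[OF l, of n] by linarith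
      then show "\<bar>(\<integral>x. f x \<partial>\<Lambda> u k) - (\<integral>x. f x \<partial>\<Lambda> u0 (l n))\<bar> \<le> 2 * r ^ (k div m)"
        using near[of "l n - k"] by simp
    qed
  qed
  \<comment> \<open>Thus exp (- \<gamma> m) = r. Rounding k / m down loses at most one factor r,
    which is the 1 / r in the constant.\<close>
  define \<gamma> where "\<gamma> = - ln r / real m"
  have \<gamma>: "0 < \<gamma>" using r m by (simp add: \<gamma>_def divide_neg_pos)
  have rate: "r ^ (k div m) \<le> 1 / r * exp (- \<gamma> * real k)" for k
  proof -
    have "k < m * (k div m) + m" using m mod_less_divisor[of m k] mult_div_mod_eq[of m k] by linarith
    then have "real k \<le> real m * real (k div m) + real m"
      by (metis less_imp_le of_nat_add of_nat_le_iff of_nat_mult)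
    then have "\<gamma> * real k \<le> \<gamma> * (real m * real (k div m) + real m)" using \<gamma> by (intro mult_left_mono) auto
    also have "\<dots> = - ln r * real (k div m) - ln r" using m by (simp add: \<gamma>_def field_simps)
    finally have "real (k div m) * ln r \<le> - ln r - \<gamma> * real k" by (simp add: mult.commute)
    then have "exp (real (k div m) * ln r) \<le> exp (- ln r - \<gamma> * real k)" by simp
    also have "\<dots> = 1 / r * exp (- \<gamma> * real k)" using r by (simp add: exp_diff exp_minus field_simps)
    finally show ?thesis using r by (simp add: exp_of_nat_mult)
  qed
  have "dual_lip_dist (distr M borel (\<lambda>\<omega>. traj S u (\<lambda>j. \<eta> (int j) \<omega>) k)) \<mu> \<le> 2 / r * exp (- \<gamma> * real k)"
    if u: "u \<in> X" for u k
  proof -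
    have "dual_lip_dist (\<Lambda> u k) \<mu> \<le> 2 * r ^ (k div m)"
      unfolding dual_lip_dist_def
    proof (rule cSUP_least)
      show "{f :: 'h \<Rightarrow> real. (\<forall>x. \<bar>f x\<bar> \<le> 1) \<and> 1-lipschitz_on UNIV f} \<noteq> {}"
        unfolding ex_in_conv[symmetric] mem_Collect_eq
        by (intro exI[of _ "\<lambda>_. 0"] conjI allI lipschitz_onI) simp_all
    qed (use bound[OF u] in blast)
    also have "\<dots> \<le> 2 / r * exp (- \<gamma> * real k)" using rate[of k] by linarith
    finally show ?thesis
      by (simp add: \<Lambda>_def)
  qed
  moreover have "0 < 2 / r" using r by simp
  ultimately show ?thesis using \<mu> \<gamma> by blast
qed

end
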